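(* For every fixed $\epsilon>0$ there is an algorithm with quasi-polynomial running time (i.e., $2^{(\log n)^{O(1)}}$, where $n$ is the input size) that computes a $(1+\epsilon)$-approximate solution for UFP-cover, provided that the sizes of the tasks are in a quasi-polynomial range, i.e., all task sizes $p_i$ are positive integers bounded by $2^{(\log n)^{O(1)}}$.
   Context: UFP-cover (covering version of Unsplittable Flow on a Path): the input is a path $G=(V,E)$ where each edge $e$ has a demand $u_e\ge 0$, and a set $T$ of $n$ tasks; each task $i$ has a start vertex $s_i$, an end vertex $t_i$ (so it uses the subpath from $s_i$ to $t_i$), a size $p_i>0$ and a cost $c_i\ge 0$. For an edge $e$, let $T_e$ be the set of tasks whose path uses $e$. A subset $T'\subseteq T$ is feasible if $\sum_{i\in T'\cap T_e}p_i\ge u_e$ for every edge $e$. The goal is to find a feasible $T'$ minimizing $\sum_{i\in T'}c_i$. A $(1+\epsilon)$-approximation outputs a feasible set of cost at most $(1+\epsilon)$ times the optimum. *)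

theory Defs
  imports Complex_Main "HOL-Library.Log_Nat"
begin

section \<open>Machine model\<close>

text \<open>
  A first-order, call-by-value functional language on finite binary trees with natural numbers at
  the leaves. An execution is charged one unit per evaluated construct, and arithmetic is in
  addition charged the bit lengths of its operands (logarithmic cost criterion). Values can be
  kept as pointers into a shared heap, so that every unit of cost can be simulated by a Turing
  machine in time polynomial in the input size plus the cost accumulated so far; conversely the
  language simulates Turing machines with constant overhead per step. The quasi-polynomial time
  bounds of this model and of Turing machines therefore agree.
\<close>

datatype val = VNat nat | VPair val val

datatype unop = OFst | OSnd | OIsPair

datatype binop = OCons | OAdd | OSub | OMul | ODiv | OLess | OEq

datatype expr =
    Var nat
  | Const nat
  | Unary unop expr
  | Binary binop expr expr
  | LetIn expr expr
  | IfNonzero expr expr expr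
  | Call nat "expr list"

text \<open>
  A program is the list of the bodies of its (mutually recursive) functions; \<open>Call f es\<close> refers to
  the body at position \<open>f\<close>. Variables are positions in the environment, the most recently bound
  one first.
\<close>

type_synonym program = "expr list"

definition of_truth :: "bool \<Rightarrow> val" where
  "of_truth b = VNat (if b then 1 else 0)"

fun unop_sem :: "unop \<Rightarrow> val \<Rightarrow> val option" where
  "unop_sem OFst (VPair a b) = Some a"
| "unop_sem OSnd (VPair a b) = Some b"
| "unop_sem OIsPair (VPair a b) = Some (of_truth True)"
| "unop_sem OIsPair (VNat n) = Some (of_truth False)"
| "unop_sem _ _ = None"

fun binop_sem :: "binop \<Rightarrow> val \<Rightarrow> val \<Rightarrow> val option" where
  "binop_sem OCons a b = Some (VPair a b)"
| "binop_sem OAdd (VNat m) (VNat n) = Some (VNat (m + n))"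
| "binop_sem OSub (VNat m) (VNat n) = Some (VNat (m - n))"
| "binop_sem OMul (VNat m) (VNat n) = Some (VNat (m * n))"
| "binop_sem ODiv (VNat m) (VNat n) = Some (VNat (m div n))"
| "binop_sem OLess (VNat m) (VNat n) = Some (of_truth (m < n))"
| "binop_sem OEq (VNat m) (VNat n) = Some (of_truth (m = n))"
| "binop_sem _ _ _ = None"

fun leaf_bits :: "val \<Rightarrow> nat" where
  "leaf_bits (VNat n) = floorlog 2 n"
| "leaf_bits (VPair a b) = 0"

definition binop_cost :: "binop \<Rightarrow> val \<Rightarrow> val \<Rightarrow> nat" where
  "binop_cost f a b = (if f = OCons then 1 else 1 + leaf_bits a + leaf_bits b)"

text \<open>
  \<open>eval P env e v k\<close>: in program \<open>P\<close> and environment \<open>env\<close>, evaluation of \<open>e\<close> terminates with value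
  \<open>v\<close> at total cost \<open>k\<close>. Ill-typed operations, unbound variables and undefined functions are stuck.
\<close>

inductive eval :: "program \<Rightarrow> val list \<Rightarrow> expr \<Rightarrow> val \<Rightarrow> nat \<Rightarrow> bool"
  and evals :: "program \<Rightarrow> val list \<Rightarrow> expr list \<Rightarrow> val list \<Rightarrow> nat \<Rightarrow> bool"
  for P :: program
where
  eval_Var: "i < length env \<Longrightarrow> eval P env (Var i) (env ! i) 1"
| eval_Const: "eval P env (Const n) (VNat n) 1"
| eval_Un: "eval P env e a k \<Longrightarrow> unop_sem f a = Some v \<Longrightarrow> eval P env (Unary f e) v (k + 1)"
| eval_Bin: "eval P env e1 a k1 \<Longrightarrow> eval P env e2 b k2 \<Longrightarrow> binop_sem f a b = Some v \<Longrightarrow>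
    eval P env (Binary f e1 e2) v (k1 + k2 + binop_cost f a b)"
| eval_Let: "eval P env e1 a k1 \<Longrightarrow> eval P (a # env) e2 v k2 \<Longrightarrow>
    eval P env (LetIn e1 e2) v (k1 + k2 + 1)"
| eval_If_true: "eval P env e a k1 \<Longrightarrow> a \<noteq> VNat 0 \<Longrightarrow> eval P env e1 v k2 \<Longrightarrow>
    eval P env (IfNonzero e e1 e2) v (k1 + k2 + 1)"
| eval_If_false: "eval P env e (VNat 0) k1 \<Longrightarrow> eval P env e2 v k2 \<Longrightarrow>
    eval P env (IfNonzero e e1 e2) v (k1 + k2 + 1)"
| eval_Call: "f < length P \<Longrightarrow> evals P env es vs k1 \<Longrightarrow> eval P vs (P ! f) v k2 \<Longrightarrow>
    eval P env (Call f es) v (k1 + k2 + 1)"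
| evals_Nil: "evals P env [] [] 0"
| evals_Cons: "eval P env e v k1 \<Longrightarrow> evals P env es vs k2 \<Longrightarrow>
    evals P env (e # es) (v # vs) (k1 + k2)"

inductive_cases eval_VarE: "eval P env (Var i) v k"
inductive_cases eval_ConstE: "eval P env (Const n) v k"
inductive_cases eval_UnaryE: "eval P env (Unary f e) v k"
inductive_cases eval_BinaryE: "eval P env (Binary f e1 e2) v k"
inductive_cases eval_LetInE: "eval P env (LetIn e1 e2) v k"
inductive_cases eval_IfNonzeroE: "eval P env (IfNonzero e e1 e2) v k"
inductive_cases eval_CallE: "eval P env (Call f es) v k"
inductive_cases evals_NilE: "evals P env [] vs k"
inductive_cases evals_ConsE: "evals P env (e # es) vs k"

lemma eval_deterministic:
  "eval P env e v k \<Longrightarrow> eval P env e v' k' \<Longrightarrow> v' = v \<and> k' = k"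
  "evals P env es vs k \<Longrightarrow> evals P env es vs' k' \<Longrightarrow> vs' = vs \<and> k' = k"
proof (induction arbitrary: v' k' and vs' k' rule: eval_evals.inducts)
  case eval_Var then show ?case by (elim eval_VarE) simp
next
  case eval_Const then show ?case by (elim eval_ConstE) simp
next
  case eval_Un
  show ?case by (rule eval_UnaryE[OF eval_Un.prems]) (metis eval_Un.IH eval_Un.hyps option.inject Suc_eq_plus1)
next
  case eval_Bin
  show ?case
    by (rule eval_BinaryE[OF eval_Bin.prems]) (metis eval_Bin.IH eval_Bin.hyps option.inject Suc_eq_plus1)
next
  case eval_Let
  show ?case by (rule eval_LetInE[OF eval_Let.prems]) (metis eval_Let.IH Suc_eq_plus1)
next
  case eval_If_true
  show ?case
    by (rule eval_IfNonzeroE[OF eval_If_true.prems]) (metis eval_If_true.IH eval_If_true.hyps Suc_eq_plus1)+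
next
  case eval_If_false
  show ?case by (rule eval_IfNonzeroE[OF eval_If_false.prems]) (metis eval_If_false.IH Suc_eq_plus1)+
next
  case eval_Call
  show ?case by (rule eval_CallE[OF eval_Call.prems]) (metis eval_Call.IH Suc_eq_plus1)
next
  case evals_Nil then show ?case by (elim evals_NilE) simp
next
  case evals_Cons
  show ?case by (rule evals_ConsE[OF evals_Cons.prems]) (metis evals_Cons.IH Suc_eq_plus1)
qed

definition computes :: "program \<Rightarrow> val \<Rightarrow> val \<Rightarrow> nat \<Rightarrow> bool" where
  "computes P x y k \<longleftrightarrow> P \<noteq> [] \<and> eval P [x] (P ! 0) y k"

section \<open>Encoding of data\<close>

fun enc_list :: "val list \<Rightarrow> val" where
  "enc_list [] = VNat 0"
| "enc_list (v # vs) = VPair v (enc_list vs)"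

text \<open>Only used for nonnegative rationals: reduced numerator and denominator.\<close>

definition enc_rat :: "rat \<Rightarrow> val" where
  "enc_rat q = VPair (VNat (nat (fst (quotient_of q)))) (VNat (nat (snd (quotient_of q))))"

fun val_size :: "val \<Rightarrow> nat" where
  "val_size (VNat n) = 1 + floorlog 2 n"
| "val_size (VPair a b) = 1 + val_size a + val_size b"

definition encodes_set :: "val \<Rightarrow> nat set \<Rightarrow> bool" where
  "encodes_set v S \<longleftrightarrow> (\<exists>is. distinct is \<and> set is = S \<and> v = enc_list (map VNat is))"

section \<open>UFP-cover\<close>

text \<open>
  The path has the vertices \<open>0, \<dots>, m\<close>, where \<open>m\<close> is the number of demands, and edge \<open>e < m\<close> joins
  the vertices \<open>e\<close> and \<open>e + 1\<close>. Tasks are identified with their positions in the list of tasks.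
\<close>

record task =
  start_vertex :: nat
  end_vertex :: nat
  task_size :: rat
  task_cost :: rat

record ufp_instance =
  demands :: "rat list"
  tasks :: "task list"

definition valid_instance :: "ufp_instance \<Rightarrow> bool" where
  "valid_instance I \<longleftrightarrow>
     (\<forall>u \<in> set (demands I). u \<ge> 0) \<and>
     (\<forall>j \<in> set (tasks I). start_vertex j \<le> end_vertex j \<and> end_vertex j \<le> length (demands I) \<and>
        task_size j > 0 \<and> task_cost j \<ge> 0)"

definition task_indices :: "ufp_instance \<Rightarrow> nat set" where
  "task_indices I = {..<length (tasks I)}"

definition tasks_using :: "ufp_instance \<Rightarrow> nat \<Rightarrow> nat set" where
  "tasks_using I e =
     {i \<in> task_indices I. start_vertex (tasks I ! i) \<le> e \<and> e < end_vertex (tasks I ! i)}"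

definition feasible :: "ufp_instance \<Rightarrow> nat set \<Rightarrow> bool" where
  "feasible I S \<longleftrightarrow> S \<subseteq> task_indices I \<and>
     (\<forall>e < length (demands I).
        (\<Sum>i \<in> S \<inter> tasks_using I e. task_size (tasks I ! i)) \<ge> demands I ! e)"

definition total_cost :: "ufp_instance \<Rightarrow> nat set \<Rightarrow> rat" where
  "total_cost I S = (\<Sum>i \<in> S. task_cost (tasks I ! i))"

text \<open>Meaningful only if a feasible set exists.\<close>

definition opt_cost :: "ufp_instance \<Rightarrow> rat" where
  "opt_cost I = Min (total_cost I ` {S. feasible I S})"

definition approx_solution :: "real \<Rightarrow> ufp_instance \<Rightarrow> nat set \<Rightarrow> bool" where
  "approx_solution \<epsilon> I S \<longleftrightarrow>
     feasible I S \<and> real_of_rat (total_cost I S) \<le> (1 + \<epsilon>) * real_of_rat (opt_cost I)"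

definition enc_task :: "task \<Rightarrow> val" where
  "enc_task j = enc_list
     [VNat (start_vertex j), VNat (end_vertex j), enc_rat (task_size j), enc_rat (task_cost j)]"

definition enc_instance :: "ufp_instance \<Rightarrow> val" where
  "enc_instance I =
     VPair (enc_list (map enc_rat (demands I))) (enc_list (map enc_task (tasks I)))"

definition input_size :: "ufp_instance \<Rightarrow> nat" where
  "input_size I = val_size (enc_instance I)"

section \<open>Quasi-polynomial bounds\<close>

definition quasi_poly :: "(nat \<Rightarrow> real) \<Rightarrow> bool" where
  "quasi_poly f \<longleftrightarrow> (\<exists>k::nat. \<forall>\<^sub>F n in sequentially. f n \<le> 2 powr (log 2 (real n) ^ k))"

definition integral_sizes_upto :: "ufp_instance \<Rightarrow> real \<Rightarrow> bool" where
  "integral_sizes_upto I b \<longleftrightarrow>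
     (\<forall>j \<in> set (tasks I). task_size j \<in> \<int> \<and> real_of_rat (task_size j) \<le> b)"

end

theory Submission
  imports Defs "HOL-Library.Multiset" "HOL-Library.Sublist"
begin

text \<open>
  Split the path at its middle edge \<open>m\<close>. Every set \<open>Q\<close> of tasks that use \<open>m\<close> is dominated, at
  every edge, by a set of cost at most \<open>(1 + \<epsilon>)\<close> times that of \<open>Q\<close> which has a description of
  polylogarithmic length. Indeed, up to a negligible part \<open>Q\<close> consists of polylogarithmically many
  groups of nearly equal size and cost; within a group only the left and right end points matter, it
  suffices to keep these up to a small fraction of the group, and the loss is compensated by a few
  further tasks of the group that reach farthest to the left and to the right. Enumerating all
  descriptions and recursing into both halves of the path, with the chosen tasks credited against
  the demands, gives recursion depth \<open>log n\<close> and quasi-polynomial branching. The sets chosen at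
  different recursion nodes replace disjoint parts of an optimal solution, so the losses do not
  accumulate.
\<close>

section \<open>Polylogarithmic and quasi-polynomial growth\<close>

definition polylog :: "(nat \<Rightarrow> real) \<Rightarrow> bool" where
  "polylog f \<longleftrightarrow> (\<exists>k::nat. \<forall>\<^sub>F n in sequentially. f n \<le> log 2 (real n) ^ k)"

lemma eventually_le_log: "\<forall>\<^sub>F n in sequentially. c \<le> log 2 (real n)"
proof (rule eventually_sequentiallyI)
  fix n assume n: "nat \<lceil>2 powr c\<rceil> \<le> n"
  then have "2 powr c \<le> real n" by linarith
  moreover from this have "0 < real n" by (rule less_le_trans[rotated]) simp
  ultimately show "c \<le> log 2 (real n)" by (simp add: le_log_iff)
qed

lemma log_of_nat_nonneg: "0 \<le> log 2 (real n)"
  by (cases "n = 0") (auto simp: log_def)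

lemma polylog_const: "polylog (\<lambda>n. c)"
  unfolding polylog_def using eventually_le_log[of c] by (intro exI[of _ 1]) simp

lemma polylog_log: "polylog (\<lambda>n. log 2 (real n))"
  unfolding polylog_def by (intro exI[of _ 1]) simp

lemma polylog_mono:
  assumes "polylog g" "\<forall>\<^sub>F n in sequentially. f n \<le> g n"
  shows "polylog f"
proof -
  obtain k where "\<forall>\<^sub>F n in sequentially. g n \<le> log 2 (real n) ^ k"
    using assms(1) unfolding polylog_def by blast
  with assms(2) have "\<forall>\<^sub>F n in sequentially. f n \<le> log 2 (real n) ^ k"
    by eventually_elim simp
  then show ?thesis unfolding polylog_def by blast
qed

lemma polylog_add:
  assumes "polylog f" "polylog g"
  shows "polylog (\<lambda>n. f n + g n)"
proof -
  obtain j k where jk: "\<forall>\<^sub>F n in sequentially. f n \<le> log 2 (real n) ^ j"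
    "\<forall>\<^sub>F n in sequentially. g n \<le> log 2 (real n) ^ k"
    using assms unfolding polylog_def by blast
  have "\<forall>\<^sub>F n in sequentially. f n + g n \<le> log 2 (real n) ^ Suc (max j k)"
    using jk eventually_le_log[of 2]
  proof eventually_elim
    case (elim n)
    let ?l = "log 2 (real n)"
    have "?l ^ j \<le> ?l ^ max j k" "?l ^ k \<le> ?l ^ max j k"
      using elim(3) by (auto intro: power_increasing)
    then have "f n + g n \<le> 2 * ?l ^ max j k" using elim by linarith
    also have "\<dots> \<le> ?l * ?l ^ max j k" using elim(3) by (intro mult_right_mono) auto
    finally show ?case by simp
  qed
  then show ?thesis unfolding polylog_def by blast
qed

lemma polylog_mult:
  assumes "polylog f" "polylog g" and nonneg: "\<And>n. 0 \<le> g n"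
  shows "polylog (\<lambda>n. f n * g n)"
proof -
  obtain j k where jk: "\<forall>\<^sub>F n in sequentially. f n \<le> log 2 (real n) ^ j"
    "\<forall>\<^sub>F n in sequentially. g n \<le> log 2 (real n) ^ k"
    using assms unfolding polylog_def by blast
  have "\<forall>\<^sub>F n in sequentially. f n * g n \<le> log 2 (real n) ^ (j + k)"
    using jk
  proof eventually_elim
    case (elim n)
    then show ?case
      using nonneg[of n] log_of_nat_nonneg[of n] unfolding power_add by (intro mult_mono) auto
  qed
  then show ?thesis unfolding polylog_def by blast
qed

lemma quasi_polyE:
  assumes "quasi_poly f"
  obtains g where "polylog g" "\<And>n. 0 \<le> g n" "\<forall>\<^sub>F n in sequentially. f n \<le> 2 powr g n"
proof -
  obtain k where "\<forall>\<^sub>F n in sequentially. f n \<le> 2 powr (log 2 (real n) ^ k)"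
    using assms unfolding quasi_poly_def by blast
  moreover have "polylog (\<lambda>n. log 2 (real n) ^ k)" unfolding polylog_def by (intro exI[of _ k]) simp
  ultimately show ?thesis using that[of "\<lambda>n. log 2 (real n) ^ k"] log_of_nat_nonneg by simp
qed

lemma quasi_polyI:
  assumes "polylog g" "\<forall>\<^sub>F n in sequentially. f n \<le> 2 powr g n"
  shows "quasi_poly f"
proof -
  obtain k where "\<forall>\<^sub>F n in sequentially. g n \<le> log 2 (real n) ^ k"
    using assms(1) unfolding polylog_def by blast
  with assms(2) have "\<forall>\<^sub>F n in sequentially. f n \<le> 2 powr (log 2 (real n) ^ k)"
  proof eventually_elim
    case (elim n)
    have "2 powr g n \<le> 2 powr (log 2 (real n) ^ k)" using elim(2) by simp
    then show ?case using elim(1) by linarith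
  qed
  then show ?thesis unfolding quasi_poly_def by blast
qed

lemma quasi_poly_of_polylog:
  assumes "polylog (\<lambda>n. real (f n))"
  shows "quasi_poly (\<lambda>n. real (f n))"
proof (rule quasi_polyI[OF assms])
  show "\<forall>\<^sub>F n in sequentially. real (f n) \<le> 2 powr real (f n)"
    by (simp add: powr_realpow less_imp_le of_nat_less_two_power)
qed

lemma quasi_poly_const: "quasi_poly (\<lambda>n. c)"
proof (rule quasi_polyI[OF polylog_const])
  have "c \<le> 2 powr max 0 (log 2 c)"
  proof (cases "0 < c")
    case True
    then have "c = 2 powr log 2 c" by simp
    also have "\<dots> \<le> 2 powr max 0 (log 2 c)" by (intro powr_mono) auto
    finally show ?thesis .
  next
    case False
    then show ?thesis by (intro order_trans[OF _ powr_ge_zero]) simp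
  qed
  then show "\<forall>\<^sub>F n in sequentially. c \<le> 2 powr max 0 (log 2 c)" by simp
qed

lemma quasi_poly_of_nat: "quasi_poly real"
proof (rule quasi_polyI[OF polylog_log])
  show "\<forall>\<^sub>F n in sequentially. real n \<le> 2 powr log 2 (real n)"
    using eventually_gt_at_top[of 0] by eventually_elim simp
qed

lemma quasi_poly_add:
  assumes "quasi_poly f" "quasi_poly g"
  shows "quasi_poly (\<lambda>n. f n + g n)"
proof -
  obtain f' where f': "polylog f'" "\<And>n. 0 \<le> f' n" "\<forall>\<^sub>F n in sequentially. f n \<le> 2 powr f' n"
    using assms(1) by (rule quasi_polyE) blast
  obtain g' where g': "polylog g'" "\<And>n. 0 \<le> g' n" "\<forall>\<^sub>F n in sequentially. g n \<le> 2 powr g' n"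
    using assms(2) by (rule quasi_polyE) blast
  show ?thesis
  proof (rule quasi_polyI)
    show "polylog (\<lambda>n. f' n + g' n + 1)" using f'(1) g'(1) by (intro polylog_add polylog_const)
    show "\<forall>\<^sub>F n in sequentially. f n + g n \<le> 2 powr (f' n + g' n + 1)"
      using f'(3) g'(3)
    proof eventually_elim
      case (elim n)
      have "2 powr f' n \<le> 2 powr (f' n + g' n)" "2 powr g' n \<le> 2 powr (f' n + g' n)"
        using f'(2)[of n] g'(2)[of n] by (auto intro: powr_mono)
      then have "f n + g n \<le> 2 powr (f' n + g' n) * 2" using elim by linarith
      then show ?case by (simp only: powr_add powr_one)
    qed
  qed
qed

lemma quasi_poly_mult:
  assumes "quasi_poly f" "quasi_poly g" and nonneg: "\<And>n. 0 \<le> g n"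
  shows "quasi_poly (\<lambda>n. f n * g n)"
proof -
  obtain f' where f': "polylog f'" "\<forall>\<^sub>F n in sequentially. f n \<le> 2 powr f' n"
    using assms(1) by (rule quasi_polyE) blast
  obtain g' where g': "polylog g'" "\<forall>\<^sub>F n in sequentially. g n \<le> 2 powr g' n"
    using assms(2) by (rule quasi_polyE) blast
  show ?thesis
  proof (rule quasi_polyI[OF polylog_add[OF f'(1) g'(1)]])
    show "\<forall>\<^sub>F n in sequentially. f n * g n \<le> 2 powr (f' n + g' n)"
      using f'(2) g'(2) by eventually_elim (auto simp: powr_add nonneg intro: mult_mono)
  qed
qed

lemma quasi_poly_power:
  assumes "quasi_poly f" "polylog (\<lambda>n. real (e n))" and nonneg: "\<And>n. 0 \<le> f n"
  shows "quasi_poly (\<lambda>n. f n ^ e n)"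
proof -
  obtain f' where f': "polylog f'" "\<forall>\<^sub>F n in sequentially. f n \<le> 2 powr f' n"
    using assms(1) by (rule quasi_polyE) blast
  have "polylog (\<lambda>n. f' n * real (e n))" using f'(1) assms(2) by (rule polylog_mult) simp
  moreover have "\<forall>\<^sub>F n in sequentially. f n ^ e n \<le> 2 powr (f' n * real (e n))"
    using f'(2)
  proof eventually_elim
    case (elim n)
    then have "f n ^ e n \<le> (2 powr f' n) ^ e n" using nonneg by (rule power_mono)
    then show ?case by (simp add: powr_powr flip: powr_realpow)
  qed
  ultimately show ?thesis by (rule quasi_polyI)
qed

lemma quasi_poly_nat_floor:
  assumes "quasi_poly f"
  shows "quasi_poly (\<lambda>n. real (nat \<lfloor>f n\<rfloor>))"
proof -
  obtain g where g: "polylog g" "\<forall>\<^sub>F n in sequentially. f n \<le> 2 powr g n"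
    using assms by (rule quasi_polyE) blast
  have "real (nat \<lfloor>x\<rfloor>) \<le> y" if "x \<le> y" "0 \<le> y" for x y :: real using that by linarith
  then have "\<forall>\<^sub>F n in sequentially. real (nat \<lfloor>f n\<rfloor>) \<le> 2 powr g n"
    using g(2) by (auto elim: eventually_mono)
  with g(1) show ?thesis by (rule quasi_polyI)
qed

lemma less_power_floorlog: "n < 2 ^ floorlog 2 n"
  by (rule floorlog_leD[OF order_refl]) simp

lemma floorlog_le_powr:
  assumes "real n \<le> 2 powr x" "0 \<le> x"
  shows "real (floorlog 2 n) \<le> x + 1"
proof (cases "n = 0")
  case False
  then have "log 2 (real n) \<le> x" using assms(1) by (simp add: log_le_iff)
  moreover have "real (floorlog 2 n) = real_of_int \<lfloor>log 2 (real n)\<rfloor> + 1"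
    using False by (simp add: floorlog_def)
  ultimately show ?thesis by linarith
qed (use assms in \<open>simp add: floorlog_def\<close>)

lemma polylog_floorlog:
  assumes "quasi_poly (\<lambda>n. real (f n))"
  shows "polylog (\<lambda>n. real (floorlog 2 (f n)))"
proof -
  obtain g where g: "polylog g" "\<And>n. 0 \<le> g n" "\<forall>\<^sub>F n in sequentially. real (f n) \<le> 2 powr g n"
    using assms by (rule quasi_polyE) blast
  show ?thesis
  proof (rule polylog_mono)
    show "polylog (\<lambda>n. g n + 1)" using g(1) polylog_const by (rule polylog_add)
    show "\<forall>\<^sub>F n in sequentially. real (floorlog 2 (f n)) \<le> g n + 1"
      using g(3) by eventually_elim (rule floorlog_le_powr[OF _ g(2)])
  qed
qed

section \<open>Ranks\<close>

text \<open>Ranks count the elements that are less than or equal, so that large blocks of equal values do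
  no harm.\<close>

definition rank :: "('a \<Rightarrow> 'b::linorder) \<Rightarrow> 'a set \<Rightarrow> 'a \<Rightarrow> nat" where
  "rank f Q t = card {z \<in> Q. f z \<le> f t}"

lemma finite_obtains_max:
  fixes f :: "'a \<Rightarrow> 'b::linorder"
  assumes "finite A" "A \<noteq> {}"
  obtains x where "x \<in> A" "\<And>y. y \<in> A \<Longrightarrow> f y \<le> f x"
  using obtains_MAX[OF assms, of f] assms(1) by (metis Max_ge finite_imageI imageI)

lemma finite_obtains_min:
  fixes f :: "'a \<Rightarrow> 'b::linorder"
  assumes "finite A" "A \<noteq> {}"
  obtains x where "x \<in> A" "\<And>y. y \<in> A \<Longrightarrow> f x \<le> f y"
  using arg_min_if_finite(1)[OF assms] arg_min_least[OF assms] by metis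

lemma rank_mono: "finite Q \<Longrightarrow> f s \<le> f t \<Longrightarrow> rank f Q s \<le> rank f Q t"
  unfolding rank_def by (intro card_mono) auto

lemma rank_le_card: "finite Q \<Longrightarrow> rank f Q t \<le> card Q"
  unfolding rank_def by (intro card_mono) auto

lemma le_of_rank_eq:
  assumes "finite Q" "x \<in> Q" "rank f Q y = rank f Q x"
  shows "f x \<le> f y"
proof (rule ccontr)
  assume "\<not> f x \<le> f y"
  then have "{z \<in> Q. f z \<le> f y} \<subset> {z \<in> Q. f z \<le> f x}" using assms(2) by auto
  then have "rank f Q y < rank f Q x"
    unfolding rank_def using assms(1) by (intro psubset_card_mono) auto
  then show False using assms(3) by simp
qed

lemma rank_div_eq_of_between:
  assumes "finite Q" "f s \<le> f t" "f t \<le> f s'" "rank f Q s div d = rank f Q s' div d"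
  shows "rank f Q t div d = rank f Q s div d"
  using assms div_le_mono[OF rank_mono[of Q f s t], of d]
    div_le_mono[OF rank_mono[of Q f t s'], of d]
  by simp

lemma diff_less_of_div_eq:
  fixes a b d :: nat
  assumes "0 < d" "a div d = b div d"
  shows "a - b < d"
proof -
  have "a < d * (b div d) + d" using dividend_less_times_div[OF assms(1), of a] assms(2) by simp
  also have "\<dots> \<le> b + d" by simp
  finally show ?thesis using assms(1) by linarith
qed

lemma card_upper_less_of_rank_div_eq:
  fixes f :: "'a \<Rightarrow> 'b::linorder"
  assumes fin: "finite Q" and \<phi>: "bij_betw \<phi> Q R" and d: "0 < d"
    and rank: "\<And>x. x \<in> Q \<Longrightarrow> rank f Q (\<phi> x) div d = rank f Q x div d"
  shows "card {x \<in> Q. \<theta> \<le> f x} < card {y \<in> R. \<theta> \<le> f y} + d"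
proof -
  let ?lost = "{x \<in> Q. \<theta> \<le> f x \<and> f (\<phi> x) < \<theta>}"
  have lost: "card ?lost < d"
  proof (cases "?lost = {}")
    case True
    show ?thesis unfolding True using d by simp
  next
    case False
    have "finite ?lost" using fin by simp
    from this False obtain x where x: "x \<in> ?lost" "\<And>y. y \<in> ?lost \<Longrightarrow> f y \<le> f x"
      by (rule finite_obtains_max[where f = f]) blast
    let ?lo = "{z \<in> Q. f z \<le> f (\<phi> x)}" and ?hi = "{z \<in> Q. f z \<le> f x}"
    have "?lost \<subseteq> ?hi - ?lo" using x by fastforce
    then have "card ?lost \<le> card (?hi - ?lo)" using fin by (intro card_mono) auto
    also have "\<dots> = rank f Q x - rank f Q (\<phi> x)"
      unfolding rank_def using x(1) fin by (intro card_Diff_subset) auto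
    also have "\<dots> < d" using d rank x(1) by (intro diff_less_of_div_eq) auto
    finally show ?thesis .
  qed
  have "{x \<in> Q. \<theta> \<le> f x} \<subseteq> {x \<in> Q. \<theta> \<le> f (\<phi> x)} \<union> ?lost" by auto
  then have "card {x \<in> Q. \<theta> \<le> f x} \<le> card ({x \<in> Q. \<theta> \<le> f (\<phi> x)} \<union> ?lost)"
    using fin by (intro card_mono) auto
  also have "\<dots> \<le> card {x \<in> Q. \<theta> \<le> f (\<phi> x)} + card ?lost" by (rule card_Un_le)
  also have "card {x \<in> Q. \<theta> \<le> f (\<phi> x)} = card {y \<in> R. \<theta> \<le> f y}"
  proof (rule bij_betw_same_card)
    show "bij_betw \<phi> {x \<in> Q. \<theta> \<le> f (\<phi> x)} {y \<in> R. \<theta> \<le> f y}"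
      using \<phi> by (rule bij_betw_subset) (use \<phi> in \<open>auto simp: bij_betw_def\<close>)
  qed
  finally show ?thesis using lost by linarith
qed

lemma ex_nth_largest:
  fixes f :: "'a \<Rightarrow> 'b::linorder"
  assumes fin: "finite U" and n: "0 < n" "n \<le> card U"
  shows "\<exists>t\<in>U. card {s \<in> U. f t < f s} < n \<and> n \<le> card {s \<in> U. f t \<le> f s}"
proof -
  let ?R = "{t \<in> U. n \<le> card {s \<in> U. f t \<le> f s}}"
  have "U \<noteq> {}" using n by auto
  with fin obtain u where u: "u \<in> U" "\<And>s. s \<in> U \<Longrightarrow> f u \<le> f s"
    by (rule finite_obtains_min[where f = f]) blast
  then have "{s \<in> U. f u \<le> f s} = U" by blast
  then have "finite ?R" "?R \<noteq> {}" using fin u(1) n(2) by auto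
  then obtain t where t: "t \<in> ?R" "\<And>s. s \<in> ?R \<Longrightarrow> f s \<le> f t"
    by (rule finite_obtains_max[where f = f]) blast
  have "card {s \<in> U. f t < f s} < n"
  proof (cases "{s \<in> U. f t < f s} = {}")
    case True
    show ?thesis unfolding True using n(1) by simp
  next
    case False
    have "finite {s \<in> U. f t < f s}" using fin by simp
    from this False obtain v where v: "v \<in> {s \<in> U. f t < f s}"
      "\<And>s. s \<in> {s \<in> U. f t < f s} \<Longrightarrow> f v \<le> f s" by (rule finite_obtains_min[where f = f]) blast
    then have "{s \<in> U. f t < f s} = {s \<in> U. f v \<le> f s}" by (auto dest: less_le_trans)
    moreover have "v \<notin> ?R" using v(1) t(2)[of v] by auto
    ultimately show ?thesis using v(1) by auto
  qed
  then show ?thesis using t(1) by blast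
qed

lemma ex_bij_betw_fibres:
  assumes fin: "finite A" "finite B"
    and card: "\<And>l. card {a \<in> A. f a = l} = card {b \<in> B. g b = l}"
  shows "\<exists>\<phi>. bij_betw \<phi> A B \<and> (\<forall>a\<in>A. g (\<phi> a) = f a)"
proof -
  have "\<exists>\<psi>. bij_betw \<psi> {a \<in> A. f a = l} {b \<in> B. g b = l}" for l
    using fin card by (intro finite_same_card_bij) auto
  then obtain \<psi> where \<psi>: "\<And>l. bij_betw (\<psi> l) {a \<in> A. f a = l} {b \<in> B. g b = l}" by metis
  have maps: "\<psi> (f a) a \<in> B \<and> g (\<psi> (f a) a) = f a" if "a \<in> A" for a
    using bij_betwE[OF \<psi>[of "f a"]] that by auto
  have "bij_betw (\<lambda>a. \<psi> (f a) a) A B"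
  proof (rule bij_betw_imageI)
    show "inj_on (\<lambda>a. \<psi> (f a) a) A"
    proof (rule inj_onI)
      fix a b assume ab: "a \<in> A" "b \<in> A" "\<psi> (f a) a = \<psi> (f b) b"
      then have "f a = f b" using maps by metis
      then show "a = b" using ab bij_betw_imp_inj_on[OF \<psi>[of "f a"]] by (auto dest: inj_onD)
    qed
    show "(\<lambda>a. \<psi> (f a) a) ` A = B"
    proof
      show "B \<subseteq> (\<lambda>a. \<psi> (f a) a) ` A"
      proof
        fix b assume "b \<in> B"
        then have "b \<in> \<psi> (g b) ` {a \<in> A. f a = g b}"
          using bij_betw_imp_surj_on[OF \<psi>[of "g b"]] by blast
        then show "b \<in> (\<lambda>a. \<psi> (f a) a) ` A" by force
      qed
    qed (use maps in auto)
  qed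
  then show ?thesis using maps by blast
qed

lemma sum_upper_le_of_bij_betw:
  fixes f :: "'a \<Rightarrow> 'b::linorder" and p :: "'a \<Rightarrow> nat"
  assumes fin: "finite Q" and \<phi>: "bij_betw \<phi> Q R"
    and le: "\<And>x. x \<in> Q \<Longrightarrow> f x \<le> f (\<phi> x) \<and> p x \<le> p (\<phi> x)"
  shows "(\<Sum>x | x \<in> Q \<and> \<theta> \<le> f x. p x) \<le> (\<Sum>y | y \<in> R \<and> \<theta> \<le> f y. p y)"
proof -
  have "(\<Sum>x | x \<in> Q \<and> \<theta> \<le> f x. p x) = (\<Sum>x\<in>Q. if \<theta> \<le> f x then p x else 0)"
    using fin by (rule sum.inter_filter)
  also have "\<dots> \<le> (\<Sum>x\<in>Q. if \<theta> \<le> f (\<phi> x) then p (\<phi> x) else 0)"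
    using le by (intro sum_mono) (force intro: order_trans)
  also have "\<dots> = (\<Sum>y\<in>R. if \<theta> \<le> f y then p y else 0)"
    by (rule sum.reindex_bij_betw[OF \<phi>])
  also have "\<dots> = (\<Sum>y | y \<in> R \<and> \<theta> \<le> f y. p y)"
    using bij_betw_finite[OF \<phi>] fin by (intro sum.inter_filter[symmetric]) simp
  finally show ?thesis .
qed

text \<open>The matching loses fewer than \<open>d\<close> elements above the threshold and the weights lose at most
  \<open>2 d\<close> times the least weight; the \<open>3 d\<close> elements of \<open>E\<close> make up for both.\<close>

lemma sum_upper_le_of_compensation:
  fixes f :: "'a \<Rightarrow> 'b::linorder" and p :: "'a \<Rightarrow> nat"
  assumes fin: "finite Q" "finite E" and \<phi>: "bij_betw \<phi> Q R"
    and d: "0 < d" "card Q \<le> 2 * d * D" and D: "0 < D"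
    and rank: "\<And>x. x \<in> Q \<Longrightarrow> rank f Q (\<phi> x) div d = rank f Q x div d"
    and E: "R \<inter> E = {}" "3 * d \<le> card {t \<in> E. \<theta> \<le> f t}"
    and p: "\<And>x. x \<in> Q \<Longrightarrow> D * p x \<le> (D + 1) * w" "\<And>y. y \<in> R \<union> E \<Longrightarrow> w \<le> p y"
  shows "(\<Sum>x | x \<in> Q \<and> \<theta> \<le> f x. p x) \<le> (\<Sum>y | y \<in> R \<union> E \<and> \<theta> \<le> f y. p y)"
proof -
  define n where "n = card {x \<in> Q. \<theta> \<le> f x}"
  have finR: "finite R" using bij_betw_finite[OF \<phi>] fin(1) by simp
  have "n < card {y \<in> R. \<theta> \<le> f y} + d"
    unfolding n_def using fin(1) \<phi> d(1) rank by (rule card_upper_less_of_rank_div_eq)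
  moreover have "card {y \<in> R \<union> E. \<theta> \<le> f y} = card {y \<in> R. \<theta> \<le> f y} + card {y \<in> E. \<theta> \<le> f y}"
  proof -
    have "{y \<in> R \<union> E. \<theta> \<le> f y} = {y \<in> R. \<theta> \<le> f y} \<union> {y \<in> E. \<theta> \<le> f y}" by auto
    then show ?thesis using E(1) fin(2) finR by (simp add: card_Un_disjoint disjoint_iff)
  qed
  ultimately have cards: "n + 2 * d \<le> card {y \<in> R \<union> E. \<theta> \<le> f y}" using E(2) by linarith
  have "n \<le> card Q" unfolding n_def using fin(1) by (intro card_mono) auto
  with d(2) have n: "n \<le> D * (2 * d)" by (simp add: ac_simps)
  have "D * (\<Sum>x | x \<in> Q \<and> \<theta> \<le> f x. p x) \<le> n * ((D + 1) * w)"
    unfolding sum_distrib_left n_def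
    using sum_bounded_above[of "{x \<in> Q. \<theta> \<le> f x}" "\<lambda>x. D * p x" "(D + 1) * w"] p(1) by auto
  also have "\<dots> = D * (n * w) + n * w" by (simp add: algebra_simps)
  also have "\<dots> \<le> D * (n * w) + D * (2 * d) * w" using n by (intro add_mono mult_le_mono1) auto
  also have "\<dots> = D * ((n + 2 * d) * w)" by (simp add: algebra_simps)
  also have "\<dots> \<le> D * (card {y \<in> R \<union> E. \<theta> \<le> f y} * w)"
    using cards by (intro mult_le_mono2 mult_le_mono1)
  also have "\<dots> \<le> D * (\<Sum>y | y \<in> R \<union> E \<and> \<theta> \<le> f y. p y)"
    using sum_bounded_below[of "{y \<in> R \<union> E. \<theta> \<le> f y}" w p] p(2) by (intro mult_le_mono2) auto
  finally show ?thesis using D by simp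
qed

lemma sum_le_of_card_le:
  fixes c :: "'a \<Rightarrow> nat"
  assumes card: "D * card S \<le> (D + a) * card Q"
    and c: "\<And>s. s \<in> S \<Longrightarrow> D * c s \<le> (D + 1) * w" "\<And>q. q \<in> Q \<Longrightarrow> w \<le> c q"
  shows "D * D * sum c S \<le> (D + 1) * (D + a) * sum c Q"
proof -
  have "D * D * sum c S = D * (\<Sum>s\<in>S. D * c s)" by (simp add: sum_distrib_left mult.assoc)
  also have "\<dots> \<le> D * (card S * ((D + 1) * w))"
    using sum_bounded_above[of S "\<lambda>s. D * c s" "(D + 1) * w"] c(1) by (intro mult_le_mono2) auto
  also have "\<dots> = D * card S * ((D + 1) * w)" by (simp only: mult.assoc)
  also have "\<dots> \<le> (D + a) * card Q * ((D + 1) * w)" using card by (rule mult_le_mono1)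
  also have "\<dots> = (D + 1) * (D + a) * (card Q * w)" by (simp only: mult_ac)
  also have "\<dots> \<le> (D + 1) * (D + a) * sum c Q"
    using sum_bounded_below[of Q w c] c(2) by (intro mult_le_mono2) auto
  finally show ?thesis .
qed

section \<open>Searching sets of tasks\<close>

text \<open>From now on a task is the list of its start vertex, end vertex, size, cost (scaled to an
  integer) and position in the instance.\<close>

type_synonym row = "nat list"

abbreviation (input) "row_start t \<equiv> t ! 0"
abbreviation (input) "row_end t \<equiv> t ! 1"
abbreviation (input) "row_size t \<equiv> t ! 2"
abbreviation (input) "row_cost t \<equiv> t ! 3"
abbreviation (input) "row_index t \<equiv> t ! 4"

definition key :: "nat \<Rightarrow> row \<Rightarrow> int" where
  "key op t = (if op < 4 then int (t ! op) else - int (t ! (op - 4)))"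

text \<open>The state \<open>(W, N, S)\<close> splits the tasks into the current candidates \<open>W\<close>, the other unselected
  tasks \<open>N\<close>, and the selected tasks \<open>S\<close>. An instruction either restricts the candidates by comparing
  a key with that of a pivot task, or selects a number of candidates and makes all unselected tasks
  candidates again. Its argument is encoded by a suffix of the list of tasks, as the head or the
  length of that suffix.\<close>

type_synonym state = "row list \<times> row list \<times> row list"

fun apply_instr :: "nat \<Rightarrow> row list \<Rightarrow> state \<Rightarrow> state" where
  "apply_instr op ts (W, N, S) =
     (if op < 8 then
        (filter (\<lambda>t. key op (hd ts) \<le> key op t) W,
         filter (\<lambda>t. \<not> key op (hd ts) \<le> key op t) W @ N, S)
      else (drop (length ts) W @ N, [], rev (take (length ts) W) @ S))"

fun state_tasks :: "state \<Rightarrow> row list" where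
  "state_tasks (W, N, S) = W @ N @ S"

fun selected :: "state \<Rightarrow> row list" where
  "selected (W, N, S) = S"

definition move :: "row list \<Rightarrow> state \<Rightarrow> state \<Rightarrow> bool" where
  "move TM st st' \<longleftrightarrow> (\<exists>op<9. \<exists>ts. ts \<noteq> [] \<and> suffix ts TM \<and> st' = apply_instr op ts st)"

definition moves :: "row list \<Rightarrow> nat \<Rightarrow> state \<Rightarrow> state \<Rightarrow> bool" where
  "moves TM k = (move TM)\<^sup>=\<^sup>= ^^ k"

lemma mset_state_tasks_apply_instr:
  "mset (state_tasks (apply_instr op ts st)) = mset (state_tasks st)"
proof (cases st)
  case (fields W N S)
  have "mset (take k W) + mset (drop k W) = mset W" for k
    by (metis append_take_drop_id mset_append)
  then show ?thesis using fields by (auto simp: ac_simps)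
qed

lemma moves_0 [simp]: "moves TM 0 st st' \<longleftrightarrow> st = st'"
  by (simp add: moves_def)

lemma moves_Suc:
  "moves TM (Suc k) st st' \<longleftrightarrow> moves TM k st st' \<or> (\<exists>st1. move TM st st1 \<and> moves TM k st1 st')"
  unfolding moves_def relpowp_Suc_left by auto

lemma moves_add: "moves TM j st st' \<Longrightarrow> moves TM k st' st'' \<Longrightarrow> moves TM (j + k) st st''"
  unfolding moves_def relpowp_add by auto

lemma moves_refl: "moves TM k st st"
  by (induction k) (simp_all add: moves_Suc)

lemma moves_mono: "moves TM j st st' \<Longrightarrow> j \<le> k \<Longrightarrow> moves TM k st st'"
  using moves_add[of TM j st st' "k - j" st'] moves_refl by simp

lemma moves_filter:
  assumes "op < 8" "piv \<in> set TM"
  shows "moves TM 1 (W, N, S)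
    (filter (\<lambda>t. key op piv \<le> key op t) W, filter (\<lambda>t. \<not> key op piv \<le> key op t) W @ N, S)"
proof -
  obtain us ts where "TM = us @ piv # ts" using assms(2) by (meson split_list)
  then have "piv # ts \<noteq> []" "suffix (piv # ts) TM" by (auto simp: suffix_def)
  then have "move TM (W, N, S) (apply_instr op (piv # ts) (W, N, S))"
    unfolding move_def using assms(1) by (intro exI[of _ op]) auto
  then show ?thesis using assms(1) by (simp add: moves_Suc)
qed

lemma moves_pick:
  assumes "0 < j" "j \<le> length TM"
  shows "moves TM 1 (W, N, S) (drop j W @ N, [], rev (take j W) @ S)"
proof -
  define ts where "ts = drop (length TM - j) TM"
  have ts: "length ts = j" "suffix ts TM" using assms(2) by (auto simp: ts_def suffix_drop)
  then have "move TM (W, N, S) (apply_instr 8 ts (W, N, S))"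
    unfolding move_def using assms(1) by (intro exI[of _ 8]) auto
  then show ?thesis using ts(1) by (simp add: moves_Suc)
qed

lemma mset_state_tasks_moves: "moves TM k st st' \<Longrightarrow> mset (state_tasks st') = mset (state_tasks st)"
proof (induction k arbitrary: st)
  case (Suc k)
  then have "mset (state_tasks st') = mset (state_tasks st1)" if "moves TM k st1 st'" for st1
    using that by blast
  then show ?case using Suc.prems mset_state_tasks_apply_instr unfolding moves_Suc move_def by metis
qed simp

type_synonym result = "(nat \<times> row list) option"

definition better :: "result \<Rightarrow> result \<Rightarrow> result" where
  "better x y = (case x of None \<Rightarrow> y | Some (c, ts) \<Rightarrow>
     (case y of None \<Rightarrow> x | Some (c', ts') \<Rightarrow> if c' < c then y else x))"

definition best_of :: "result \<Rightarrow> result set \<Rightarrow> bool" where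
  "best_of x X \<longleftrightarrow> (x = None \<or> x \<in> X) \<and>
     (\<forall>c ts. Some (c, ts) \<in> X \<longrightarrow> (\<exists>c' ts'. x = Some (c', ts') \<and> c' \<le> c))"

lemma best_of_empty: "best_of None {}"
  by (simp add: best_of_def)

lemma best_of_singleton: "best_of x {x}"
  by (auto simp: best_of_def)

lemma best_of_better: "best_of x X \<Longrightarrow> best_of y Y \<Longrightarrow> best_of (better x y) (X \<union> Y)"
  by (cases x; cases y) (fastforce simp: best_of_def better_def)+

primrec try_suffixes :: "(state \<Rightarrow> result) \<Rightarrow> nat \<Rightarrow> row list \<Rightarrow> state \<Rightarrow> result" where
  "try_suffixes g op [] st = None"
| "try_suffixes g op (t # ts) st =
     better (g (apply_instr op (t # ts) st)) (try_suffixes g op ts st)"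

primrec try_ops :: "(state \<Rightarrow> result) \<Rightarrow> row list \<Rightarrow> nat \<Rightarrow> state \<Rightarrow> result" where
  "try_ops g TM 0 st = None"
| "try_ops g TM (Suc op) st = better (try_suffixes g op TM st) (try_ops g TM op st)"

primrec search :: "(row list \<Rightarrow> result) \<Rightarrow> row list \<Rightarrow> nat \<Rightarrow> state \<Rightarrow> result" where
  "search fin TM 0 st = fin (selected st)"
| "search fin TM (Suc k) st = better (search fin TM k st) (try_ops (search fin TM k) TM 9 st)"

lemma best_of_try_suffixes:
  assumes "\<And>st. best_of (g st) (X st)"
  shows "best_of (try_suffixes g op ts st)
    (\<Union>us\<in>{us. us \<noteq> [] \<and> suffix us ts}. X (apply_instr op us st))"
proof (induction ts)
  case (Cons t ts)
  have "{us. us \<noteq> [] \<and> suffix us (t # ts)} = insert (t # ts) {us. us \<noteq> [] \<and> suffix us ts}"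
    by (auto simp: suffix_Cons)
  then show ?case using best_of_better[OF assms Cons.IH] by simp
qed (simp add: best_of_empty)

lemma best_of_try_ops:
  assumes "\<And>st. best_of (g st) (X st)"
  shows "best_of (try_ops g TM n st)
    (\<Union>op<n. \<Union>us\<in>{us. us \<noteq> [] \<and> suffix us TM}. X (apply_instr op us st))"
proof (induction n)
  case (Suc n)
  show ?case
    using best_of_better[OF best_of_try_suffixes[OF assms] Suc.IH] by (simp add: lessThan_Suc)
qed (simp add: best_of_empty)

lemma best_of_search:
  "best_of (search fin TM k st) ((\<lambda>st'. fin (selected st')) ` {st'. moves TM k st st'})"
proof (induction k arbitrary: st)
  case 0
  show ?case by (simp add: best_of_singleton)
next
  case (Suc k)
  let ?X = "\<lambda>st. (\<lambda>st'. fin (selected st')) ` {st'. moves TM k st st'}"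
  have "best_of (search fin TM (Suc k) st)
    (?X st \<union> (\<Union>op<9. \<Union>us\<in>{us. us \<noteq> [] \<and> suffix us TM}. ?X (apply_instr op us st)))"
    unfolding search.simps by (intro best_of_better best_of_try_ops Suc.IH)
  also have "?X st \<union> (\<Union>op<9. \<Union>us\<in>{us. us \<noteq> [] \<and> suffix us TM}. ?X (apply_instr op us st)) =
    (\<lambda>st'. fin (selected st')) ` {st'. moves TM (Suc k) st st'}"
    unfolding moves_Suc move_def by blast
  finally show ?case .
qed

lemma search_Some:
  assumes "search fin TM k st = Some r" "distinct (state_tasks st)"
  obtains S where "fin S = Some r" "distinct S" "set S \<subseteq> set (state_tasks st)"
proof -
  obtain st' where st': "moves TM k st st'" "fin (selected st') = Some r"
    using best_of_search[of fin TM k st] assms(1) by (auto simp: best_of_def)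
  obtain W N S where [simp]: "st' = (W, N, S)" by (cases st')
  have "mset (W @ N @ S) = mset (state_tasks st)" using mset_state_tasks_moves[OF st'(1)] by simp
  then have "distinct (W @ N @ S)" "set (W @ N @ S) = set (state_tasks st)"
    using assms(2) mset_eq_imp_distinct_iff mset_eq_setD by blast+
  then show ?thesis using that[of S] st'(2) by auto
qed

lemma search_le:
  assumes "moves TM k st st'" "fin (selected st') = Some (c, ts)"
  obtains c' ts' where "search fin TM k st = Some (c', ts')" "c' \<le> c"
proof -
  have "Some (c, ts) \<in> (\<lambda>st'. fin (selected st')) ` {st'. moves TM k st st'}"
    using assms by force
  then show ?thesis using best_of_search[of fin TM k st] that unfolding best_of_def by blast
qed

section \<open>Dominating sets of crossing tasks\<close>

definition uses :: "row \<Rightarrow> nat \<Rightarrow> bool" where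
  "uses t e \<longleftrightarrow> row_start t \<le> e \<and> e < row_end t"

definition set_cover :: "row set \<Rightarrow> nat \<Rightarrow> nat" where
  "set_cover X e = (\<Sum>t\<in>X. if uses t e then row_size t else 0)"

definition set_cost :: "row set \<Rightarrow> nat" where
  "set_cost X = (\<Sum>t\<in>X. row_cost t)"

lemma set_cover_Un:
  "finite X \<Longrightarrow> finite Y \<Longrightarrow> X \<inter> Y = {} \<Longrightarrow> set_cover (X \<union> Y) e = set_cover X e + set_cover Y e"
  by (simp add: set_cover_def sum.union_disjoint)

lemma set_cost_Un: "finite X \<Longrightarrow> finite Y \<Longrightarrow> X \<inter> Y = {} \<Longrightarrow> set_cost (X \<union> Y) = set_cost X + set_cost Y"
  by (simp add: set_cost_def sum.union_disjoint)

definition dominates :: "nat \<Rightarrow> nat \<Rightarrow> row set \<Rightarrow> row set \<Rightarrow> bool" where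
  "dominates a b S Q \<longleftrightarrow> (\<forall>e. set_cover Q e \<le> set_cover S e) \<and> a * set_cost S \<le> b * set_cost Q"

lemma dominates_empty [simp]: "dominates a b {} {}"
  by (simp add: dominates_def set_cover_def set_cost_def)

lemma dominates_Un:
  assumes "dominates a b S Q" "dominates a b S' Q'"
    and "finite S" "finite S'" "S \<inter> S' = {}" and "finite Q" "finite Q'" "Q \<inter> Q' = {}"
  shows "dominates a b (S \<union> S') (Q \<union> Q')"
  using assms by (simp add: dominates_def set_cover_Un set_cost_Un distrib_left add_mono)

lemma set_cover_mono: "finite Y \<Longrightarrow> X \<subseteq> Y \<Longrightarrow> set_cover X e \<le> set_cover Y e"
  by (simp add: set_cover_def sum_mono2)

lemma set_cost_mono: "finite Y \<Longrightarrow> X \<subseteq> Y \<Longrightarrow> set_cost X \<le> set_cost Y"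
  by (simp add: set_cost_def sum_mono2)

locale task_list =
  fixes TM :: "row list"
  assumes distinct_TM: "distinct TM"
begin

definition selectable :: "nat \<Rightarrow> row set \<Rightarrow> bool" where
  "selectable k S \<longleftrightarrow> (\<exists>R l. moves TM k (TM, [], []) (R, [], l) \<and> set l = S)"

definition region :: "(nat \<times> row) list \<Rightarrow> row set" where
  "region Fs = {t \<in> set TM. \<forall>(op, piv) \<in> set Fs. key op piv \<le> key op t}"

definition valid_filters :: "(nat \<times> row) list \<Rightarrow> bool" where
  "valid_filters Fs \<longleftrightarrow> (\<forall>(op, piv) \<in> set Fs. op < 8 \<and> piv \<in> set TM)"

lemma region_subset: "region Fs \<subseteq> set TM"
  by (auto simp: region_def)

lemma finite_region [simp]: "finite (region Fs)"
  by (simp add: region_def)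

lemma region_append: "region (Fs @ Gs) = region Fs \<inter> region Gs"
  by (auto simp: region_def)

lemma selectable_mono: "selectable j S \<Longrightarrow> j \<le> k \<Longrightarrow> selectable k S"
  unfolding selectable_def using moves_mono by blast

lemma selectable_empty: "selectable k {}"
  unfolding selectable_def using moves_refl by fastforce

lemma moves_from_start:
  assumes "moves TM k (TM, [], []) (W, N, S)"
  shows "distinct (W @ N @ S)" "set W \<union> set N \<union> set S = set TM"
proof -
  have "mset (W @ N @ S) = mset TM" using mset_state_tasks_moves[OF assms] by simp
  then show "distinct (W @ N @ S)" "set W \<union> set N \<union> set S = set TM"
    using distinct_TM mset_eq_imp_distinct_iff[of "W @ N @ S" TM] mset_eq_setD[of "W @ N @ S" TM]
    by (simp_all add: Un_assoc)
qed

lemma moves_filters: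
  "valid_filters Fs \<Longrightarrow> \<exists>W' N'. moves TM (length Fs) (W, N, S) (W', N', S) \<and>
    set W' = {t \<in> set W. \<forall>(op, piv) \<in> set Fs. key op piv \<le> key op t}"
proof (induction Fs arbitrary: W N)
  case Nil
  show ?case by (auto intro: moves_refl)
next
  case (Cons F Fs)
  obtain op piv where F: "F = (op, piv)" by fastforce
  with Cons.prems have ok: "op < 8" "piv \<in> set TM" "valid_filters Fs"
    by (auto simp: valid_filters_def)
  obtain W' N' where W':
    "moves TM (length Fs)
      (filter (\<lambda>t. key op piv \<le> key op t) W, filter (\<lambda>t. \<not> key op piv \<le> key op t) W @ N, S)
      (W', N', S)"
    "set W' = {t \<in> set W. key op piv \<le> key op t \<and> (\<forall>(op, piv) \<in> set Fs. key op piv \<le> key op t)}"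
    using Cons.IH[OF ok(3), of "filter (\<lambda>t. key op piv \<le> key op t) W"
        "filter (\<lambda>t. \<not> key op piv \<le> key op t) W @ N"]
    by auto
  have "moves TM (length (F # Fs)) (W, N, S) (W', N', S)"
    using moves_add[OF moves_filter[OF ok(1,2)] W'(1)] by simp
  then show ?case using W'(2) F by auto
qed

lemma selectable_pick:
  assumes sel: "selectable k S" and Fs: "valid_filters Fs"
  shows "\<exists>P \<subseteq> region Fs - S. card P = min j (card (region Fs - S)) \<and>
    selectable (k + length Fs + 1) (S \<union> P)"
proof -
  obtain R l where R: "moves TM k (TM, [], []) (R, [], l)" and l: "set l = S"
    using sel unfolding selectable_def by blast
  obtain W N where WN: "moves TM (length Fs) (R, [], l) (W, N, l)"
    "set W = {t \<in> set R. \<forall>(op, piv) \<in> set Fs. key op piv \<le> key op t}"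
    using moves_filters[OF Fs] by blast
  note filtered = moves_add[OF R WN(1)]
  have "set R = set TM - S" using moves_from_start[OF R] l by auto
  then have W: "set W = region Fs - S" using WN(2) by (auto simp: region_def)
  have dist: "distinct W" using moves_from_start(1)[OF filtered] by simp
  then have len: "length W = card (region Fs - S)" using W distinct_card by metis
  define i where "i = min j (length W)"
  show ?thesis
  proof (cases "i = 0")
    case True
    moreover have "selectable (k + length Fs + 1) S" by (rule selectable_mono[OF sel]) simp
    ultimately show ?thesis using len by (intro exI[of _ "{}"]) (simp add: i_def)
  next
    case False
    have "card (region Fs - S) \<le> card (set TM)" using region_subset by (intro card_mono) auto
    then have "length W \<le> length TM" using len distinct_TM by (simp add: distinct_card)
    then have "moves TM (k + length Fs + 1) (TM, [], []) (drop i W @ N, [], rev (take i W) @ l)"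
      using False by (intro moves_add[OF filtered] moves_pick) (auto simp: i_def)
    then have "selectable (k + length Fs + 1) (S \<union> set (take i W))"
      unfolding selectable_def using l by fastforce
    moreover have "set (take i W) \<subseteq> region Fs - S" unfolding W[symmetric] by (rule set_take_subset)
    moreover have "card (set (take i W)) = min j (card (region Fs - S))"
      using dist len by (simp add: distinct_card i_def)
    ultimately show ?thesis by blast
  qed
qed

lemma selectable_pick_upset:
  assumes sel: "selectable k S" and Fs: "valid_filters Fs" and op: "op < 8"
    and P: "P \<subseteq> region Fs" "\<forall>s\<in>P. \<forall>t\<in>region Fs. key op s \<le> key op t \<longrightarrow> t \<in> P"
  shows "\<exists>E \<subseteq> P - S. card E = min j (card (P - S)) \<and> selectable (k + length Fs + 2) (S \<union> E)"
proof (cases "P = {}")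
  case True
  then show ?thesis using selectable_mono[OF sel] by simp
next
  case False
  have "finite P" using P(1) by (rule finite_subset) simp
  from this False obtain s where s: "s \<in> P" "\<And>t. t \<in> P \<Longrightarrow> key op s \<le> key op t"
    by (rule finite_obtains_min[where f = "key op"]) blast
  have sTM: "s \<in> set TM" using s(1) P(1) region_subset by blast
  then have "valid_filters (Fs @ [(op, s)])" using Fs op by (auto simp: valid_filters_def)
  moreover have "region (Fs @ [(op, s)]) = P"
    using P s region_subset unfolding region_append by (auto simp: region_def)
  ultimately show ?thesis using selectable_pick[OF sel, of "Fs @ [(op, s)]" j] by simp
qed

corollary selectable_upset:
  assumes "selectable k S" "valid_filters Fs" "op < 8" "P \<subseteq> region Fs"
    "\<forall>s\<in>P. \<forall>t\<in>region Fs. key op s \<le> key op t \<longrightarrow> t \<in> P"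
  shows "selectable (k + length Fs + 2) (S \<union> P)"
proof -
  obtain E where E: "E \<subseteq> P - S" "card E = card (P - S)" "selectable (k + length Fs + 2) (S \<union> E)"
    using selectable_pick_upset[OF assms, where j = "card (P - S)"] by auto
  moreover have "finite (P - S)"
    using assms(4) by (intro finite_subset[of "P - S" "region Fs"]) auto
  ultimately have "E = P - S" by (simp add: card_subset_eq)
  then show ?thesis using E(3) by simp
qed

text \<open>The \<open>n\<close> candidates with the largest keys are selected as everything strictly above the \<open>n\<close>-th
  largest key, and \<open>n\<close> more from there.\<close>

lemma selectable_largest:
  assumes sel: "selectable k S" and Fs: "valid_filters Fs" and op: "op < 8"
    and n: "0 < n" "n \<le> card (region Fs - S)"
  obtains t0 E where "E \<subseteq> region Fs - S" "\<forall>t\<in>E. key op t0 \<le> key op t" "n \<le> card E" "card E \<le> 2 * n"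
    "{t \<in> region Fs. key op t0 < key op t} \<subseteq> S \<union> E" "selectable (k + 2 * (length Fs + 2)) (S \<union> E)"
proof -
  let ?V = "region Fs"
  have "finite (?V - S)" by simp
  from ex_nth_largest[OF this n, of "key op"] obtain t0 where t0: "t0 \<in> ?V - S"
    "card {t \<in> ?V - S. key op t0 < key op t} < n" "n \<le> card {t \<in> ?V - S. key op t0 \<le> key op t}"
    by blast
  let ?E1 = "{t \<in> ?V - S. key op t0 < key op t}" and ?U = "{t \<in> ?V. key op t0 \<le> key op t}"
  have "selectable (k + length Fs + 2) (S \<union> {t \<in> ?V. key op t0 < key op t})"
    by (rule selectable_upset[OF sel Fs op]) auto
  moreover have "S \<union> {t \<in> ?V. key op t0 < key op t} = S \<union> ?E1" by auto
  ultimately have sel1: "selectable (k + length Fs + 2) (S \<union> ?E1)" by simp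
  obtain E2 where E2: "E2 \<subseteq> ?U - (S \<union> ?E1)" "card E2 = min n (card (?U - (S \<union> ?E1)))"
    "selectable (k + length Fs + 2 + length Fs + 2) (S \<union> ?E1 \<union> E2)"
    using selectable_pick_upset[OF sel1 Fs op, of ?U n] by auto
  have fin: "finite (?E1 \<union> E2)" using E2(1) finite_subset[of E2 ?U] by auto
  have "n \<le> card (?E1 \<union> E2)"
  proof (cases "n \<le> card (?U - (S \<union> ?E1))")
    case True
    then show ?thesis using E2(2) card_mono[OF fin, of E2] by simp
  next
    case False
    then have "E2 = ?U - (S \<union> ?E1)" using E2(1,2) by (simp add: card_subset_eq)
    then have "?E1 \<union> E2 = {t \<in> ?V - S. key op t0 \<le> key op t}" by auto
    then show ?thesis using t0(3) by simp
  qed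
  moreover have "card (?E1 \<union> E2) \<le> 2 * n" using card_Un_le[of ?E1 E2] t0(2) E2(2) by linarith
  moreover have "k + length Fs + 2 + length Fs + 2 = k + 2 * (length Fs + 2)" by simp
  then have "selectable (k + 2 * (length Fs + 2)) (S \<union> (?E1 \<union> E2))"
    using E2(3) by (simp only: Un_assoc)
  ultimately show ?thesis using E2(1) by (intro that[of "?E1 \<union> E2" t0]) auto
qed

lemma selectable_extremes:
  assumes sel: "selectable k S" and Fs: "valid_filters Fs" and op: "op < 8"
  shows "\<exists>E \<subseteq> region Fs - S. card E \<le> 2 * n \<and> selectable (k + 2 * (length Fs + 2)) (S \<union> E) \<and>
    (\<forall>\<theta>. {t \<in> region Fs. \<theta> \<le> key op t} \<subseteq> S \<union> E \<or> n \<le> card {t \<in> E. \<theta> \<le> key op t})"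
proof -
  let ?V = "region Fs"
  consider "n = 0" | "card (?V - S) \<le> n" | "0 < n" "n \<le> card (?V - S)" by linarith
  then show ?thesis
  proof cases
    case 1
    then show ?thesis using selectable_mono[OF sel] by (intro exI[of _ "{}"]) simp
  next
    case 2
    have "selectable (k + length Fs + 2) (S \<union> ?V)" by (rule selectable_upset[OF sel Fs op]) auto
    then have "selectable (k + 2 * (length Fs + 2)) (S \<union> (?V - S))"
      using selectable_mono by fastforce
    then show ?thesis using 2 by (intro exI[of _ "?V - S"]) auto
  next
    case 3
    then obtain t0 E where E: "E \<subseteq> ?V - S" "\<forall>t\<in>E. key op t0 \<le> key op t" "n \<le> card E"
      "card E \<le> 2 * n"
      "{t \<in> ?V. key op t0 < key op t} \<subseteq> S \<union> E" "selectable (k + 2 * (length Fs + 2)) (S \<union> E)"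
      by (rule selectable_largest[OF sel Fs op])
    have "{t \<in> ?V. \<theta> \<le> key op t} \<subseteq> S \<union> E \<or> n \<le> card {t \<in> E. \<theta> \<le> key op t}" for \<theta>
    proof (cases "\<theta> \<le> key op t0")
      case True
      then have "{t \<in> E. \<theta> \<le> key op t} = E" using E(2) by auto
      then show ?thesis using E(3) by simp
    next
      case False
      then have "{t \<in> ?V. \<theta> \<le> key op t} \<subseteq> {t \<in> ?V. key op t0 < key op t}" by auto
      then show ?thesis using E(5) by blast
    qed
    then show ?thesis using E(1,4,6) by blast
  qed
qed

definition box :: "row set \<Rightarrow> nat set \<Rightarrow> row set" where
  "box Q A = {t \<in> set TM. \<forall>a\<in>A. (\<exists>s\<in>Q. s ! a \<le> t ! a) \<and> (\<exists>s\<in>Q. t ! a \<le> s ! a)}"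

lemma boxE:
  assumes "t \<in> box Q A" "a \<in> A"
  obtains lo hi where "lo \<in> Q" "hi \<in> Q" "lo ! a \<le> t ! a" "t ! a \<le> hi ! a"
  using assms by (auto simp: box_def)

lemma box_subset: "box Q A \<subseteq> set TM"
  by (auto simp: box_def)

lemma finite_box [simp]: "finite (box Q A)"
  by (simp add: box_def)

lemma subset_box: "Q \<subseteq> set TM \<Longrightarrow> Q \<subseteq> box Q A"
  by (auto simp: box_def)

lemma box_mono: "Q \<subseteq> Q' \<Longrightarrow> A' \<subseteq> A \<Longrightarrow> box Q A \<subseteq> box Q' A'"
  unfolding box_def by blast

lemma box_eq_region:
  assumes Q: "Q \<subseteq> set TM" "Q \<noteq> {}"
  shows "finite A \<Longrightarrow> A \<subseteq> {..<4} \<Longrightarrow>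
    \<exists>Fs. length Fs = 2 * card A \<and> valid_filters Fs \<and> region Fs = box Q A"
proof (induction A rule: finite_induct)
  case empty
  show ?case by (intro exI[of _ "[]"]) (auto simp: valid_filters_def region_def box_def)
next
  case (insert a A)
  then obtain Fs where Fs: "length Fs = 2 * card A" "valid_filters Fs" "region Fs = box Q A" by auto
  have finQ: "finite Q" using Q(1) finite_subset by blast
  obtain lo where lo: "lo \<in> Q" "\<And>s. s \<in> Q \<Longrightarrow> lo ! a \<le> s ! a"
    using finite_obtains_min[OF finQ Q(2), of "\<lambda>t. t ! a"] by blast
  obtain hi where hi: "hi \<in> Q" "\<And>s. s \<in> Q \<Longrightarrow> s ! a \<le> hi ! a"
    using finite_obtains_max[OF finQ Q(2), of "\<lambda>t. t ! a"] by blast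
  let ?Fs = "Fs @ [(a, lo), (a + 4, hi)]"
  have a: "a < 4" using insert.prems by simp
  have "valid_filters ?Fs" using Fs(2) a lo(1) hi(1) Q(1) by (auto simp: valid_filters_def)
  moreover have "region ?Fs = box Q (insert a A)"
  proof -
    have "(\<exists>s\<in>Q. s ! a \<le> t ! a) \<longleftrightarrow> lo ! a \<le> t ! a" "(\<exists>s\<in>Q. t ! a \<le> s ! a) \<longleftrightarrow> t ! a \<le> hi ! a" for t
      using lo hi by (blast intro: order_trans)+
    then show ?thesis
      unfolding region_append Fs(3) using a by (auto simp: region_def box_def key_def)
  qed
  ultimately show ?case using Fs(1) insert.hyps by (intro exI[of _ ?Fs]) simp
qed

lemma selectable_cell:
  assumes sel: "selectable k S" and C: "C \<subseteq> set TM" "C \<inter> S = {}"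
  shows "\<exists>P \<subseteq> box C {..<4} - S. card P = card C \<and> selectable (k + 9) (S \<union> P)"
proof (cases "C = {}")
  case True
  then show ?thesis using selectable_mono[OF sel] by (intro exI[of _ "{}"]) simp
next
  case False
  obtain Fs where Fs: "length Fs = 8" "valid_filters Fs" "region Fs = box C {..<4}"
    using box_eq_region[OF C(1) False, of "{..<4}"] by auto
  obtain P where P: "P \<subseteq> box C {..<4} - S" "card P = min (card C) (card (box C {..<4} - S))"
    "selectable (k + length Fs + 1) (S \<union> P)"
    using selectable_pick[OF sel Fs(2), of "card C"] unfolding Fs(3) by blast
  have "card C \<le> card (box C {..<4} - S)"
    using subset_box[OF C(1)] C(2) by (intro card_mono) auto
  then have "card P = card C" using P(2) by simp
  moreover have "k + length Fs + 1 = k + 9" using Fs(1) by simp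
  with P(3) have "selectable (k + 9) (S \<union> P)" by (simp only:)
  ultimately show ?thesis using P(1) by blast
qed

lemma selectable_cells:
  assumes sel: "selectable k S" and Q: "Q \<subseteq> set TM" and disj: "S \<inter> box Q A = {}" and A: "A \<subseteq> {..<4}"
    and lab: "\<And>l. box {s \<in> Q. lab s = l} {..<4} \<subseteq> {t. lab t = l}"
  shows "finite \<Lambda> \<Longrightarrow> \<exists>R \<subseteq> box Q A. selectable (k + 9 * card \<Lambda>) (S \<union> R) \<and>
    lab ` R \<subseteq> \<Lambda> \<and> (\<forall>l\<in>\<Lambda>. card {t \<in> R. lab t = l} = card {s \<in> Q. lab s = l})"
proof (induction \<Lambda> rule: finite_induct)
  case empty
  show ?case using sel by (intro exI[of _ "{}"]) simp
next
  case (insert l \<Lambda>)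
  then obtain R where R: "R \<subseteq> box Q A" "selectable (k + 9 * card \<Lambda>) (S \<union> R)" "lab ` R \<subseteq> \<Lambda>"
    "\<forall>l\<in>\<Lambda>. card {t \<in> R. lab t = l} = card {s \<in> Q. lab s = l}" by blast
  let ?C = "{s \<in> Q. lab s = l}"
  have "?C \<subseteq> set TM" "?C \<inter> (S \<union> R) = {}"
    using Q subset_box[OF Q, of A] disj R(3) insert.hyps(2) by auto
  from selectable_cell[OF R(2) this] obtain P where P: "P \<subseteq> box ?C {..<4} - (S \<union> R)"
    "card P = card ?C"
    "selectable (k + 9 * card \<Lambda> + 9) (S \<union> R \<union> P)" by blast
  have labP: "lab t = l" if "t \<in> P" for t using lab P(1) that by blast
  have "R \<union> P \<subseteq> box Q A" using R(1) P(1) box_mono[OF _ A, of ?C Q] by blast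
  moreover have "selectable (k + 9 * card (insert l \<Lambda>)) (S \<union> (R \<union> P))"
  proof -
    have "k + 9 * card \<Lambda> + 9 = k + 9 * card (insert l \<Lambda>)" using insert.hyps by simp
    then show ?thesis using P(3) by (simp only: Un_assoc)
  qed
  moreover have "lab ` (R \<union> P) \<subseteq> insert l \<Lambda>" using R(3) labP by auto
  moreover have "card {t \<in> R \<union> P. lab t = l'} = card {s \<in> Q. lab s = l'}"
    if "l' \<in> insert l \<Lambda>" for l'
  proof (cases "l' = l")
    case True
    then have "{t \<in> R \<union> P. lab t = l'} = P" using R(3) labP insert.hyps(2) by auto
    then show ?thesis using P(2) True by simp
  next
    case False
    then have "{t \<in> R \<union> P. lab t = l'} = {t \<in> R. lab t = l'}" using labP by auto
    then show ?thesis using R(4) that False by simp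
  qed
  ultimately show ?case by blast
qed

corollary selectable_matching:
  assumes sel: "selectable k S" and Q: "Q \<subseteq> set TM" and disj: "S \<inter> box Q A = {}" and A: "A \<subseteq> {..<4}"
    and lab: "\<And>l. box {s \<in> Q. lab s = l} {..<4} \<subseteq> {t. lab t = l}"
  obtains R \<phi> where "R \<subseteq> box Q A" "selectable (k + 9 * card (lab ` Q)) (S \<union> R)"
    "bij_betw \<phi> Q R" "\<And>s. s \<in> Q \<Longrightarrow> lab (\<phi> s) = lab s"
proof -
  have finQ: "finite Q" using Q finite_subset by blast
  then have "finite (lab ` Q)" by simp
  from selectable_cells[OF sel Q disj A lab this] obtain R where R: "R \<subseteq> box Q A"
    "selectable (k + 9 * card (lab ` Q)) (S \<union> R)" "lab ` R \<subseteq> lab ` Q"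
    "\<forall>l\<in>lab ` Q. card {t \<in> R. lab t = l} = card {s \<in> Q. lab s = l}"
    by blast
  have "card {s \<in> Q. lab s = l} = card {t \<in> R. lab t = l}" for l
  proof (cases "l \<in> lab ` Q")
    case False
    then have "{s \<in> Q. lab s = l} = {}" "{t \<in> R. lab t = l} = {}" using R(3) by auto
    then show ?thesis by (simp only:)
  qed (rule R(4)[rule_format, symmetric])
  moreover have "finite R" using R(1) by (rule finite_subset) simp
  ultimately have "\<exists>\<phi>. bij_betw \<phi> Q R \<and> (\<forall>s\<in>Q. lab (\<phi> s) = lab s)"
    by (intro ex_bij_betw_fibres finQ)
  then obtain \<phi> where "bij_betw \<phi> Q R" "\<forall>s\<in>Q. lab (\<phi> s) = lab s" by (elim exE conjE)
  then show ?thesis by (intro that[of R \<phi>] R(1,2)) auto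
qed

end

locale crossing = task_list TM for TM :: "row list" +
  fixes m :: nat
  assumes crosses: "\<And>t. t \<in> set TM \<Longrightarrow> uses t m"
begin

text \<open>Key \<open>4\<close> measures how far a task reaches to the left, key \<open>1\<close> how far to the right.\<close>

lemma uses_eq_key_le:
  obtains op \<theta> where "op \<in> {1, 4}" "\<And>t. t \<in> set TM \<Longrightarrow> uses t e \<longleftrightarrow> \<theta> \<le> key op t"
proof (cases "m \<le> e")
  case True
  then have "uses t e \<longleftrightarrow> int e + 1 \<le> key 1 t" if "t \<in> set TM" for t
    using crosses[OF that] by (auto simp: uses_def key_def)
  then show ?thesis by (intro that[of 1]) auto
next
  case False
  then have "uses t e \<longleftrightarrow> - int e \<le> key 4 t" if "t \<in> set TM" for t
    using crosses[OF that] by (auto simp: uses_def key_def)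
  then show ?thesis by (intro that[of 4]) auto
qed

end

definition group_length :: "nat \<Rightarrow> nat" where
  "group_length D = 72 * D ^ 3 + 24"

locale uniform_group = crossing TM m for TM :: "row list" and m :: nat +
  fixes D :: nat and Q :: "row set"
  assumes D_pos: "0 < D" and Q_subset: "Q \<subseteq> set TM" and Q_nonempty: "Q \<noteq> {}"
    and sizes: "\<And>s t. s \<in> Q \<Longrightarrow> t \<in> Q \<Longrightarrow> D * row_size s \<le> (D + 1) * row_size t"
    and costs: "\<And>s t. s \<in> Q \<Longrightarrow> t \<in> Q \<Longrightarrow> D * row_cost s \<le> (D + 1) * row_cost t"
begin

definition slack :: nat where
  "slack = card Q div D"

definition width :: nat where
  "width = max 1 slack"

definition cell :: "row \<Rightarrow> nat \<times> nat \<times> nat" where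
  "cell t = (rank (key 4) Q t div width, rank (key 1) Q t div width, rank (key 2) Q t div width)"

abbreviation "bounding_box \<equiv> box Q {2, 3}"

definition compensates :: "row set \<Rightarrow> row set \<Rightarrow> row set \<Rightarrow> bool" where
  "compensates S R S' \<longleftrightarrow> (\<forall>op\<in>{1, 4}. \<forall>\<theta>. {t \<in> bounding_box. \<theta> \<le> key op t} \<subseteq> S \<union> S' \<or>
     (\<exists>E \<subseteq> S' - R. 3 * slack \<le> card {t \<in> E. \<theta> \<le> key op t}))"

lemma compensatesI:
  assumes "E1 \<subseteq> S' - R" "E4 \<subseteq> S' - R"
    and "\<And>\<theta>. {t \<in> bounding_box. \<theta> \<le> key 1 t} \<subseteq> S \<union> S' \<or>
      3 * slack \<le> card {t \<in> E1. \<theta> \<le> key 1 t}"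
    and "\<And>\<theta>. {t \<in> bounding_box. \<theta> \<le> key 4 t} \<subseteq> S \<union> S' \<or>
      3 * slack \<le> card {t \<in> E4. \<theta> \<le> key 4 t}"
  shows "compensates S R S'"
  unfolding compensates_def
proof (intro ballI allI)
  fix op \<theta> assume "op \<in> {1, 4 :: nat}"
  then consider "op = 1" | "op = 4" by blast
  then show "{t \<in> bounding_box. \<theta> \<le> key op t} \<subseteq> S \<union> S' \<or>
      (\<exists>E \<subseteq> S' - R. 3 * slack \<le> card {t \<in> E. \<theta> \<le> key op t})"
    using assms(1,2) assms(3,4)[of \<theta>] by cases auto
qed

lemma finite_Q: "finite Q"
  using Q_subset finite_subset by blast

lemma Q_subset_bounding_box: "Q \<subseteq> bounding_box"
  using Q_subset by (rule subset_box)

lemma card_Q_less: "card Q < 2 * width * D"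
proof -
  have "card Q < D * slack + D"
    unfolding slack_def using dividend_less_times_div[OF D_pos, of "card Q"] by simp
  also have "\<dots> \<le> D * width + D * width"
    unfolding width_def by (intro add_mono mult_le_mono2) auto
  finally show ?thesis by (simp add: algebra_simps)
qed

lemma rank_div_width_less: "rank f Q t div width < 2 * D"
  using rank_le_card[OF finite_Q, of f t] card_Q_less
  by (intro less_mult_imp_div_less) (simp add: algebra_simps)

lemma card_cells: "card (cell ` Q) \<le> 8 * D ^ 3"
proof -
  have "card (cell ` Q) \<le> card ({..<2 * D} \<times> {..<2 * D} \<times> {..<2 * D})"
    using rank_div_width_less by (intro card_mono) (auto simp: cell_def)
  then show ?thesis by (simp add: card_cartesian_product power3_eq_cube)
qed

lemma box_cell_subset: "box {s \<in> Q. cell s = l} {..<4} \<subseteq> {t. cell t = l}"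
proof
  fix t assume t: "t \<in> box {s \<in> Q. cell s = l} {..<4}"
  have between: "\<exists>s s'. cell s = l \<and> cell s' = l \<and> key op s \<le> key op t \<and> key op t \<le> key op s'"
    if "op < 8" for op
  proof -
    define a where "a = (if op < 4 then op else op - 4)"
    have "a < 4" using that unfolding a_def by arith
    with t obtain s s' where "cell s = l" "cell s' = l" "s ! a \<le> t ! a" "t ! a \<le> s' ! a"
      by (elim boxE[of t _ _ a]) auto
    then show ?thesis by (cases "op < 4") (auto simp: key_def a_def)
  qed
  have same: "rank (key op) Q t div width = c"
    if "op < 8" "\<And>s. cell s = l \<Longrightarrow> rank (key op) Q s div width = c" for op c
    using between[OF that(1)] that(2) rank_div_eq_of_between[OF finite_Q, of "key op"] by metis
  obtain c4 c1 c2 where l: "l = (c4, c1, c2)" by (cases l)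
  have "rank (key 4) Q t div width = c4" "rank (key 1) Q t div width = c1"
    "rank (key 2) Q t div width = c2"
    by (auto intro!: same simp: cell_def l)
  then show "t \<in> {t. cell t = l}" by (simp add: cell_def l)
qed

lemma set_cost_le:
  assumes "S' \<subseteq> bounding_box" "card S' \<le> card Q + 12 * slack"
  shows "D * D * set_cost S' \<le> (D + 1) * (D + 12) * set_cost Q"
proof -
  obtain q where q: "q \<in> Q" "\<And>t. t \<in> Q \<Longrightarrow> row_cost q \<le> row_cost t"
    using finite_obtains_min[OF finite_Q Q_nonempty, of row_cost] by blast
  have "D * row_cost t \<le> (D + 1) * row_cost q" if "t \<in> S'" for t
  proof -
    have "t \<in> bounding_box" using that assms(1) by blast
    then obtain s where s: "s \<in> Q" "row_cost t \<le> row_cost s" by (elim boxE[of t _ _ 3]) auto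
    then show ?thesis using costs[OF s(1) q(1)] mult_le_mono2[OF s(2), of D] by linarith
  qed
  moreover have "D * card S' \<le> (D + 12) * card Q"
  proof -
    have "D * card S' \<le> D * card Q + 12 * (D * slack)"
      using mult_le_mono2[OF assms(2), of D] by (simp add: algebra_simps)
    also have "D * slack \<le> card Q" by (simp add: slack_def)
    finally show ?thesis by (simp add: algebra_simps)
  qed
  ultimately show ?thesis unfolding set_cost_def using q(2) by (intro sum_le_of_card_le)
qed

lemma set_cover_eq_sum_upper:
  assumes "X \<subseteq> set TM" "\<And>t. t \<in> set TM \<Longrightarrow> uses t e \<longleftrightarrow> \<theta> \<le> key op t"
  shows "set_cover X e = (\<Sum>t | t \<in> X \<and> \<theta> \<le> key op t. row_size t)"
proof -
  have "set_cover X e = (\<Sum>t\<in>X. if \<theta> \<le> key op t then row_size t else 0)"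
    unfolding set_cover_def using assms by (intro sum.cong) auto
  also have "\<dots> = (\<Sum>t | t \<in> X \<and> \<theta> \<le> key op t. row_size t)"
    using assms(1) finite_subset by (intro sum.inter_filter[symmetric]) blast
  finally show ?thesis .
qed

lemma sum_upper_le:
  assumes op: "op \<in> {1, 4}" and \<phi>: "bij_betw \<phi> Q R" "\<And>s. s \<in> Q \<Longrightarrow> cell (\<phi> s) = cell s"
    and E: "R \<inter> E = {}" "R \<union> E \<subseteq> bounding_box" "3 * slack \<le> card {t \<in> E. \<theta> \<le> key op t}"
  shows "(\<Sum>t | t \<in> Q \<and> \<theta> \<le> key op t. row_size t) \<le> (\<Sum>t | t \<in> R \<union> E \<and> \<theta> \<le> key op t. row_size t)"
proof -
  have fin: "finite (R \<union> E)" using E(2) by (rule finite_subset) simp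
  have ranks: "rank (key op) Q (\<phi> s) div width = rank (key op) Q s div width"
    "rank (key 2) Q (\<phi> s) div width = rank (key 2) Q s div width" if "s \<in> Q" for s
    using \<phi>(2)[OF that] op by (auto simp: cell_def)
  show ?thesis
  proof (cases "slack = 0")
    case True
    then have "key op s \<le> key op (\<phi> s) \<and> key 2 s \<le> key 2 (\<phi> s)" if "s \<in> Q" for s
      using ranks[OF that] le_of_rank_eq[OF finite_Q that] unfolding width_def True by fastforce
    then have "key op s \<le> key op (\<phi> s) \<and> row_size s \<le> row_size (\<phi> s)" if "s \<in> Q" for s
      using that by (simp add: key_def)
    then have "(\<Sum>t | t \<in> Q \<and> \<theta> \<le> key op t. row_size t) \<le> (\<Sum>t | t \<in> R \<and> \<theta> \<le> key op t. row_size t)"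
      using finite_Q \<phi>(1) by (intro sum_upper_le_of_bij_betw)
    also have "\<dots> \<le> (\<Sum>t | t \<in> R \<union> E \<and> \<theta> \<le> key op t. row_size t)"
      using fin by (intro sum_mono2) auto
    finally show ?thesis .
  next
    case False
    then have width: "width = slack" by (simp add: width_def)
    obtain q where q: "q \<in> Q" "\<And>t. t \<in> Q \<Longrightarrow> row_size q \<le> row_size t"
      using finite_obtains_min[OF finite_Q Q_nonempty, of row_size] by blast
    have "row_size q \<le> row_size t" if "t \<in> R \<union> E" for t
    proof -
      have "t \<in> bounding_box" using that E(2) by blast
      then obtain s where "s \<in> Q" "row_size s \<le> row_size t" by (elim boxE[of t _ _ 2]) auto
      then show ?thesis using q(2)[of s] by simp
    qed
    moreover have "card Q \<le> 2 * slack * D" using card_Q_less by (simp add: width)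
    ultimately show ?thesis
      using False E fin ranks(1) D_pos sizes[OF _ q(1)]
      by (intro sum_upper_le_of_compensation[OF finite_Q _ \<phi>(1), where D = D and d = slack
            and w = "row_size q"])
        (auto simp: width)
  qed
qed

lemma set_cover_le:
  assumes S: "S \<inter> bounding_box = {}" and S': "S' \<subseteq> bounding_box" "R \<subseteq> S'"
    and \<phi>: "bij_betw \<phi> Q R" "\<And>s. s \<in> Q \<Longrightarrow> cell (\<phi> s) = cell s"
    and comp: "compensates S R S'"
  shows "set_cover Q e \<le> set_cover S' e"
proof -
  obtain op \<theta> where op: "op \<in> {1, 4}" and uses: "\<And>t. t \<in> set TM \<Longrightarrow> uses t e \<longleftrightarrow> \<theta> \<le> key op t"
    using uses_eq_key_le by blast
  have finS': "finite S'" using S'(1) by (rule finite_subset) simp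
  have "{t \<in> bounding_box. \<theta> \<le> key op t} \<subseteq> S \<union> S' \<or>
      (\<exists>E \<subseteq> S' - R. 3 * slack \<le> card {t \<in> E. \<theta> \<le> key op t})"
    using comp op unfolding compensates_def by blast
  then have "(\<Sum>t | t \<in> Q \<and> \<theta> \<le> key op t. row_size t) \<le> (\<Sum>t | t \<in> S' \<and> \<theta> \<le> key op t. row_size t)"
  proof
    assume "{t \<in> bounding_box. \<theta> \<le> key op t} \<subseteq> S \<union> S'"
    then have "{t \<in> Q. \<theta> \<le> key op t} \<subseteq> {t \<in> S'. \<theta> \<le> key op t}"
      using Q_subset_bounding_box S by blast
    then show ?thesis using finS' by (intro sum_mono2) auto
  next
    assume "\<exists>E \<subseteq> S' - R. 3 * slack \<le> card {t \<in> E. \<theta> \<le> key op t}"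
    then obtain E where E: "E \<subseteq> S' - R" "3 * slack \<le> card {t \<in> E. \<theta> \<le> key op t}" by blast
    then have "(\<Sum>t | t \<in> Q \<and> \<theta> \<le> key op t. row_size t) \<le>
        (\<Sum>t | t \<in> R \<union> E \<and> \<theta> \<le> key op t. row_size t)"
      using S' by (intro sum_upper_le[OF op \<phi>]) auto
    also have "\<dots> \<le> (\<Sum>t | t \<in> S' \<and> \<theta> \<le> key op t. row_size t)"
      using finS' E(1) S'(2) by (intro sum_mono2) auto
    finally show ?thesis .
  qed
  moreover have "S' \<subseteq> set TM" using S'(1) box_subset by blast
  ultimately show ?thesis using set_cover_eq_sum_upper[OF _ uses] Q_subset by simp
qed

text \<open>Selecting as many tasks as \<open>Q\<close> has from each cell of a grid of strips of \<open>slack\<close> ranks loses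
  fewer than \<open>slack\<close> tasks at each edge, and the size differences lose at most \<open>2 slack\<close> more; hence
  \<open>3 slack\<close> extreme tasks on each side make up for the loss.\<close>

lemma selectable_matching_and_extremes:
  assumes sel: "selectable k S" and S: "S \<inter> bounding_box = {}"
  obtains R S' \<phi> where "R \<subseteq> S'" "S' \<subseteq> bounding_box" "card S' \<le> card Q + 12 * slack"
    "selectable (k + group_length D) (S \<union> S')"
    "bij_betw \<phi> Q R" "\<forall>s\<in>Q. cell (\<phi> s) = cell s" "compensates S R S'"
proof -
  obtain R \<phi> where R: "R \<subseteq> bounding_box" "selectable (k + 9 * card (cell ` Q)) (S \<union> R)"
    and \<phi>: "bij_betw \<phi> Q R" "\<And>s. s \<in> Q \<Longrightarrow> cell (\<phi> s) = cell s"
    using selectable_matching[OF sel Q_subset S _ box_cell_subset] by auto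
  have selR: "selectable (k + 72 * D ^ 3) (S \<union> R)"
    by (rule selectable_mono[OF R(2)]) (use card_cells in simp)
  obtain Fs where Fs: "length Fs = 4" "valid_filters Fs" "region Fs = bounding_box"
    using box_eq_region[OF Q_subset Q_nonempty, of "{2, 3}"] by auto
  note extremes = selectable_extremes[OF _ Fs(2), where n = "3 * slack", unfolded Fs(1,3)]
  obtain E1 where E1: "E1 \<subseteq> bounding_box - (S \<union> R)" "card E1 \<le> 2 * (3 * slack)"
    "selectable (k + 72 * D ^ 3 + 12) (S \<union> R \<union> E1)"
    "\<And>\<theta>. {t \<in> bounding_box. \<theta> \<le> key 1 t} \<subseteq> S \<union> R \<union> E1 \<or> 3 * slack \<le> card {t \<in> E1. \<theta> \<le> key 1 t}"
    using extremes[OF selR, of 1] by auto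
  obtain E4 where E4: "E4 \<subseteq> bounding_box - (S \<union> R \<union> E1)" "card E4 \<le> 2 * (3 * slack)"
    "selectable (k + 72 * D ^ 3 + 12 + 12) (S \<union> R \<union> E1 \<union> E4)"
    "\<And>\<theta>. {t \<in> bounding_box. \<theta> \<le> key 4 t} \<subseteq> S \<union> R \<union> E1 \<union> E4 \<or>
      3 * slack \<le> card {t \<in> E4. \<theta> \<le> key 4 t}"
    using extremes[OF E1(3), of 4] by auto
  let ?S' = "R \<union> E1 \<union> E4"
  have "card ?S' \<le> card R + card E1 + card E4" by (meson add_le_mono1 card_Un_le le_trans)
  then have "card ?S' \<le> card Q + 12 * slack"
    using E1(2) E4(2) bij_betw_same_card[OF \<phi>(1)] by linarith
  moreover have "selectable (k + group_length D) (S \<union> ?S')"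
    using E4(3) by (simp add: group_length_def Un_assoc add.assoc)
  moreover have "compensates S R ?S'"
  proof (rule compensatesI)
    show "E1 \<subseteq> ?S' - R" "E4 \<subseteq> ?S' - R" using E1(1) E4(1) by auto
    show "{t \<in> bounding_box. \<theta> \<le> key 1 t} \<subseteq> S \<union> ?S' \<or>
        3 * slack \<le> card {t \<in> E1. \<theta> \<le> key 1 t}" for \<theta>
      using E1(4)[of \<theta>] by blast
    show "{t \<in> bounding_box. \<theta> \<le> key 4 t} \<subseteq> S \<union> ?S' \<or>
        3 * slack \<le> card {t \<in> E4. \<theta> \<le> key 4 t}" for \<theta>
      using E4(4)[of \<theta>] by blast
  qed
  moreover have "R \<subseteq> ?S'" "?S' \<subseteq> bounding_box" using R(1) E1(1) E4(1) by auto
  ultimately show ?thesis using \<phi> that[of R ?S' \<phi>] by blast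
qed

lemma dominate_group:
  assumes sel: "selectable k S" and S: "S \<inter> bounding_box = {}"
  shows "\<exists>S' \<subseteq> bounding_box. selectable (k + group_length D) (S \<union> S') \<and>
    dominates (D * D) ((D + 1) * (D + 12)) S' Q"
proof -
  obtain R S' \<phi> where S': "R \<subseteq> S'" "S' \<subseteq> bounding_box" "card S' \<le> card Q + 12 * slack"
      "selectable (k + group_length D) (S \<union> S')"
    and R: "bij_betw \<phi> Q R" "\<forall>s\<in>Q. cell (\<phi> s) = cell s" "compensates S R S'"
    using assms by (rule selectable_matching_and_extremes)
  have "set_cover Q e \<le> set_cover S' e" for e
    using R(2) by (intro set_cover_le[OF S S'(2,1) R(1) _ R(3)]) auto
  then have "dominates (D * D) ((D + 1) * (D + 12)) S' Q"
    unfolding dominates_def using set_cost_le[OF S'(2,3)] by blast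
  then show ?thesis using S'(2,4) by blast
qed

end

definition scale_class :: "nat \<Rightarrow> nat \<Rightarrow> int" where
  "scale_class D x = \<lfloor>log (1 + 1 / real D) (real x)\<rfloor>"

lemma scale_class_mono: "0 < D \<Longrightarrow> 0 < x \<Longrightarrow> x \<le> y \<Longrightarrow> scale_class D x \<le> scale_class D y"
  unfolding scale_class_def by (intro floor_mono) simp

lemma le_of_scale_class_eq:
  assumes D: "0 < D" and xy: "0 < x" "0 < y" and eq: "scale_class D x = scale_class D y"
  shows "D * x \<le> (D + 1) * y"
proof -
  define b where "b = 1 + 1 / real D"
  have b: "1 < b" using D by (simp add: b_def)
  have "log b (real x) < log b (real y) + 1"
    using eq unfolding scale_class_def b_def[symmetric] by linarith
  also have "\<dots> = log b (b * real y)" using b xy by (simp add: log_mult)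
  finally have "real x < b * real y" using b xy by (subst (asm) log_less_cancel_iff) auto
  then have "real D * real x < real D * (b * real y)" using D by simp
  also have "\<dots> = (real D + 1) * real y" using D by (simp add: b_def field_simps)
  finally have "real (D * x) < real ((D + 1) * y)" by (simp add: algebra_simps)
  then show ?thesis by linarith
qed

lemma scale_class_le_add:
  assumes D: "0 < D" and xy: "0 < x" "0 < y" and le: "y \<le> 2 ^ L * x"
  shows "scale_class D y \<le> scale_class D x + int (D * L)"
proof -
  define b where "b = 1 + 1 / real D"
  have b: "1 < b" using D by (simp add: b_def)
  have "1 + real D * (1 / real D) \<le> b ^ D"
    unfolding b_def by (intro Bernoulli_inequality) (simp add: order_trans[of _ 0])
  then have "2 \<le> b ^ D" using D by simp
  then have "2 ^ L \<le> (b ^ D) ^ L" by (rule power_mono) simp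
  then have pow: "2 ^ L \<le> b ^ (D * L)" by (simp add: power_mult)
  have "real y \<le> 2 ^ L * real x" using of_nat_mono[OF le, where 'a = real] by simp
  also have "\<dots> \<le> b ^ (D * L) * real x" using pow by (rule mult_right_mono) simp
  finally have "log b (real y) \<le> log b (b ^ (D * L) * real x)" using b xy by simp
  also have "\<dots> = log b (real x) + of_int (int (D * L))"
    using b xy by (simp add: log_mult log_nat_power)
  finally have "\<lfloor>log b (real y)\<rfloor> \<le> \<lfloor>log b (real x) + of_int (int (D * L))\<rfloor>" by (rule floor_mono)
  then show ?thesis unfolding scale_class_def b_def[symmetric] floor_add_int[symmetric] .
qed

context task_list
begin

definition cheap :: "nat \<Rightarrow> nat \<Rightarrow> row set" where
  "cheap D C = {t \<in> set TM. D * length TM * row_cost t \<le> C}"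

lemma finite_cheap [simp]: "finite (cheap D C)"
  by (simp add: cheap_def)

lemma selectable_cheap: "selectable 2 (cheap D C)"
proof -
  have "t \<in> cheap D C" if "s \<in> cheap D C" "t \<in> set TM" "key 7 s \<le> key 7 t" for s t
  proof -
    have "row_cost t \<le> row_cost s" using that(3) by (simp add: key_def)
    then have "D * length TM * row_cost t \<le> D * length TM * row_cost s" by (rule mult_le_mono2)
    also have "\<dots> \<le> C" using that(1) by (simp add: cheap_def)
    finally show ?thesis using that(2) by (simp add: cheap_def)
  qed
  then show ?thesis
    using selectable_upset[OF selectable_empty[of 0], of "[]" 7 "cheap D C"]
    by (auto simp: valid_filters_def region_def cheap_def numeral_2_eq_2)
qed

lemma set_cost_cheap_le: "D * set_cost (cheap D C) \<le> C"
proof (cases "TM = []")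
  case True
  then have "cheap D C = {}" unfolding cheap_def by simp
  then show ?thesis by (simp add: set_cost_def)
next
  case False
  have "length TM * (D * set_cost (cheap D C)) = (\<Sum>t\<in>cheap D C. D * length TM * row_cost t)"
    by (simp add: set_cost_def sum_distrib_left ac_simps)
  also have "\<dots> \<le> card (cheap D C) * C"
    using sum_bounded_above[of "cheap D C" _ C] by (simp add: cheap_def)
  also have "card (cheap D C) \<le> length TM"
    using card_mono[of "set TM" "cheap D C"] card_length[of TM] by (auto simp: cheap_def)
  finally show ?thesis using False by simp
qed

definition classes :: "nat \<Rightarrow> row \<Rightarrow> int \<times> int" where
  "classes D t = (scale_class D (row_size t), scale_class D (row_cost t))"

lemma card_classes_le:
  assumes D: "0 < D" and sizes: "\<And>t. t \<in> set TM \<Longrightarrow> 0 < row_size t \<and> row_size t \<le> 2 ^ L"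
    and len: "length TM \<le> 2 ^ L" and Q: "Q \<subseteq> set TM - cheap D C" "\<And>t. t \<in> Q \<Longrightarrow> row_cost t \<le> C"
  shows "card (classes D ` Q) \<le> (D * L + 1) * (D * (D + L) + 1)"
proof -
  let ?\<gamma> = "scale_class D C"
  have "classes D t \<in> {0..int (D * L)} \<times> {?\<gamma> - int (D * (D + L))..?\<gamma>}" if t: "t \<in> Q" for t
  proof -
    have tTM: "t \<in> set TM" "C < D * length TM * row_cost t" using t Q(1) by (auto simp: cheap_def)
    then have cost: "0 < row_cost t" by (cases "row_cost t") auto
    have C: "0 < C" using cost Q(2)[OF t] by simp
    have "D * length TM \<le> 2 ^ D * 2 ^ L"
      using len by (intro mult_le_mono) (simp_all add: less_imp_le)
    then have "D * length TM * row_cost t \<le> 2 ^ D * 2 ^ L * row_cost t" by (rule mult_le_mono1)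
    then have "C \<le> 2 ^ (D + L) * row_cost t" using tTM(2) unfolding power_add by linarith
    then have "?\<gamma> \<le> scale_class D (row_cost t) + int (D * (D + L))"
      using D cost C by (intro scale_class_le_add)
    moreover have "scale_class D (row_cost t) \<le> ?\<gamma>" using scale_class_mono[OF D cost Q(2)[OF t]] .
    moreover have "scale_class D 1 = 0" by (simp add: scale_class_def)
    then have "0 \<le> scale_class D (row_size t)" "scale_class D (row_size t) \<le> int (D * L)"
      using scale_class_mono[OF D, of 1 "row_size t"] scale_class_le_add[OF D, of 1 "row_size t" L]
        sizes[OF tTM(1)]
      by auto
    ultimately show ?thesis by (simp add: classes_def)
  qed
  then have "classes D ` Q \<subseteq> {0..int (D * L)} \<times> {?\<gamma> - int (D * (D + L))..?\<gamma>}" by blast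
  then have "card (classes D ` Q) \<le> card ({0..int (D * L)} \<times> {?\<gamma> - int (D * (D + L))..?\<gamma>})"
    by (intro card_mono) simp_all
  also have "\<dots> = (D * L + 1) * (D * (D + L) + 1)"
  proof -
    have "nat (int (D * L) - 0 + 1) = D * L + 1"
      "nat (?\<gamma> - (?\<gamma> - int (D * (D + L))) + 1) = D * (D + L) + 1"
      by linarith+
    then show ?thesis by (simp only: card_cartesian_product card_atLeastAtMost_int)
  qed
  finally show ?thesis .
qed

lemma box_class_subset:
  assumes D: "0 < D" and sizes: "\<And>t. t \<in> set TM \<Longrightarrow> 0 < row_size t" and Q: "Q \<subseteq> set TM - cheap D C"
  shows "box {t \<in> Q. classes D t = g} {2, 3} \<subseteq> {t. classes D t = g} - cheap D C"
proof
  fix t assume t: "t \<in> box {t \<in> Q. classes D t = g} {2, 3}"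
  then have tTM: "t \<in> set TM" using box_subset by blast
  from t obtain a b where ab: "a \<in> Q" "b \<in> Q" "classes D a = g" "classes D b = g"
    "row_size a \<le> row_size t" "row_size t \<le> row_size b" by (elim boxE[of t _ _ 2]) auto
  from t obtain a' b' where ab': "a' \<in> Q" "b' \<in> Q" "classes D a' = g" "classes D b' = g"
    "row_cost a' \<le> row_cost t" "row_cost t \<le> row_cost b'" by (elim boxE[of t _ _ 3]) auto
  have a': "C < D * length TM * row_cost a'" using ab'(1) Q by (auto simp: cheap_def)
  then have "0 < row_cost a'" by (cases "row_cost a'") auto
  then have "scale_class D (row_cost a') \<le> scale_class D (row_cost t)"
    "scale_class D (row_cost t) \<le> scale_class D (row_cost b')"
    using ab'(5,6) by (auto intro!: scale_class_mono[OF D])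
  moreover have "0 < row_size a" "0 < row_size t" using sizes ab(1) Q tTM by auto
  then have "scale_class D (row_size a) \<le> scale_class D (row_size t)"
    "scale_class D (row_size t) \<le> scale_class D (row_size b)"
    using ab(5,6) by (auto intro!: scale_class_mono[OF D])
  ultimately have "classes D t = g" using ab(3,4) ab'(3,4) by (auto simp: classes_def)
  moreover have "C < D * length TM * row_cost t"
    using a' mult_le_mono2[OF ab'(5), of "D * length TM"] by linarith
  ultimately show "t \<in> {t. classes D t = g} - cheap D C" by (simp add: cheap_def)
qed

end

definition selection_length :: "nat \<Rightarrow> nat \<Rightarrow> nat" where
  "selection_length D L = 2 + (D * L + 1) * (D * (D + L) + 1) * group_length D"

context crossing
begin

lemma dominate_class:
  assumes D: "0 < D" and sel: "selectable k S" and C: "C \<subseteq> set TM" "S \<inter> box C {2, 3} = {}"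
    and uniform: "\<And>s t. s \<in> C \<Longrightarrow> t \<in> C \<Longrightarrow>
      D * row_size s \<le> (D + 1) * row_size t \<and> D * row_cost s \<le> (D + 1) * row_cost t"
  shows "\<exists>S' \<subseteq> box C {2, 3}. selectable (k + group_length D) (S \<union> S') \<and>
    dominates (D * D) ((D + 1) * (D + 12)) S' C"
proof (cases "C = {}")
  case True
  then show ?thesis using selectable_mono[OF sel] by (intro exI[of _ "{}"]) simp
next
  case False
  interpret uniform_group TM m D C
    by unfold_locales (use D C(1) False uniform in auto)
  show ?thesis using sel C(2) by (rule dominate_group)
qed

lemma dominate_classes:
  fixes cls :: "row \<Rightarrow> 'c"
  assumes D: "0 < D" and sel: "selectable k B" and Q: "Q \<subseteq> set TM"
    and uniform: "\<And>s t. s \<in> Q \<Longrightarrow> t \<in> Q \<Longrightarrow> cls s = cls t \<Longrightarrow>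
      D * row_size s \<le> (D + 1) * row_size t \<and> D * row_cost s \<le> (D + 1) * row_cost t"
    and convex: "\<And>g. box {t \<in> Q. cls t = g} {2, 3} \<subseteq> {t. cls t = g} - B"
  shows "finite \<Gamma> \<Longrightarrow> \<exists>S \<subseteq> {t \<in> set TM. cls t \<in> \<Gamma>} - B.
    selectable (k + card \<Gamma> * group_length D) (B \<union> S) \<and>
    dominates (D * D) ((D + 1) * (D + 12)) S {t \<in> Q. cls t \<in> \<Gamma>}"
proof (induction \<Gamma> rule: finite_induct)
  case empty
  show ?case using sel by (intro exI[of _ "{}"]) simp
next
  case (insert g \<Gamma>)
  let ?Qg = "{t \<in> Q. cls t = g}" and ?Q\<Gamma> = "{t \<in> Q. cls t \<in> \<Gamma>}"
  from insert.IH obtain S where S: "S \<subseteq> {t \<in> set TM. cls t \<in> \<Gamma>} - B"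
    "selectable (k + card \<Gamma> * group_length D) (B \<union> S)"
    "dominates (D * D) ((D + 1) * (D + 12)) S ?Q\<Gamma>"
    by blast
  have "?Qg \<subseteq> set TM" "(B \<union> S) \<inter> box ?Qg {2, 3} = {}"
    using Q convex[of g] S(1) insert.hyps(2) by auto
  from dominate_class[OF D S(2) this] obtain Sg where Sg: "Sg \<subseteq> box ?Qg {2, 3}"
    "selectable (k + card \<Gamma> * group_length D + group_length D) (B \<union> S \<union> Sg)"
    "dominates (D * D) ((D + 1) * (D + 12)) Sg ?Qg"
    using uniform by auto
  have cls_Sg: "Sg \<subseteq> {t \<in> set TM. cls t = g} - B" using Sg(1) convex[of g] box_subset by blast
  have fin: "finite S" "finite Sg" "finite ?Q\<Gamma>" "finite ?Qg"
    using S(1) cls_Sg Q by (auto intro: finite_subset[of _ "set TM"])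
  have disj: "S \<inter> Sg = {}" "?Q\<Gamma> \<inter> ?Qg = {}" using S(1) cls_Sg insert.hyps(2) by auto
  have "dominates (D * D) ((D + 1) * (D + 12)) (S \<union> Sg) (?Q\<Gamma> \<union> ?Qg)"
    using S(3) Sg(3) fin(1,2) disj(1) fin(3,4) disj(2) by (rule dominates_Un)
  moreover have split: "{t \<in> Q. cls t \<in> insert g \<Gamma>} = ?Q\<Gamma> \<union> ?Qg" by auto
  moreover have "S \<union> Sg \<subseteq> {t \<in> set TM. cls t \<in> insert g \<Gamma>} - B" using S(1) cls_Sg by auto
  moreover have "k + card \<Gamma> * group_length D + group_length D =
    k + card (insert g \<Gamma>) * group_length D"
    using insert.hyps by simp
  then have "selectable (k + card (insert g \<Gamma>) * group_length D) (B \<union> (S \<union> Sg))"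
    using Sg(2) by (simp only: Un_assoc)
  ultimately show ?case unfolding split by blast
qed

lemma dominates_Un_cheap:
  assumes D: "0 < D" and finQ: "finite Q" and C: "C \<le> set_cost Q"
    and S: "S \<subseteq> set TM - cheap D C" "dominates (D * D) ((D + 1) * (D + 12)) S (Q - cheap D C)"
  shows "dominates D (D + 26) (cheap D C \<union> S) Q"
  unfolding dominates_def
proof (intro conjI allI)
  let ?B = "cheap D C"
  have disj: "finite S" "?B \<inter> S = {}" using S(1) finite_subset[of S "set TM"] by auto
  show "set_cover Q e \<le> set_cover (?B \<union> S) e" for e
  proof -
    have "set_cover Q e = set_cover (Q \<inter> ?B) e + set_cover (Q - ?B) e"
      using finQ by (subst set_cover_Un[symmetric]) (auto simp: Int_Diff_Un)
    also have "\<dots> \<le> set_cover ?B e + set_cover S e"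
    proof (rule add_mono)
      show "set_cover (Q \<inter> ?B) e \<le> set_cover ?B e" by (intro set_cover_mono) auto
      show "set_cover (Q - ?B) e \<le> set_cover S e" using S(2) by (simp add: dominates_def)
    qed
    also have "\<dots> = set_cover (?B \<union> S) e" by (rule set_cover_Un[OF finite_cheap disj, symmetric])
    finally show ?thesis .
  qed
  have B: "D * set_cost ?B \<le> set_cost Q" using set_cost_cheap_le C by (rule le_trans)
  have "set_cost (Q - ?B) \<le> set_cost Q" using finQ by (intro set_cost_mono) auto
  then have S: "D * D * set_cost S \<le> (D + 1) * (D + 12) * set_cost Q"
    using S(2) unfolding dominates_def by (meson le_trans mult_le_mono2)
  have "D * (D * set_cost (?B \<union> S)) = D * (D * set_cost ?B) + D * D * set_cost S"
    by (simp add: set_cost_Un[OF finite_cheap disj] algebra_simps)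
  also have "\<dots> \<le> D * set_cost Q + (D + 1) * (D + 12) * set_cost Q"
    by (intro add_mono S mult_le_mono2 B)
  also have "\<dots> = (D * D + 14 * D + 12) * set_cost Q" by (simp add: algebra_simps)
  also have "\<dots> \<le> (D * (D + 26)) * set_cost Q"
    using D by (intro mult_le_mono1) (simp add: algebra_simps)
  finally have "D * (D * set_cost (?B \<union> S)) \<le> D * ((D + 26) * set_cost Q)"
    by (simp only: mult.assoc)
  then show "D * set_cost (?B \<union> S) \<le> (D + 26) * set_cost Q" using D by simp
qed

text \<open>If \<open>C\<close> is the largest cost in \<open>Q\<close>, all tasks of cost at most \<open>C / (D n)\<close> together cost at most
  \<open>C / D\<close> and are selected. This leaves logarithmically many classes of costs.\<close>

lemma dominate:
  assumes D: "0 < D" and sizes: "\<And>t. t \<in> set TM \<Longrightarrow> 0 < row_size t \<and> row_size t \<le> 2 ^ L"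
    and len: "length TM \<le> 2 ^ L" and Q: "Q \<subseteq> set TM"
  shows "\<exists>S. selectable (selection_length D L) S \<and> dominates D (D + 26) S Q"
proof (cases "Q = {}")
  case True
  then show ?thesis using selectable_empty by (intro exI[of _ "{}"]) simp
next
  case False
  have finQ: "finite Q" using Q finite_subset by blast
  then obtain q where q: "q \<in> Q" "\<And>t. t \<in> Q \<Longrightarrow> row_cost t \<le> row_cost q"
    using finite_obtains_max[OF _ False, of row_cost] by blast
  define B where "B = cheap D (row_cost q)"
  define Q' where "Q' = Q - B"
  define \<Gamma> where "\<Gamma> = classes D ` Q'"
  have Q': "Q' \<subseteq> set TM - cheap D (row_cost q)" "finite Q'"
    using Q finQ by (auto simp: Q'_def B_def)
  have cost_pos: "0 < row_cost t" if "t \<in> Q'" for t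
    using that Q'(1) by (cases "row_cost t") (auto simp: cheap_def)
  have "\<exists>S \<subseteq> {t \<in> set TM. classes D t \<in> \<Gamma>} - B. selectable (2 + card \<Gamma> * group_length D) (B \<union> S) \<and>
    dominates (D * D) ((D + 1) * (D + 12)) S {t \<in> Q'. classes D t \<in> \<Gamma>}"
  proof (rule dominate_classes[OF D])
    show "selectable 2 B" unfolding B_def by (rule selectable_cheap)
    show "box {t \<in> Q'. classes D t = g} {2, 3} \<subseteq> {t. classes D t = g} - B" for g
      unfolding B_def using sizes Q'(1) by (intro box_class_subset[OF D]) auto
    show "D * row_size s \<le> (D + 1) * row_size t \<and> D * row_cost s \<le> (D + 1) * row_cost t"
      if "s \<in> Q'" "t \<in> Q'" "classes D s = classes D t" for s t
      using that Q'(1) sizes cost_pos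
      by (intro conjI le_of_scale_class_eq[OF D]) (auto simp: classes_def)
  qed (use Q' in \<open>auto simp: \<Gamma>_def\<close>)
  moreover have "{t \<in> Q'. classes D t \<in> \<Gamma>} = Q'" by (auto simp: \<Gamma>_def)
  ultimately obtain S where S: "S \<subseteq> set TM - B" "selectable (2 + card \<Gamma> * group_length D) (B \<union> S)"
    "dominates (D * D) ((D + 1) * (D + 12)) S Q'" by auto
  have "card \<Gamma> \<le> (D * L + 1) * (D * (D + L) + 1)"
    unfolding \<Gamma>_def using q(2) by (intro card_classes_le[OF D sizes len Q'(1)]) (auto simp: Q'_def)
  then have "selectable (selection_length D L) (B \<union> S)"
    unfolding selection_length_def by (intro selectable_mono[OF S(2)] add_left_mono mult_le_mono1)
  moreover have "row_cost q \<le> set_cost Q"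
    unfolding set_cost_def using q(1) finQ by (intro member_le_sum) auto
  then have "dominates D (D + 26) (B \<union> S) Q"
    unfolding B_def using S(1,3) by (intro dominates_Un_cheap[OF D finQ]) (auto simp: B_def Q'_def)
  ultimately show ?thesis by blast
qed

end

section \<open>Recursion on intervals of the path\<close>

definition cover :: "row list \<Rightarrow> nat \<Rightarrow> nat" where
  "cover ts e = (\<Sum>t\<leftarrow>ts. if uses t e then row_size t else 0)"

definition cost :: "row list \<Rightarrow> nat" where
  "cost ts = (\<Sum>t\<leftarrow>ts. row_cost t)"

lemma cover_append [simp]: "cover (xs @ ys) e = cover xs e + cover ys e"
  by (simp add: cover_def)

lemma cover_Nil [simp]: "cover [] e = 0"
  by (simp add: cover_def)

lemma cost_append [simp]: "cost (xs @ ys) = cost xs + cost ys"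
  by (simp add: cost_def)

lemma cost_Nil [simp]: "cost [] = 0"
  by (simp add: cost_def)

lemma cover_eq_set_cover: "distinct l \<Longrightarrow> cover l e = set_cover (set l) e"
  by (simp add: cover_def set_cover_def sum_list_distinct_conv_sum_set)

lemma cost_eq_set_cost: "distinct l \<Longrightarrow> cost l = set_cost (set l)"
  by (simp add: cost_def set_cost_def sum_list_distinct_conv_sum_set)

definition middle_tasks :: "row list \<Rightarrow> nat \<Rightarrow> nat \<Rightarrow> nat \<Rightarrow> row list" where
  "middle_tasks T a m b = filter (\<lambda>t. a \<le> row_start t \<and> uses t m \<and> row_end t \<le> b) T"

text \<open>\<open>A\<close> are the tasks that have been selected outside of the interval, \<open>S\<close> those among the tasks
  that use the middle edge \<open>m\<close>, and \<open>solve\<close> treats the intervals to the left and right of \<open>m\<close>.\<close>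

definition combine ::
  "(nat \<Rightarrow> nat \<Rightarrow> row list \<Rightarrow> result) \<Rightarrow> nat list \<Rightarrow> nat \<Rightarrow> nat \<Rightarrow> nat \<Rightarrow> row list \<Rightarrow> row list \<Rightarrow> result"
where
  "combine solve us a m b A S =
     (if cover (S @ A) m < us ! m then None
      else case solve a m (S @ A) of None \<Rightarrow> None | Some (c1, l1) \<Rightarrow>
        (case solve (m + 1) b (S @ A) of None \<Rightarrow> None | Some (c2, l2) \<Rightarrow>
          Some (c1 + c2 + cost S, S @ l1 @ l2)))"

primrec solve_interval ::
  "nat list \<Rightarrow> row list \<Rightarrow> nat \<Rightarrow> nat \<Rightarrow> nat \<Rightarrow> nat \<Rightarrow> row list \<Rightarrow> result" where
  "solve_interval us T K 0 a b A = Some (0, [])"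
| "solve_interval us T K (Suc h) a b A =
     (if a < b then
        (let m = (a + b) div 2; TM = middle_tasks T a m b in
          search (combine (solve_interval us T K h) us a m b A) TM K (TM, [], []))
      else Some (0, []))"

definition covers :: "nat list \<Rightarrow> row list \<Rightarrow> nat \<Rightarrow> nat \<Rightarrow> (nat \<Rightarrow> nat) \<Rightarrow> bool" where
  "covers us A a b f \<longleftrightarrow> (\<forall>e. a \<le> e \<and> e < b \<longrightarrow> us ! e \<le> f e + cover A e)"

definition tasks_within :: "row list \<Rightarrow> nat \<Rightarrow> nat \<Rightarrow> row set" where
  "tasks_within T a b = {t \<in> set T. a \<le> row_start t \<and> row_end t \<le> b}"

definition left_tasks :: "row set \<Rightarrow> nat \<Rightarrow> row set" where
  "left_tasks Q m = {t \<in> Q. row_end t \<le> m}"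

definition crossing_tasks :: "row set \<Rightarrow> nat \<Rightarrow> row set" where
  "crossing_tasks Q m = {t \<in> Q. uses t m}"

definition right_tasks :: "row set \<Rightarrow> nat \<Rightarrow> row set" where
  "right_tasks Q m = {t \<in> Q. m < row_start t \<and> m < row_end t}"

lemma set_middle_tasks: "set (middle_tasks T a m b) = crossing_tasks (tasks_within T a b) m"
  by (auto simp: middle_tasks_def crossing_tasks_def tasks_within_def)

lemma length_middle_tasks_le: "length (middle_tasks T a m b) \<le> length T"
  by (simp add: middle_tasks_def)

lemma halves_of_interval:
  fixes a b h :: nat
  assumes "a < b" "b - a < 2 ^ Suc h"
  shows "a \<le> (a + b) div 2" "(a + b) div 2 < b"
    "(a + b) div 2 - a < 2 ^ h" "b - ((a + b) div 2 + 1) < 2 ^ h"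
  using assms by auto

lemma combine_eq_SomeE:
  assumes "combine solve us a m b A S = Some (c, l)"
  obtains c1 l1 c2 l2 where "us ! m \<le> cover (S @ A) m" "solve a m (S @ A) = Some (c1, l1)"
    "solve (m + 1) b (S @ A) = Some (c2, l2)" "c = c1 + c2 + cost S" "l = S @ l1 @ l2"
  using assms by (auto simp: combine_def split: if_splits option.splits)

lemma covers_append:
  assumes "us ! m \<le> cover (S @ A) m"
    "covers us (S @ A) a m (cover l1)" "covers us (S @ A) (m + 1) b (cover l2)"
  shows "covers us A a b (cover (S @ l1 @ l2))"
  unfolding covers_def
proof (intro allI impI)
  fix e assume e: "a \<le> e \<and> e < b"
  consider "e < m" | "e = m" | "m + 1 \<le> e" by linarith
  then show "us ! e \<le> cover (S @ l1 @ l2) e + cover A e"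
    using assms e by cases (fastforce simp: covers_def)+
qed

lemma solve_interval_Suc_SomeE:
  assumes "distinct T" "a < b" "solve_interval us T K (Suc h) a b A = Some (c, l)"
  obtains S where "combine (solve_interval us T K h) us a ((a + b) div 2) b A S = Some (c, l)"
    "distinct S" "set S \<subseteq> crossing_tasks (tasks_within T a b) ((a + b) div 2)"
proof -
  let ?m = "(a + b) div 2"
  let ?TM = "middle_tasks T a ?m b"
  have "search (combine (solve_interval us T K h) us a ?m b A) ?TM K (?TM, [], []) = Some (c, l)"
    using assms(2,3) by (simp add: Let_def)
  moreover have "distinct (state_tasks (?TM, [], []))"
    using assms(1) by (simp add: middle_tasks_def)
  ultimately show ?thesis by (rule search_Some) (simp add: that set_middle_tasks)
qed

lemma solve_interval_sound:
  assumes "distinct T"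
  shows "solve_interval us T K h a b A = Some (c, l) \<Longrightarrow> b - a < 2 ^ h \<Longrightarrow>
    distinct l \<and> set l \<subseteq> {t \<in> tasks_within T a b. row_start t < row_end t} \<and> c = cost l \<and>
    covers us A a b (cover l)"
proof (induction h arbitrary: a b A c l)
  case 0
  then show ?case by (auto simp: covers_def)
next
  case (Suc h)
  show ?case
  proof (cases "a < b")
    case False
    then show ?thesis using Suc.prems by (auto simp: covers_def)
  next
    case True
    define m where "m = (a + b) div 2"
    note m = halves_of_interval[OF True Suc.prems(2), folded m_def]
    obtain S where S: "combine (solve_interval us T K h) us a m b A S = Some (c, l)"
      "distinct S" "set S \<subseteq> crossing_tasks (tasks_within T a b) m"
      using solve_interval_Suc_SomeE[OF assms True Suc.prems(1), folded m_def] by blast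
    from S(1) obtain c1 l1 c2 l2 where cov: "us ! m \<le> cover (S @ A) m"
      and l1: "solve_interval us T K h a m (S @ A) = Some (c1, l1)"
      and l2: "solve_interval us T K h (m + 1) b (S @ A) = Some (c2, l2)"
      and l: "c = c1 + c2 + cost S" "l = S @ l1 @ l2" by (rule combine_eq_SomeE)
    note left = Suc.IH[OF l1 m(3)] and right = Suc.IH[OF l2 m(4)]
    have "set S \<inter> set l1 = {}" "set S \<inter> set l2 = {}" "set l1 \<inter> set l2 = {}"
      using S(3) left right by (fastforce simp: tasks_within_def crossing_tasks_def uses_def)+
    then have "distinct l" unfolding l(2) using S(2) left right by (simp add: Int_Un_distrib)
    moreover have "set l \<subseteq> {t \<in> tasks_within T a b. row_start t < row_end t}"
      unfolding l(2) using S(3) left right m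
      by (fastforce simp: tasks_within_def crossing_tasks_def uses_def)
    moreover have "c = cost l" using left right l by simp
    moreover have "covers us A a b (cover l)"
      unfolding l(2) using cov left right by (intro covers_append) auto
    ultimately show ?thesis by blast
  qed
qed

lemma length_solve_interval_le:
  assumes "distinct T" "solve_interval us T K h a b A = Some (c, l)" "b - a < 2 ^ h"
  shows "length l \<le> length T"
proof -
  have "distinct l" "set l \<subseteq> set T"
    using solve_interval_sound[OF assms] by (auto simp: tasks_within_def)
  then show ?thesis using card_mono[of "set T" "set l"] assms(1) by (simp add: distinct_card)
qed

lemma set_cover_eq_0: "(\<And>t. t \<in> X \<Longrightarrow> \<not> uses t e) \<Longrightarrow> set_cover X e = 0"
  by (simp add: set_cover_def)

lemma
  assumes "finite Q"
  shows set_cost_partition: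
      "set_cost Q = set_cost (left_tasks Q m) + set_cost (crossing_tasks Q m) +
        set_cost (right_tasks Q m)"
    and set_cover_partition: "set_cover Q e =
      set_cover (left_tasks Q m) e + set_cover (crossing_tasks Q m) e +
      set_cover (right_tasks Q m) e"
proof -
  note defs = left_tasks_def crossing_tasks_def right_tasks_def uses_def
  have Q: "Q = left_tasks Q m \<union> crossing_tasks Q m \<union> right_tasks Q m" by (auto simp: defs)
  have fin: "finite (left_tasks Q m)" "finite (crossing_tasks Q m)" "finite (right_tasks Q m)"
    using assms by (auto simp: defs)
  have disj: "left_tasks Q m \<inter> crossing_tasks Q m = {}"
    "(left_tasks Q m \<union> crossing_tasks Q m) \<inter> right_tasks Q m = {}" by (auto simp: defs)
  show "set_cost Q = set_cost (left_tasks Q m) + set_cost (crossing_tasks Q m) +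
    set_cost (right_tasks Q m)"
    by (subst Q) (use fin disj in \<open>simp add: set_cost_Un\<close>)
  show "set_cover Q e =
      set_cover (left_tasks Q m) e + set_cover (crossing_tasks Q m) e +
      set_cover (right_tasks Q m) e"
    by (subst Q) (use fin disj in \<open>simp add: set_cover_Un\<close>)
qed

lemma covers_split:
  assumes Q: "finite Q" "covers us A a b (set_cover Q)" and m: "a \<le> m" "m < b"
    and S: "\<And>e. set_cover (crossing_tasks Q m) e \<le> cover S e"
  shows "covers us (S @ A) a m (set_cover (left_tasks Q m))"
    and "us ! m \<le> cover (S @ A) m"
    and "covers us (S @ A) (m + 1) b (set_cover (right_tasks Q m))"
proof -
  have left: "set_cover (left_tasks Q m) e = 0" if "m \<le> e" for e
    using that by (intro set_cover_eq_0) (auto simp: left_tasks_def uses_def)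
  have right: "set_cover (right_tasks Q m) e = 0" if "e \<le> m" for e
    using that by (intro set_cover_eq_0) (auto simp: right_tasks_def uses_def)
  have demand: "us ! e \<le> set_cover (left_tasks Q m) e + set_cover (right_tasks Q m) e +
    cover (S @ A) e"
    if "a \<le> e" "e < b" for e
    using Q(2) that set_cover_partition[OF Q(1), of e m] S[of e] by (fastforce simp: covers_def)
  show "us ! m \<le> cover (S @ A) m" using demand[OF m] left[of m] right[of m] by simp
  show "covers us (S @ A) a m (set_cover (left_tasks Q m))"
    unfolding covers_def
  proof (intro allI impI)
    fix e assume "a \<le> e \<and> e < m"
    then show "us ! e \<le> set_cover (left_tasks Q m) e + cover (S @ A) e"
      using demand[of e] right[of e] m by linarith
  qed
  show "covers us (S @ A) (m + 1) b (set_cover (right_tasks Q m))"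
    unfolding covers_def
  proof (intro allI impI)
    fix e assume "m + 1 \<le> e \<and> e < b"
    then show "us ! e \<le> set_cover (right_tasks Q m) e + cover (S @ A) e"
      using demand[of e] left[of e] m by linarith
  qed
qed

lemma ex_selection_of_middle_tasks:
  assumes dist: "distinct T" and D: "0 < D" and len: "length T \<le> 2 ^ L"
    and sizes: "\<And>t. t \<in> set T \<Longrightarrow> 0 < row_size t \<and> row_size t \<le> 2 ^ L"
    and K: "selection_length D L \<le> K" and Q: "Q \<subseteq> tasks_within T a b"
  obtains st where "moves (middle_tasks T a m b) K (middle_tasks T a m b, [], []) st"
    "\<And>e. set_cover (crossing_tasks Q m) e \<le> cover (selected st) e"
    "D * cost (selected st) \<le> (D + 26) * set_cost (crossing_tasks Q m)"
proof -
  let ?TM = "middle_tasks T a m b"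
  interpret crossing ?TM m
    by unfold_locales (use dist in \<open>auto simp: middle_tasks_def\<close>)
  have len: "length ?TM \<le> 2 ^ L" using length_middle_tasks_le len by (rule le_trans)
  have "crossing_tasks Q m \<subseteq> set ?TM" using Q by (auto simp: set_middle_tasks crossing_tasks_def)
  then obtain S where S: "selectable (selection_length D L) S"
    "dominates D (D + 26) S (crossing_tasks Q m)"
    using dominate[OF D _ len, of "crossing_tasks Q m"] sizes by (auto simp: middle_tasks_def)
  obtain R l where l: "moves ?TM K (?TM, [], []) (R, [], l)" "set l = S"
    using selectable_mono[OF S(1) K] unfolding selectable_def by blast
  have "distinct l" using moves_from_start(1)[OF l(1)] by simp
  then show ?thesis
    using S(2) l(2)
    by (intro that[OF l(1)]) (auto simp: dominates_def cover_eq_set_cover cost_eq_set_cost)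
qed

lemma solve_interval_Suc_le:
  assumes "a < b" "moves (middle_tasks T a m b) K (middle_tasks T a m b, [], []) st"
    and m: "m = (a + b) div 2" "us ! m \<le> cover (selected st @ A) m"
    and "solve_interval us T K h a m (selected st @ A) = Some (c1, l1)"
    and "solve_interval us T K h (m + 1) b (selected st @ A) = Some (c2, l2)"
  obtains c l where "solve_interval us T K (Suc h) a b A = Some (c, l)"
    "c \<le> c1 + c2 + cost (selected st)"
proof -
  have "combine (solve_interval us T K h) us a m b A (selected st) =
      Some (c1 + c2 + cost (selected st), selected st @ l1 @ l2)"
    using assms by (simp add: combine_def)
  from search_le[of _ _ _ _ "combine (solve_interval us T K h) us a m b A", OF assms(2) this]
  show ?thesis using that assms(1) m(1) by (auto simp: Let_def)
qed

lemma solve_interval_complete: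
  assumes dist: "distinct T" and D: "0 < D" and len: "length T \<le> 2 ^ L"
    and sizes: "\<And>t. t \<in> set T \<Longrightarrow> 0 < row_size t \<and> row_size t \<le> 2 ^ L"
    and K: "selection_length D L \<le> K"
  shows "b - a < 2 ^ h \<Longrightarrow> Q \<subseteq> tasks_within T a b \<Longrightarrow> covers us A a b (set_cover Q) \<Longrightarrow>
    \<exists>c l. solve_interval us T K h a b A = Some (c, l) \<and> D * c \<le> (D + 26) * set_cost Q"
proof (induction h arbitrary: a b A Q)
  case 0
  then show ?case by simp
next
  case (Suc h)
  show ?case
  proof (cases "a < b")
    case False
    then show ?thesis by simp
  next
    case True
    define m where "m = (a + b) div 2"
    note m = halves_of_interval[OF True Suc.prems(1), folded m_def]
    let ?TM = "middle_tasks T a m b"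
    have finQ: "finite Q" using Suc.prems(2) by (rule finite_subset) (simp add: tasks_within_def)
    obtain st where st: "moves ?TM K (?TM, [], []) st"
      "\<And>e. set_cover (crossing_tasks Q m) e \<le> cover (selected st) e"
      "D * cost (selected st) \<le> (D + 26) * set_cost (crossing_tasks Q m)"
      using ex_selection_of_middle_tasks[OF dist D len sizes K Suc.prems(2)] by blast
    define S where "S = selected st"
    note S = st(2,3)[folded S_def]
      and split = covers_split[OF finQ Suc.prems(3) m(1,2) st(2), folded S_def]
    have "left_tasks Q m \<subseteq> tasks_within T a m" "right_tasks Q m \<subseteq> tasks_within T (m + 1) b"
      using Suc.prems(2) by (auto simp: left_tasks_def right_tasks_def tasks_within_def)
    note subproblems = Suc.IH[OF m(3) this(1) split(1)] Suc.IH[OF m(4) this(2) split(3)]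
    then obtain c1 l1 c2 l2 where l1: "solve_interval us T K h a m (S @ A) = Some (c1, l1)"
        "D * c1 \<le> (D + 26) * set_cost (left_tasks Q m)"
      and l2: "solve_interval us T K h (m + 1) b (S @ A) = Some (c2, l2)"
        "D * c2 \<le> (D + 26) * set_cost (right_tasks Q m)" by blast
    from solve_interval_Suc_le[OF True st(1) m_def, folded S_def, OF split(2) l1(1) l2(1)]
    obtain c l where c: "solve_interval us T K (Suc h) a b A = Some (c, l)" "c \<le> c1 + c2 + cost S"
      by blast
    have "D * c \<le> D * c1 + D * c2 + D * cost S"
      using mult_le_mono2[OF c(2), of D] by (simp add: distrib_left)
    then have "D * c \<le> (D + 26) * set_cost Q"
      using l1(2) l2(2) S(2) unfolding set_cost_partition[OF finQ, of m] distrib_left by linarith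
    with c(1) show ?thesis by blast
  qed
qed

section \<open>Unit cost\<close>

fun max_bits :: "val \<Rightarrow> nat" where
  "max_bits (VNat n) = floorlog 2 n"
| "max_bits (VPair a b) = max (max_bits a) (max_bits b)"

lemma leaf_bits_le_max_bits: "leaf_bits v \<le> max_bits v"
  by (cases v) auto

lemma max_bits_of_truth: "max_bits (of_truth b) \<le> 1"
  by (simp add: of_truth_def floorlog_le_iff)

lemma max_bits_unop: "unop_sem f a = Some v \<Longrightarrow> max_bits v \<le> max_bits a + 1"
  by (cases f; cases a) (auto intro: le_trans[OF max_bits_of_truth])

lemma max_bits_binop:
  assumes "binop_sem f a b = Some v" "f \<noteq> OMul" "max_bits a \<le> B" "max_bits b \<le> B"
  shows "max_bits v \<le> B + 1"
proof -
  have "m div n < 2 * b" if "m < b" for m n b :: nat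
    using that div_le_dividend[of m n] by linarith
  then show ?thesis
    using assms by (cases "(f, a, b)" rule: binop_sem.cases)
      (auto simp: floorlog_le_iff intro: le_trans[OF max_bits_of_truth])
qed

lemma binop_cost_le:
  assumes "max_bits a \<le> B" "max_bits b \<le> B"
  shows "binop_cost f a b \<le> 1 + 2 * B"
  using assms leaf_bits_le_max_bits[of a] leaf_bits_le_max_bits[of b]
  by (auto simp: binop_cost_def)

text \<open>Without multiplication, \<open>n\<close> unit steps lengthen numbers of at most \<open>B\<close> bits by at most \<open>n\<close>
  bits, so each step costs at most \<open>1 + 2 (B + n)\<close>.\<close>

definition bit_cost :: "nat \<Rightarrow> nat \<Rightarrow> nat" where
  "bit_cost B n = n * (1 + 2 * (B + n))"

lemma bit_cost_mono: "n \<le> n' \<Longrightarrow> bit_cost B n \<le> bit_cost B n'"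
  unfolding bit_cost_def by (intro mult_le_mono) auto

lemma bit_cost_add:
  "bit_cost B m + bit_cost (B + m) n + c \<le> bit_cost B (m + n + 1)" if "c \<le> 1 + 2 * (B + m + n)"
  using that by (simp add: bit_cost_def algebra_simps)

definition runs :: "program \<Rightarrow> val list \<Rightarrow> expr \<Rightarrow> val \<Rightarrow> nat \<Rightarrow> bool" where
  "runs P env e v n \<longleftrightarrow> (\<forall>B. (\<forall>x\<in>set env. max_bits x \<le> B) \<longrightarrow>
     max_bits v \<le> B + n \<and> (\<exists>k. eval P env e v k \<and> k \<le> bit_cost B n))"

definition runs_list :: "program \<Rightarrow> val list \<Rightarrow> expr list \<Rightarrow> val list \<Rightarrow> nat \<Rightarrow> bool" where
  "runs_list P env es vs n \<longleftrightarrow> (\<forall>B. (\<forall>x\<in>set env. max_bits x \<le> B) \<longrightarrow>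
     (\<forall>v\<in>set vs. max_bits v \<le> B + n) \<and> (\<exists>k. evals P env es vs k \<and> k \<le> bit_cost B n))"

lemma runsE:
  assumes "runs P env e v n" "\<forall>x\<in>set env. max_bits x \<le> B"
  obtains k where "max_bits v \<le> B + n" "eval P env e v k" "k \<le> bit_cost B n"
  using assms unfolding runs_def by blast

lemma runs_listE:
  assumes "runs_list P env es vs n" "\<forall>x\<in>set env. max_bits x \<le> B"
  obtains k where "\<forall>v\<in>set vs. max_bits v \<le> B + n" "evals P env es vs k" "k \<le> bit_cost B n"
  using assms unfolding runs_list_def by blast

lemma runs_mono: "runs P env e v n \<Longrightarrow> n \<le> n' \<Longrightarrow> runs P env e v n'"
  unfolding runs_def by (meson add_left_mono bit_cost_mono le_trans)

lemma runs_Var: "i < length env \<Longrightarrow> runs P env (Var i) (env ! i) 1"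
  unfolding runs_def
  by (auto simp: bit_cost_def intro!: exI[of _ 1] eval_Var[simplified] dest: nth_mem intro: le_SucI)

lemma runs_Const: "runs P env (Const c) (VNat c) (c + 1)"
proof -
  have "floorlog 2 c \<le> c" by (simp add: floorlog_le_iff)
  then show ?thesis
    unfolding runs_def by (auto simp: bit_cost_def trans_le_add2 intro!: exI[of _ 1] eval_Const)
qed

lemma runs_Unary:
  assumes e: "runs P env e a k" and f: "unop_sem f a = Some v"
  shows "runs P env (Unary f e) v (k + 1)"
  unfolding runs_def
proof (intro allI impI)
  fix B assume B: "\<forall>x\<in>set env. max_bits x \<le> B"
  obtain i where i: "max_bits a \<le> B + k" "eval P env e a i" "i \<le> bit_cost B k"
    using e B by (rule runsE)
  have "i + 1 \<le> bit_cost B (k + 1)" using i(3) bit_cost_add[of 1 B k 0] by simp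
  then show "max_bits v \<le> B + (k + 1) \<and> (\<exists>j. eval P env (Unary f e) v j \<and> j \<le> bit_cost B (k + 1))"
    using max_bits_unop[OF f] i(1) eval_Un[OF i(2) f] by fastforce
qed

lemma runs_Binary:
  assumes e1: "runs P env e1 a k1" and e2: "runs P env e2 b k2"
    and f: "f \<noteq> OMul" "binop_sem f a b = Some v"
  shows "runs P env (Binary f e1 e2) v (k1 + k2 + 1)"
  unfolding runs_def
proof (intro allI impI)
  fix B assume B: "\<forall>x\<in>set env. max_bits x \<le> B"
  obtain i where i: "max_bits a \<le> B + k1" "eval P env e1 a i" "i \<le> bit_cost B k1"
    using e1 B by (rule runsE)
  have "\<forall>x\<in>set env. max_bits x \<le> B + k1" using B by (auto intro: trans_le_add1)
  with e2 obtain j where j: "max_bits b \<le> B + k1 + k2" "eval P env e2 b j"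
    "j \<le> bit_cost (B + k1) k2"
    by (rule runsE)
  have a: "max_bits a \<le> B + k1 + k2" using i(1) by simp
  have "max_bits v \<le> B + (k1 + k2 + 1)" using max_bits_binop[OF f(2,1) a j(1)] by simp
  moreover have "i + j + binop_cost f a b \<le> bit_cost B (k1 + k2 + 1)"
    using bit_cost_add[OF binop_cost_le[OF a j(1)], of f] i(3) j(3) by linarith
  ultimately show "max_bits v \<le> B + (k1 + k2 + 1) \<and>
      (\<exists>k. eval P env (Binary f e1 e2) v k \<and> k \<le> bit_cost B (k1 + k2 + 1))"
    using eval_Bin[OF i(2) j(2) f(2)] by blast
qed

lemma runs_LetIn:
  assumes e1: "runs P env e1 a k1" and e2: "runs P (a # env) e2 v k2"
  shows "runs P env (LetIn e1 e2) v (k1 + k2 + 1)"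
  unfolding runs_def
proof (intro allI impI)
  fix B assume B: "\<forall>x\<in>set env. max_bits x \<le> B"
  obtain i where i: "max_bits a \<le> B + k1" "eval P env e1 a i" "i \<le> bit_cost B k1"
    using e1 B by (rule runsE)
  have "\<forall>x\<in>set (a # env). max_bits x \<le> B + k1" using B i(1) by (auto intro: trans_le_add1)
  with e2 obtain j where j: "max_bits v \<le> B + k1 + k2" "eval P (a # env) e2 v j"
    "j \<le> bit_cost (B + k1) k2" by (rule runsE)
  have "i + j + 1 \<le> bit_cost B (k1 + k2 + 1)" using bit_cost_add[of 1 B k1 k2] i(3) j(3) by linarith
  then show "max_bits v \<le> B + (k1 + k2 + 1) \<and>
      (\<exists>k. eval P env (LetIn e1 e2) v k \<and> k \<le> bit_cost B (k1 + k2 + 1))"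
    using j(1) eval_Let[OF i(2) j(2)] by fastforce
qed

lemma runs_IfNonzero:
  assumes e: "runs P env e a k1" and branch: "runs P env (if a = VNat 0 then e2 else e1) v k2"
  shows "runs P env (IfNonzero e e1 e2) v (k1 + k2 + 1)"
  unfolding runs_def
proof (intro allI impI)
  fix B assume B: "\<forall>x\<in>set env. max_bits x \<le> B"
  obtain i where i: "eval P env e a i" "i \<le> bit_cost B k1" using e B by (rule runsE)
  have "\<forall>x\<in>set env. max_bits x \<le> B + k1" using B by (auto intro: trans_le_add1)
  with branch obtain j where j: "max_bits v \<le> B + k1 + k2"
    "eval P env (if a = VNat 0 then e2 else e1) v j" "j \<le> bit_cost (B + k1) k2" by (rule runsE)
  have "eval P env (IfNonzero e e1 e2) v (i + j + 1)"
    using i(1) j(2)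
    by (cases "a = VNat 0") (auto intro: eval_If_true eval_If_false simp del: One_nat_def)
  moreover have "i + j + 1 \<le> bit_cost B (k1 + k2 + 1)"
    using bit_cost_add[of 1 B k1 k2] i(2) j(3) by linarith
  ultimately show "max_bits v \<le> B + (k1 + k2 + 1) \<and>
      (\<exists>k. eval P env (IfNonzero e e1 e2) v k \<and> k \<le> bit_cost B (k1 + k2 + 1))"
    using j(1) by fastforce
qed

lemma runs_Call:
  assumes es: "runs_list P env es vs k1" and body: "runs P vs (P ! f) v k2" and f: "f < length P"
  shows "runs P env (Call f es) v (k1 + k2 + 1)"
  unfolding runs_def
proof (intro allI impI)
  fix B assume B: "\<forall>x\<in>set env. max_bits x \<le> B"
  obtain i where i: "\<forall>x\<in>set vs. max_bits x \<le> B + k1" "evals P env es vs i" "i \<le> bit_cost B k1"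
    using es B by (rule runs_listE)
  obtain j where j: "max_bits v \<le> B + k1 + k2" "eval P vs (P ! f) v j" "j \<le> bit_cost (B + k1) k2"
    using body i(1) by (rule runsE)
  have "i + j + 1 \<le> bit_cost B (k1 + k2 + 1)" using bit_cost_add[of 1 B k1 k2] i(3) j(3) by linarith
  then show "max_bits v \<le> B + (k1 + k2 + 1) \<and>
      (\<exists>k. eval P env (Call f es) v k \<and> k \<le> bit_cost B (k1 + k2 + 1))"
    using j(1) eval_Call[OF f i(2) j(2)] by fastforce
qed

lemma runs_list_Nil: "runs_list P env [] [] 0"
  unfolding runs_list_def by (auto intro: evals_Nil)

lemma runs_list_Cons:
  assumes e: "runs P env e v k1" and es: "runs_list P env es vs k2"
  shows "runs_list P env (e # es) (v # vs) (k1 + k2 + 1)"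
  unfolding runs_list_def
proof (intro allI impI)
  fix B assume B: "\<forall>x\<in>set env. max_bits x \<le> B"
  obtain i where i: "max_bits v \<le> B + k1" "eval P env e v i" "i \<le> bit_cost B k1"
    using e B by (rule runsE)
  have "\<forall>x\<in>set env. max_bits x \<le> B + k1" using B by (auto intro: trans_le_add1)
  with es obtain j where j: "\<forall>x\<in>set vs. max_bits x \<le> B + k1 + k2" "evals P env es vs j"
    "j \<le> bit_cost (B + k1) k2" by (rule runs_listE)
  have "i + j \<le> bit_cost B (k1 + k2 + 1)" using bit_cost_add[of 0 B k1 k2] i(3) j(3) by linarith
  then show "(\<forall>x\<in>set (v # vs). max_bits x \<le> B + (k1 + k2 + 1)) \<and>
      (\<exists>k. evals P env (e # es) (v # vs) k \<and> k \<le> bit_cost B (k1 + k2 + 1))"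
    using i(1) j(1) evals_Cons[OF i(2) j(2)] by fastforce
qed

definition calls :: "program \<Rightarrow> nat \<Rightarrow> val list \<Rightarrow> val \<Rightarrow> nat \<Rightarrow> bool" where
  "calls P f vs v n \<longleftrightarrow> f < length P \<and> runs P vs (P ! f) v n"

definition call_wp :: "program \<Rightarrow> nat \<Rightarrow> val list \<Rightarrow> (val \<Rightarrow> nat \<Rightarrow> bool) \<Rightarrow> bool" where
  "call_wp P f vs Q \<longleftrightarrow> (\<exists>v n. calls P f vs v n \<and> Q v n)"

fun wp :: "program \<Rightarrow> expr \<Rightarrow> val list \<Rightarrow> (val \<Rightarrow> nat \<Rightarrow> bool) \<Rightarrow> bool"
  and wps :: "program \<Rightarrow> expr list \<Rightarrow> val list \<Rightarrow> (val list \<Rightarrow> nat \<Rightarrow> bool) \<Rightarrow> bool" where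
  "wp P (Var i) env Q \<longleftrightarrow> i < length env \<and> Q (env ! i) 1"
| "wp P (Const c) env Q \<longleftrightarrow> Q (VNat c) (c + 1)"
| "wp P (Unary f e) env Q \<longleftrightarrow>
     wp P e env (\<lambda>a k. case unop_sem f a of None \<Rightarrow> False | Some v \<Rightarrow> Q v (k + 1))"
| "wp P (Binary f e1 e2) env Q \<longleftrightarrow> f \<noteq> OMul \<and>
     wp P e1 env (\<lambda>a k1. wp P e2 env (\<lambda>b k2.
       case binop_sem f a b of None \<Rightarrow> False | Some v \<Rightarrow> Q v (k1 + k2 + 1)))"
| "wp P (LetIn e1 e2) env Q \<longleftrightarrow>
     wp P e1 env (\<lambda>a k1. wp P e2 (a # env) (\<lambda>v k2. Q v (k1 + k2 + 1)))"
| "wp P (IfNonzero e e1 e2) env Q \<longleftrightarrow>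
     wp P e env (\<lambda>a k1. if a = VNat 0 then wp P e2 env (\<lambda>v k2. Q v (k1 + k2 + 1))
       else wp P e1 env (\<lambda>v k2. Q v (k1 + k2 + 1)))"
| "wp P (Call f es) env Q \<longleftrightarrow> wps P es env (\<lambda>vs k1. call_wp P f vs (\<lambda>v k2. Q v (k1 + k2 + 1)))"
| "wps P [] env Q \<longleftrightarrow> Q [] 0"
| "wps P (e # es) env Q \<longleftrightarrow> wp P e env (\<lambda>v k1. wps P es env (\<lambda>vs k2. Q (v # vs) (k1 + k2 + 1)))"

lemma wp_imp_runs:
  "wp P e env Q \<Longrightarrow> \<exists>v n. runs P env e v n \<and> Q v n"
  "wps P es env R \<Longrightarrow> \<exists>vs n. runs_list P env es vs n \<and> R vs n"
proof (induction P e env Q and P es env R rule: wp_wps.induct)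
  case (1 P i env Q)
  then show ?case using runs_Var[of i env P] by auto
next
  case (2 P c env Q)
  then show ?case using runs_Const[of P env c] by auto
next
  case (3 P f e env Q)
  from 3(1)[OF 3(2)[unfolded wp.simps]] show ?case
    by (fastforce split: option.splits intro: runs_Unary)
next
  case (4 P f e1 e2 env Q)
  then show ?case by (fastforce split: option.splits intro: runs_Binary)
next
  case (5 P e1 e2 env Q)
  then show ?case by (fastforce intro: runs_LetIn)
next
  case (6 P e e1 e2 env Q)
  from 6(3)[OF 6(4)[unfolded wp.simps]] obtain a k1 where a: "runs P env e a k1"
    and branch: "if a = VNat 0 then wp P e2 env (\<lambda>v k2. Q v (k1 + k2 + 1))
       else wp P e1 env (\<lambda>v k2. Q v (k1 + k2 + 1))" by blast
  have "\<exists>v k2. runs P env (if a = VNat 0 then e2 else e1) v k2 \<and> Q v (k1 + k2 + 1)"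
    using branch 6(1,2)[of a k1] by (auto split: if_splits)
  then show ?case using runs_IfNonzero[OF a] by blast
next
  case (7 P f es env Q)
  then show ?case by (fastforce simp: call_wp_def calls_def intro: runs_Call)
next
  case (8 P env Q)
  then show ?case by (auto intro: runs_list_Nil)
next
  case (9 P e es env Q)
  then show ?case by (fastforce intro: runs_list_Cons)
qed

lemma callsI: "f < length P \<Longrightarrow> wp P (P ! f) vs (\<lambda>v' k. v' = v \<and> k \<le> n) \<Longrightarrow> calls P f vs v n"
  unfolding calls_def using wp_imp_runs(1) runs_mono by blast

lemma call_wpI: "calls P f vs v n \<Longrightarrow> Q v n \<Longrightarrow> call_wp P f vs Q"
  unfolding call_wp_def by blast

lemma calls_mono: "calls P f vs v n \<Longrightarrow> n \<le> n' \<Longrightarrow> calls P f vs v n'"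
  unfolding calls_def using runs_mono by blast

section \<open>The program\<close>

abbreviation (input) "Fst e \<equiv> Unary OFst e"
abbreviation (input) "Snd e \<equiv> Unary OSnd e"
abbreviation (input) "Add a b \<equiv> Binary OAdd a b"
abbreviation (input) "Sub a b \<equiv> Binary OSub a b"
abbreviation (input) "Div a b \<equiv> Binary ODiv a b"
abbreviation (input) "Less a b \<equiv> Binary OLess a b"
abbreviation (input) "MkPair a b \<equiv> Binary OCons a b"

definition fMul :: nat where "fMul = 1"
definition fCostDen :: nat where "fCostDen = 2"
definition fRows :: nat where "fRows = 3"
definition fCeilings :: nat where "fCeilings = 4"
definition fLength :: nat where "fLength = 5"
definition fSum :: nat where "fSum = 6"
definition fBits :: nat where "fBits = 7"
definition fNth :: nat where "fNth = 8"
definition fCover :: nat where "fCover = 9"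
definition fAppend :: nat where "fAppend = 10"
definition fMiddle :: nat where "fMiddle = 11"
definition fCompare :: nat where "fCompare = 12"
definition fFilter :: nat where "fFilter = 13"
definition fPick :: nat where "fPick = 14"
definition fBetter :: nat where "fBetter = 15"
definition fSearch :: nat where "fSearch = 16"
definition fOps :: nat where "fOps = 17"
definition fSuffixes :: nat where "fSuffixes = 18"
definition fApply :: nat where "fApply = 19"
definition fCombine :: nat where "fCombine = 20"
definition fSolve :: nat where "fSolve = 21"
definition fIndices :: nat where "fIndices = 22"

lemmas function_index_defs =
  fMul_def fCostDen_def fRows_def fCeilings_def fLength_def fSum_def fBits_def fNth_def fCover_def
  fAppend_def fMiddle_def fCompare_def fFilter_def fPick_def fBetter_def fSearch_def fOps_def
  fSuffixes_def fApply_def fCombine_def fSolve_def fIndices_def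

definition mul_body :: expr where
  "mul_body = IfNonzero (Var 1)
     (LetIn (Call fMul [Var 0, Div (Var 1) (Const 2)])
       (Add (Add (Var 0) (Var 0))
         (IfNonzero (Sub (Var 2) (Add (Div (Var 2) (Const 2)) (Div (Var 2) (Const 2))))
           (Var 1) (Const 0))))
     (Const 0)"

definition cost_den_body :: expr where
  "cost_den_body = IfNonzero (Var 0)
     (Call fMul [Call fCostDen [Snd (Var 0)], Snd (Fst (Snd (Snd (Snd (Fst (Var 0))))))])
     (Const 1)"

definition rows_body :: expr where
  "rows_body = IfNonzero (Var 0)
     (LetIn (Fst (Var 0))
       (MkPair
         (MkPair (Fst (Var 0)) (MkPair (Fst (Snd (Var 0))) (MkPair (Fst (Fst (Snd (Snd (Var 0)))))
           (MkPair (Call fMul [Div (Var 3) (Snd (Fst (Snd (Snd (Snd (Var 0)))))),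
                               Fst (Fst (Snd (Snd (Snd (Var 0)))))])
             (MkPair (Var 2) (Const 0))))))
         (Call fRows [Snd (Var 1), Add (Var 2) (Const 1), Var 3])))
     (Const 0)"

definition ceilings_body :: expr where
  "ceilings_body = IfNonzero (Var 0)
     (MkPair (Div (Sub (Add (Fst (Fst (Var 0))) (Snd (Fst (Var 0)))) (Const 1)) (Snd (Fst (Var 0))))
       (Call fCeilings [Snd (Var 0)]))
     (Const 0)"

definition length_body :: expr where
  "length_body = IfNonzero (Var 0) (Add (Call fLength [Snd (Var 0)]) (Const 1)) (Const 0)"

definition sum_body :: expr where
  "sum_body = IfNonzero (Var 0)
     (Add (Call fNth [Fst (Var 0), Var 1]) (Call fSum [Snd (Var 0), Var 1])) (Const 0)"

definition bits_body :: expr where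
  "bits_body = IfNonzero (Var 0) (Add (Call fBits [Div (Var 0) (Const 2)]) (Const 1)) (Const 0)"

definition nth_body :: expr where
  "nth_body = IfNonzero (Var 1) (Call fNth [Snd (Var 0), Sub (Var 1) (Const 1)]) (Fst (Var 0))"

definition cover_body :: expr where
  "cover_body = IfNonzero (Var 0)
     (Add (IfNonzero (Less (Var 1) (Fst (Fst (Var 0)))) (Const 0)
            (IfNonzero (Less (Var 1) (Fst (Snd (Fst (Var 0)))))
              (Fst (Snd (Snd (Fst (Var 0))))) (Const 0)))
       (Call fCover [Snd (Var 0), Var 1]))
     (Const 0)"

definition append_body :: expr where
  "append_body = IfNonzero (Var 0)
     (MkPair (Fst (Var 0)) (Call fAppend [Snd (Var 0), Var 1]))
     (Var 1)"

definition middle_body :: expr where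
  "middle_body = IfNonzero (Var 0)
     (LetIn (Call fMiddle [Snd (Var 0), Var 1, Var 2, Var 3])
       (LetIn (Fst (Var 1))
         (IfNonzero (Less (Fst (Var 0)) (Var 3)) (Var 1)
         (IfNonzero (Less (Var 4) (Fst (Var 0))) (Var 1)
         (IfNonzero (Less (Var 5) (Fst (Snd (Var 0)))) (Var 1)
         (IfNonzero (Less (Var 4) (Fst (Snd (Var 0)))) (MkPair (Var 0) (Var 1)) (Var 1)))))))
     (Const 0)"

definition compare_body :: expr where
  "compare_body = IfNonzero (Less (Var 0) (Const 4))
     (IfNonzero (Less (Call fNth [Var 2, Var 0]) (Call fNth [Var 1, Var 0])) (Const 0) (Const 1))
     (LetIn (Sub (Var 0) (Const 4))
       (IfNonzero (Less (Call fNth [Var 2, Var 0]) (Call fNth [Var 3, Var 0]))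
         (Const 0) (Const 1)))"

definition filter_body :: expr where
  "filter_body = IfNonzero (Var 2)
     (LetIn (Call fFilter [Var 0, Var 1, Snd (Var 2), Var 3])
       (IfNonzero (Call fCompare [Var 1, Var 2, Fst (Var 3)])
         (MkPair (MkPair (Fst (Var 3)) (Fst (Var 0))) (Snd (Var 0)))
         (MkPair (Fst (Var 0)) (MkPair (Fst (Var 3)) (Snd (Var 0))))))
     (MkPair (Const 0) (Var 3))"

definition pick_body :: expr where
  "pick_body = IfNonzero (Var 0)
     (IfNonzero (Var 1) (Call fPick [Snd (Var 0), Snd (Var 1), MkPair (Fst (Var 1)) (Var 2)])
       (MkPair (Var 1) (Var 2)))
     (MkPair (Var 1) (Var 2))"

definition better_body :: expr where
  "better_body = IfNonzero (Var 0)
     (IfNonzero (Var 1) (IfNonzero (Less (Fst (Var 1)) (Fst (Var 0))) (Var 1) (Var 0)) (Var 0))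
     (Var 1)"

text \<open>The search functions carry a context \<open>(G, a, m, b, X, TM)\<close>, where \<open>G = (us, T, K)\<close>: demands,
  tasks, and length of the instruction sequences; the current interval and its middle; the
  tasks chosen so far; and the tasks from which the middle edge is to be covered.\<close>

definition search_body :: expr where
  "search_body = IfNonzero (Var 1)
     (LetIn (Sub (Var 1) (Const 1))
       (Call fBetter
         [Call fSearch [Var 1, Var 0, Var 3, Var 4, Var 5],
          Call fOps [Var 1, Var 0, Var 3, Var 4, Var 5, Const 9]]))
     (Call fCombine [Var 0, Var 4])"

definition ops_body :: expr where
  "ops_body = IfNonzero (Var 5)
     (LetIn (Sub (Var 5) (Const 1))
       (Call fBetter
         [Call fSuffixes [Var 1, Var 2, Var 3, Var 4, Var 5, Var 0,
                          Snd (Snd (Snd (Snd (Snd (Var 1)))))],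
          Call fOps [Var 1, Var 2, Var 3, Var 4, Var 5, Var 0]]))
     (Const 0)"

definition suffixes_body :: expr where
  "suffixes_body = IfNonzero (Var 6)
     (Call fBetter
       [Call fApply [Var 0, Var 1, Var 2, Var 3, Var 4, Var 5, Var 6],
        Call fSuffixes [Var 0, Var 1, Var 2, Var 3, Var 4, Var 5, Snd (Var 6)]])
     (Const 0)"

definition apply_body :: expr where
  "apply_body = IfNonzero (Less (Var 5) (Const 8))
     (LetIn (Call fFilter [Var 5, Fst (Var 6), Var 2, Var 3])
       (Call fSearch [Var 1, Var 2, Fst (Var 0), Snd (Var 0), Var 5]))
     (LetIn (Call fPick [Var 6, Var 2, Var 4])
       (Call fSearch [Var 1, Var 2, Call fAppend [Fst (Var 0), Var 4], Const 0, Snd (Var 0)]))"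

definition combine_body :: expr where
  "combine_body =
     LetIn (Call fAppend [Var 1, Fst (Snd (Snd (Snd (Snd (Var 0)))))])
     (IfNonzero (Less (Call fCover [Var 0, Fst (Snd (Snd (Var 1)))])
                      (Call fNth [Fst (Fst (Var 1)), Fst (Snd (Snd (Var 1)))]))
       (Const 0)
       (LetIn (Call fSolve [Fst (Var 1), Fst (Snd (Var 1)), Fst (Snd (Snd (Var 1))), Var 0])
       (IfNonzero (Var 0)
         (LetIn (Call fSolve [Fst (Var 2), Add (Fst (Snd (Snd (Var 2)))) (Const 1),
                            Fst (Snd (Snd (Snd (Var 2)))), Var 1])
         (IfNonzero (Var 0)
           (MkPair (Add (Add (Fst (Var 1)) (Fst (Var 0))) (Call fSum [Var 4, Const 3]))
               (Call fAppend [Var 4, Call fAppend [Snd (Var 1), Snd (Var 0)]]))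
           (Const 0)))
         (Const 0))))"

definition solve_body :: expr where
  "solve_body = IfNonzero (Less (Var 1) (Var 2))
     (LetIn (Div (Add (Var 1) (Var 2)) (Const 2))
     (LetIn (Call fMiddle [Fst (Snd (Var 1)), Var 2, Var 0, Var 3])
       (Call fSearch
         [MkPair (Var 2) (MkPair (Var 3) (MkPair (Var 1)
            (MkPair (Var 4) (MkPair (Var 5) (Var 0))))),
          Snd (Snd (Var 2)), Var 0, Const 0, Const 0])))
     (MkPair (Const 0) (Const 0))"

definition indices_body :: expr where
  "indices_body = IfNonzero (Var 0)
     (MkPair (Call fNth [Fst (Var 0), Const 4]) (Call fIndices [Snd (Var 0)])) (Const 0)"

definition main_body :: "nat \<Rightarrow> expr" where
  "main_body A =
     LetIn (Call fRows [Snd (Var 0), Const 0, Call fCostDen [Snd (Var 0)]])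
     (LetIn (Call fCeilings [Fst (Var 1)])
     (LetIn (Call fBits [Add (Call fSum [Var 1, Const 2]) (Const 1)])
     (LetIn (Call fMul [Call fMul [Var 0, Var 0], Const A])
     (LetIn (Call fSolve [MkPair (Var 2) (MkPair (Var 3) (Var 0)), Const 0,
                          Call fLength [Var 2], Const 0])
       (IfNonzero (Var 0) (Call fIndices [Snd (Var 0)]) (Const 0))))))"

definition prog :: "nat \<Rightarrow> program" where
  "prog A = [main_body A, mul_body, cost_den_body, rows_body, ceilings_body, length_body, sum_body,
     bits_body, nth_body, cover_body, append_body, middle_body, compare_body, filter_body,
     pick_body, better_body, search_body, ops_body, suffixes_body, apply_body, combine_body,
     solve_body, indices_body]"

lemma prog_nth [simp]:
  "prog A ! 0 = main_body A" "prog A ! fMul = mul_body" "prog A ! fCostDen = cost_den_body"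
  "prog A ! fRows = rows_body" "prog A ! fCeilings = ceilings_body" "prog A ! fLength = length_body"
  "prog A ! fSum = sum_body" "prog A ! fBits = bits_body" "prog A ! fNth = nth_body"
  "prog A ! fCover = cover_body" "prog A ! fAppend = append_body" "prog A ! fMiddle = middle_body"
  "prog A ! fCompare = compare_body" "prog A ! fFilter = filter_body" "prog A ! fPick = pick_body"
  "prog A ! fBetter = better_body" "prog A ! fSearch = search_body" "prog A ! fOps = ops_body"
  "prog A ! fSuffixes = suffixes_body" "prog A ! fApply = apply_body"
  "prog A ! fCombine = combine_body" "prog A ! fSolve = solve_body"
  "prog A ! fIndices = indices_body"
  by (simp_all add: prog_def function_index_defs)

lemma less_length_prog [simp]:
  "prog A \<noteq> []" "fMul < length (prog A)" "fCostDen < length (prog A)"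
  "fRows < length (prog A)" "fCeilings < length (prog A)" "fLength < length (prog A)"
  "fSum < length (prog A)" "fBits < length (prog A)" "fNth < length (prog A)"
  "fCover < length (prog A)" "fAppend < length (prog A)" "fMiddle < length (prog A)"
  "fCompare < length (prog A)" "fFilter < length (prog A)" "fPick < length (prog A)"
  "fBetter < length (prog A)" "fSearch < length (prog A)" "fOps < length (prog A)"
  "fSuffixes < length (prog A)" "fApply < length (prog A)" "fCombine < length (prog A)"
  "fSolve < length (prog A)" "fIndices < length (prog A)"
  by (simp_all add: prog_def function_index_defs)

section \<open>Correctness and unit cost of the program\<close>

lemma of_truth_eq_0 [simp]: "of_truth b = VNat 0 \<longleftrightarrow> \<not> b"
  by (simp add: of_truth_def)

lemma floorlog_2_rec: "0 < b \<Longrightarrow> floorlog 2 b = floorlog 2 (b div 2) + 1"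
  using compute_floorlog[of 2 b] by simp

lemma calls_mul: "calls (prog A) fMul [VNat a, VNat b] (VNat (a * b)) (50 * floorlog 2 b + 10)"
proof (induction b rule: less_induct)
  case (less b)
  show ?case
  proof (cases "b = 0")
    case True
    then show ?thesis by (intro callsI) (simp_all add: mul_body_def)
  next
    case False
    then have IH: "calls (prog A) fMul [VNat a, VNat (b div 2)] (VNat (a * (b div 2)))
        (50 * floorlog 2 (b div 2) + 10)"
      by (intro less.IH) simp
    have double: "a * b = a * (b div 2) + a * (b div 2) + (if odd b then a else 0)"
      by (cases "even b") (auto elim!: evenE oddE simp: algebra_simps)
    have parity: "b \<le> b div 2 + b div 2 \<longleftrightarrow> even b" by presburger
    show ?thesis
      using False double parity floorlog_2_rec[of b]
      by (intro callsI) (auto simp: mul_body_def intro!: call_wpI[OF IH])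
  qed
qed

definition enc_nats :: "nat list \<Rightarrow> val" where
  "enc_nats t = enc_list (map VNat t)"

definition enc_rows :: "row list \<Rightarrow> val" where
  "enc_rows ts = enc_list (map enc_nats ts)"

lemma enc_nats_simps [simp]: "enc_nats [] = VNat 0" "enc_nats (x # t) = VPair (VNat x) (enc_nats t)"
  by (simp_all add: enc_nats_def)

lemma enc_rows_simps [simp]:
  "enc_rows [] = VNat 0" "enc_rows (t # ts) = VPair (enc_nats t) (enc_rows ts)"
  by (simp_all add: enc_rows_def)

fun enc_result :: "result \<Rightarrow> val" where
  "enc_result None = VNat 0"
| "enc_result (Some (c, ts)) = VPair (VNat c) (enc_rows ts)"

definition proper_rows :: "row list \<Rightarrow> bool" where
  "proper_rows ts \<longleftrightarrow> (\<forall>t\<in>set ts. length t = 5)"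

lemma proper_rows_simps [simp]:
  "proper_rows []" "proper_rows (t # ts) \<longleftrightarrow> length t = 5 \<and> proper_rows ts"
  "proper_rows (ts @ us) \<longleftrightarrow> proper_rows ts \<and> proper_rows us"
  by (auto simp: proper_rows_def)

lemma proper_rows_subset: "proper_rows ts \<Longrightarrow> set us \<subseteq> set ts \<Longrightarrow> proper_rows us"
  by (auto simp: proper_rows_def)

lemma enc_nats_length_5:
  assumes "length t = 5"
  shows "enc_nats t = VPair (VNat (t ! 0)) (VPair (VNat (t ! 1)) (VPair (VNat (t ! 2))
    (VPair (VNat (t ! 3)) (VPair (VNat (t ! 4)) (VNat 0)))))"
proof -
  have "\<exists>a b c d e. t = [a, b, c, d, e]"
    using assms by (auto simp: length_Suc_conv eval_nat_numeral)
  then show ?thesis by auto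
qed

lemma calls_length: "calls (prog A) fLength [enc_list xs] (VNat (length xs)) (10 * length xs + 10)"
proof (induction xs)
  case Nil
  show ?case by (rule callsI) (simp_all add: length_body_def)
next
  case (Cons x xs)
  show ?case by (rule callsI) (auto simp: length_body_def intro!: call_wpI[OF Cons.IH])
qed

lemma calls_nth: "i < length xs \<Longrightarrow> calls (prog A) fNth [enc_list xs, VNat i] (xs ! i) (15 * i + 10)"
proof (induction xs arbitrary: i)
  case (Cons x xs)
  show ?case
  proof (cases i)
    case 0
    then show ?thesis by (intro callsI) (simp_all add: nth_body_def)
  next
    case (Suc j)
    with Cons.prems have "j < length xs" by simp
    from Cons.IH[OF this] show ?thesis
      unfolding Suc by (intro callsI) (auto simp: nth_body_def intro!: call_wpI)
  qed
qed simp

lemma calls_nth_nats: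
  "i < length t \<Longrightarrow> calls (prog A) fNth [enc_nats t, VNat i] (VNat (t ! i)) (15 * i + 10)"
  using calls_nth[of i "map VNat t" A] by (simp add: enc_nats_def)

lemma calls_sum:
  assumes "k < 5"
  shows "proper_rows ts \<Longrightarrow>
    calls (prog A) fSum [enc_rows ts, VNat k] (VNat (\<Sum>t\<leftarrow>ts. t ! k)) (100 * length ts + 10)"
proof (induction ts)
  case Nil
  show ?case by (rule callsI) (simp_all add: sum_body_def)
next
  case (Cons t ts)
  then have "k < length t" "proper_rows ts" using assms by simp_all
  then show ?case
    using assms by (intro callsI)
      (auto simp: sum_body_def intro!: call_wpI[OF calls_nth_nats] call_wpI[OF Cons.IH])
qed

lemma calls_bits: "calls (prog A) fBits [VNat n] (VNat (floorlog 2 n)) (20 * floorlog 2 n + 10)"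
proof (induction n rule: less_induct)
  case (less n)
  show ?case
  proof (cases "n = 0")
    case True
    then show ?thesis by (intro callsI) (simp_all add: bits_body_def floorlog_def)
  next
    case False
    then have "calls (prog A) fBits [VNat (n div 2)] (VNat (floorlog 2 (n div 2)))
      (20 * floorlog 2 (n div 2) + 10)"
      by (intro less.IH) simp
    then show ?thesis
      using False floorlog_2_rec[of n] by (intro callsI) (auto simp: bits_body_def intro!: call_wpI)
  qed
qed

lemma calls_cover:
  "proper_rows ts \<Longrightarrow>
    calls (prog A) fCover [enc_rows ts, VNat e] (VNat (cover ts e)) (50 * length ts + 10)"
proof (induction ts)
  case Nil
  show ?case by (rule callsI) (simp_all add: cover_body_def)
next
  case (Cons t ts)
  then have "length t = 5" "proper_rows ts" by simp_all
  then show ?case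
    by (intro callsI)
      (auto simp: cover_body_def cover_def uses_def enc_nats_length_5
        intro!: call_wpI[OF Cons.IH[unfolded cover_def]])
qed

lemma calls_append:
  "calls (prog A) fAppend [enc_rows xs, enc_rows ys] (enc_rows (xs @ ys)) (15 * length xs + 10)"
proof (induction xs)
  case Nil
  show ?case by (rule callsI) (simp_all add: append_body_def)
next
  case (Cons x xs)
  show ?case by (rule callsI) (auto simp: append_body_def intro!: call_wpI[OF Cons.IH])
qed

lemma calls_middle:
  "proper_rows ts \<Longrightarrow> calls (prog A) fMiddle [enc_rows ts, VNat a, VNat m, VNat b]
     (enc_rows (middle_tasks ts a m b)) (80 * length ts + 10)"
proof (induction ts)
  case Nil
  show ?case by (rule callsI) (simp_all add: middle_body_def middle_tasks_def)
next
  case (Cons t ts)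
  then have t: "length t = 5" "proper_rows ts" by simp_all
  then show ?case
    by (intro callsI)
      (auto simp: middle_body_def middle_tasks_def uses_def enc_nats_length_5[of t]
        intro!: call_wpI[OF Cons.IH[unfolded middle_tasks_def uses_def]])
qed

lemma calls_compare:
  assumes "op < 8" "length piv = 5" "length t = 5"
  shows "calls (prog A) fCompare [VNat op, enc_nats piv, enc_nats t]
    (of_truth (key op piv \<le> key op t)) 250"
  using assms
  by (intro callsI)
    (auto simp: compare_body_def key_def of_truth_def intro!: call_wpI[OF calls_nth_nats])

lemma calls_filter:
  assumes "op < 8" "length piv = 5"
  shows "proper_rows W \<Longrightarrow> calls (prog A) fFilter [VNat op, enc_nats piv, enc_rows W, enc_rows N]
    (VPair (enc_rows (filter (\<lambda>t. key op piv \<le> key op t) W))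
      (enc_rows (filter (\<lambda>t. \<not> key op piv \<le> key op t) W @ N))) (300 * length W + 10)"
proof (induction W)
  case Nil
  show ?case by (rule callsI) (simp_all add: filter_body_def)
next
  case (Cons t W)
  then have "length t = 5" "proper_rows W" by simp_all
  then show ?case
    using assms by (intro callsI)
      (auto simp: filter_body_def intro!: call_wpI[OF Cons.IH] call_wpI[OF calls_compare])
qed

lemma calls_pick:
  "calls (prog A) fPick [enc_rows js, enc_rows W, enc_rows S]
     (VPair (enc_rows (drop (length js) W)) (enc_rows (rev (take (length js) W) @ S)))
     (20 * length js + 10)"
proof (induction js arbitrary: W S)
  case Nil
  show ?case by (rule callsI) (simp_all add: pick_body_def)
next
  case (Cons j js)
  show ?case
  proof (cases W)
    case Nil
    then show ?thesis by (intro callsI) (simp_all add: pick_body_def)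
  next
    case W: (Cons w W')
    show ?thesis
      unfolding W by (rule callsI)
        (auto simp: pick_body_def intro!: call_wpI[OF Cons.IH[of W' "w # S", simplified]])
  qed
qed

lemma enc_result_eq_0 [simp]: "enc_result x = VNat 0 \<longleftrightarrow> x = None"
  by (cases x) auto

lemma calls_better:
  "calls (prog A) fBetter [enc_result x, enc_result y] (enc_result (better x y)) 20"
  by (rule callsI) (auto simp: better_body_def better_def split: option.split)

lemma calls_indices:
  "proper_rows ts \<Longrightarrow> calls (prog A) fIndices [enc_rows ts]
    (enc_nats (map (\<lambda>t. row_index t) ts)) (120 * length ts + 10)"
proof (induction ts)
  case Nil
  show ?case by (rule callsI) (simp_all add: indices_body_def)
next
  case (Cons t ts)
  then have "4 < length t" "proper_rows ts" by simp_all
  then show ?case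
    by (intro callsI)
      (auto simp: indices_body_def intro!: call_wpI[OF calls_nth_nats] call_wpI[OF Cons.IH])
qed

locale search_context =
  fixes A :: nat and ctx G a m b X :: val and TM :: "row list" and n :: nat
  assumes ctx: "ctx = VPair G (VPair a (VPair m (VPair b (VPair X (enc_rows TM)))))"
    and proper_TM: "proper_rows TM" and length_TM: "length TM \<le> n"
begin

definition proper_state :: "state \<Rightarrow> bool" where
  "proper_state st \<longleftrightarrow> proper_rows (state_tasks st) \<and> length (state_tasks st) \<le> n"

definition searches :: "nat \<Rightarrow> (state \<Rightarrow> result) \<Rightarrow> nat \<Rightarrow> bool" where
  "searches K g s \<longleftrightarrow> (\<forall>W N S. proper_state (W, N, S) \<longrightarrow>
     calls (prog A) fSearch [ctx, VNat K, enc_rows W, enc_rows N, enc_rows S]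
       (enc_result (g (W, N, S))) s)"

lemma proper_state_apply_instr: "proper_state (apply_instr op ts st) \<longleftrightarrow> proper_state st"
  using mset_state_tasks_apply_instr[of op ts st] mset_eq_setD mset_eq_length
  unfolding proper_state_def proper_rows_def by metis

lemma calls_apply:
  assumes g: "searches K g s" and st: "proper_state (W, N, S)"
    and js: "js \<noteq> []" "proper_rows js" "length js \<le> n"
  shows "calls (prog A) fApply
    [ctx, VNat K, enc_rows W, enc_rows N, enc_rows S, VNat op, enc_rows js]
    (enc_result (g (apply_instr op js (W, N, S)))) (s + 400 * n + 100)"
proof -
  have W: "proper_rows W" "length W \<le> n" using st by (auto simp: proper_state_def)
  obtain j js' where j: "js = j # js'" "length j = 5" using js(1,2) by (cases js) auto
  obtain W' N' S' where st': "apply_instr op js (W, N, S) = (W', N', S')"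
    by (cases "apply_instr op js (W, N, S)")
  have "proper_state (W', N', S')" using st proper_state_apply_instr st' by metis
  with g have search: "calls (prog A) fSearch [ctx, VNat K, enc_rows W', enc_rows N', enc_rows S']
      (enc_result (g (W', N', S'))) s" unfolding searches_def by blast
  show ?thesis
  proof (cases "op < 8")
    case True
    then have "W' = filter (\<lambda>t. key op j \<le> key op t) W"
      "N' = filter (\<lambda>t. \<not> key op j \<le> key op t) W @ N" "S' = S"
      using st' j(1) by auto
    note search = search[unfolded this]
    show ?thesis
      using True W j
      by (intro callsI) (auto simp: apply_body_def
        intro!: call_wpI[OF calls_filter[OF True j(2) W(1)]] call_wpI[OF search])
  next
    case False
    then have "W' = drop (length js) W @ N" "N' = []" "S' = rev (take (length js) W) @ S"
      using st' by auto
    note search = search[unfolded this enc_rows_simps(1)]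
    show ?thesis
      using False W js(3)
      by (intro callsI) (auto simp: apply_body_def
        intro!: call_wpI[OF calls_pick] call_wpI[OF calls_append] call_wpI[OF search])
  qed
qed

lemma calls_suffixes:
  assumes g: "searches K g s" and st: "proper_state (W, N, S)"
  shows "proper_rows js \<Longrightarrow> length js \<le> n \<Longrightarrow>
    calls (prog A) fSuffixes [ctx, VNat K, enc_rows W, enc_rows N, enc_rows S, VNat op, enc_rows js]
      (enc_result (try_suffixes g op js (W, N, S))) (length js * (s + 400 * n + 200) + 10)"
proof (induction js)
  case Nil
  show ?case by (rule callsI) (simp_all add: suffixes_body_def)
next
  case (Cons j js)
  then have "proper_rows js" "length js \<le> n" by simp_all
  note IH = Cons.IH[OF this]
  note step = calls_apply[OF g st list.distinct(2) Cons.prems, of op, unfolded enc_rows_simps]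
  show ?case
    by (rule callsI) (auto simp: suffixes_body_def simp del: apply_instr.simps
      intro!: call_wpI[OF step] call_wpI[OF IH] call_wpI[OF calls_better])
qed

lemma calls_ops:
  assumes g: "searches K g s" and st: "proper_state (W, N, S)"
  shows "calls (prog A) fOps [ctx, VNat K, enc_rows W, enc_rows N, enc_rows S, VNat op]
      (enc_result (try_ops g TM op (W, N, S))) (op * (n * (s + 400 * n + 200) + 100) + 10)"
proof (induction op)
  case 0
  show ?case by (rule callsI) (simp_all add: ops_body_def)
next
  case (Suc op)
  have "length TM * (s + 400 * n + 200) + 10 \<le> n * (s + 400 * n + 200) + 10"
    using length_TM by (simp add: mult_le_mono1)
  note suffixes = calls_mono[OF calls_suffixes[OF g st proper_TM length_TM, of op] this]
  show ?case
    by (rule callsI) (auto simp: ops_body_def ctx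
      intro!: call_wpI[OF suffixes[unfolded ctx]] call_wpI[OF Suc.IH[unfolded ctx]]
        call_wpI[OF calls_better])
qed

lemma calls_search:
  assumes fin: "\<And>S. proper_rows S \<Longrightarrow> length S \<le> n \<Longrightarrow>
      calls (prog A) fCombine [ctx, enc_rows S] (enc_result (fin S)) F"
  shows "searches K (search fin TM K) ((F + 400 * n + 2000) * (20 * (n + 1)) ^ K)"
proof (induction K)
  case 0
  show ?case
    unfolding searches_def
  proof (intro allI impI)
    fix W N S assume "proper_state (W, N, S)"
    then have "proper_rows S" "length S \<le> n" by (auto simp: proper_state_def)
    from fin[OF this] show "calls (prog A) fSearch [ctx, VNat 0, enc_rows W, enc_rows N, enc_rows S]
        (enc_result (search fin TM 0 (W, N, S))) ((F + 400 * n + 2000) * (20 * (n + 1)) ^ 0)"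
      by (intro callsI) (auto simp: search_body_def intro!: call_wpI)
  qed
next
  case (Suc K)
  define s where "s = (F + 400 * n + 2000) * (20 * (n + 1)) ^ K"
  have "(F + 400 * n + 2000) * 1 \<le> s" unfolding s_def by (intro mult_le_mono) auto
  then have s: "400 * n + 2000 \<le> s" by simp
  then have "9 * n * (400 * n + 2000) \<le> 9 * n * s" by (rule mult_le_mono2)
  then have "s + (9 * (n * (s + 400 * n + 200) + 100) + 10) + 100 \<le> 20 * (n + 1) * s"
    using s by (simp add: algebra_simps)
  also have "\<dots> = (F + 400 * n + 2000) * (20 * (n + 1)) ^ Suc K" by (simp add: s_def)
  finally have time: "s + (9 * (n * (s + 400 * n + 200) + 100) + 10) + 100
      \<le> (F + 400 * n + 2000) * (20 * (n + 1)) ^ Suc K" .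
  show ?case
    unfolding searches_def
  proof (intro allI impI calls_mono[OF _ time])
    fix W N S assume st: "proper_state (W, N, S)"
    note IH = Suc.IH[folded s_def]
    note search = IH[unfolded searches_def, rule_format, OF st] and ops = calls_ops[OF IH st, of 9]
    show "calls (prog A) fSearch [ctx, VNat (Suc K), enc_rows W, enc_rows N, enc_rows S]
        (enc_result (search fin TM (Suc K) (W, N, S)))
        (s + (9 * (n * (s + 400 * n + 200) + 100) + 10) + 100)"
      by (rule callsI) (auto simp: search_body_def
        intro!: call_wpI[OF search] call_wpI[OF ops] call_wpI[OF calls_better])
  qed
qed

end

lemma calls_combine:
  assumes left: "calls (prog A) fSolve [G, VNat a, VNat m, enc_rows (S @ X)]
      (enc_result (solve a m (S @ X))) r"
    and right: "calls (prog A) fSolve [G, VNat (Suc m), VNat b, enc_rows (S @ X)]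
      (enc_result (solve (Suc m) b (S @ X))) r"
    and len: "\<And>c l. solve a m (S @ X) = Some (c, l) \<Longrightarrow> length l \<le> n"
    and rows: "proper_rows S" "proper_rows X" "length S \<le> n" "length (S @ X) \<le> M"
    and us: "m < length us" and G: "G = VPair (enc_nats us) G'"
    and ctx: "ctx =
      VPair G (VPair (VNat a) (VPair (VNat m) (VPair (VNat b) (VPair (enc_rows X) TMv))))"
  shows "calls (prog A) fCombine [ctx, enc_rows S] (enc_result (combine solve us a m b X S))
    (2 * r + 50 * M + 15 * length us + 200 * n + 300)"
proof -
  have SX: "proper_rows (S @ X)" using rows by simp
  have sum: "calls (prog A) fSum [enc_rows S, VNat 3] (VNat (cost S)) (100 * length S + 10)"
    unfolding cost_def by (rule calls_sum) (use rows in auto)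
  note rules = call_wpI[OF calls_append] call_wpI[OF calls_cover[OF SX]]
    call_wpI[OF calls_nth_nats[OF us]] call_wpI[OF left[unfolded G]] call_wpI[OF right[unfolded G]]
    call_wpI[OF sum]
  note defs = combine_body_def ctx G combine_def
  show ?thesis
  proof (cases "solve a m (S @ X)"; cases "solve (Suc m) b (S @ X)")
    fix p q assume pq: "solve a m (S @ X) = Some p" "solve (Suc m) b (S @ X) = Some q"
    obtain c1 l1 c2 l2 where "p = (c1, l1)" "q = (c2, l2)" by (cases p; cases q)
    then show ?thesis
      using rows us pq len
      by (intro callsI) (auto simp: defs simp del: cover_append intro!: rules)
  qed (use rows us in \<open>intro callsI; auto simp: defs simp del: cover_append intro!: rules\<close>)+
qed

definition solve_time :: "nat \<Rightarrow> nat \<Rightarrow> nat \<Rightarrow> nat \<Rightarrow> nat" where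
  "solve_time Y n K h = Y * (10 * (20 * (n + 1)) ^ K) ^ h"

lemma solve_time_ge: "Y \<le> solve_time Y n K h"
  by (simp add: solve_time_def)

lemma solve_time_Suc_ge:
  assumes "80 * n + 500 \<le> Y"
  shows "80 * n + 500 + (2 * solve_time Y n K h + Y) * (20 * (n + 1)) ^ K
    \<le> solve_time Y n K (Suc h)"
proof -
  define B where "B = (20 * (n + 1)) ^ K"
  define r where "r = solve_time Y n K h"
  have Y: "Y \<le> r" unfolding r_def by (rule solve_time_ge)
  have "1 \<le> B" by (simp add: B_def)
  then have "r \<le> r * B" by simp
  moreover have "(2 * r + Y) * B \<le> 3 * r * B" using Y by (intro mult_le_mono1) simp
  ultimately have "80 * n + 500 + (2 * r + Y) * B \<le> 10 * (r * B)" using assms Y by linarith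
  then show ?thesis by (simp add: r_def B_def solve_time_def ac_simps)
qed

text \<open>\<open>n\<close> bounds the number of tasks and \<open>M\<close> the number of tasks that are ever selected along a path
  of the recursion, counted with multiplicity.\<close>

locale solve_context =
  fixes A K n M :: nat and us :: "nat list" and T :: "row list"
  assumes proper_T: "proper_rows T" and distinct_T: "distinct T" and length_T: "length T \<le> n"
begin

definition problem :: val where
  "problem = VPair (enc_nats us) (VPair (enc_rows T) (VNat K))"

definition node_time :: nat where
  "node_time = 1000 * (n + M + length us + 10)"

definition solves :: "nat \<Rightarrow> bool" where
  "solves h \<longleftrightarrow> (\<forall>a b X. b - a < 2 ^ h \<and> b \<le> length us \<and> proper_rows X \<and> length X + h * n \<le> M \<longrightarrow>
     calls (prog A) fSolve [problem, VNat a, VNat b, enc_rows X]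
       (enc_result (solve_interval us T K h a b X)) (solve_time node_time n K h))"

lemma calls_combine_solve_interval:
  assumes "solves h" and m: "m - a < 2 ^ h" "b - (m + 1) < 2 ^ h" "m < b" "b \<le> length us"
    and rows: "proper_rows S" "proper_rows X" "length S \<le> n" "length X + Suc h * n \<le> M"
  shows "calls (prog A) fCombine
    [VPair problem (VPair (VNat a) (VPair (VNat m) (VPair (VNat b) (VPair (enc_rows X) TMv)))),
      enc_rows S]
    (enc_result (combine (solve_interval us T K h) us a m b X S))
    (2 * solve_time node_time n K h + 50 * M + 15 * length us + 200 * n + 300)"
proof (rule calls_combine[OF _ _ _ rows(1-3) _ _ problem_def refl])
  have SX: "proper_rows (S @ X)" "length (S @ X) + h * n \<le> M" using rows by auto
  show "length (S @ X) \<le> M" "m < length us" using SX(2) m(3,4) by auto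
  show "calls (prog A) fSolve [problem, VNat a, VNat m, enc_rows (S @ X)]
      (enc_result (solve_interval us T K h a m (S @ X))) (solve_time node_time n K h)"
    using assms(1) SX m unfolding solves_def by simp
  show "calls (prog A) fSolve [problem, VNat (Suc m), VNat b, enc_rows (S @ X)]
      (enc_result (solve_interval us T K h (Suc m) b (S @ X))) (solve_time node_time n K h)"
    using assms(1) SX m unfolding solves_def by simp
  show "length l \<le> n" if "solve_interval us T K h a m (S @ X) = Some (c, l)" for c l
    using length_solve_interval_le[OF distinct_T that m(1)] length_T by simp
qed

lemma calls_search_combine:
  fixes a m b X
  defines "TM \<equiv> middle_tasks T a m b"
  assumes "solves h" and m: "m - a < 2 ^ h" "b - (m + 1) < 2 ^ h" "m < b" "b \<le> length us"
    and X: "proper_rows X" "length X + Suc h * n \<le> M"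
  shows "calls (prog A) fSearch
    [VPair problem (VPair (VNat a) (VPair (VNat m) (VPair (VNat b)
      (VPair (enc_rows X) (enc_rows TM))))), VNat K, enc_rows TM, VNat 0, VNat 0]
    (enc_result (search (combine (solve_interval us T K h) us a m b X) TM K (TM, [], [])))
    ((2 * solve_time node_time n K h + node_time) * (20 * (n + 1)) ^ K)"
proof -
  let ?ctx = "VPair problem (VPair (VNat a) (VPair (VNat m) (VPair (VNat b)
    (VPair (enc_rows X) (enc_rows TM)))))"
  let ?r = "solve_time node_time n K h"
  interpret search_context A ?ctx problem "VNat a" "VNat m" "VNat b" "enc_rows X" TM n
    using le_trans[OF length_middle_tasks_le length_T] proper_T unfolding TM_def
    by unfold_locales (auto simp: proper_rows_def middle_tasks_def)
  have "searches K (search (combine (solve_interval us T K h) us a m b X) TM K)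
      ((2 * ?r + 50 * M + 15 * length us + 200 * n + 300 + 400 * n + 2000) * (20 * (n + 1)) ^ K)"
    using X m by (intro calls_search calls_combine_solve_interval[OF assms(2)]) auto
  moreover have "proper_state (TM, [], [])"
    using proper_TM length_TM by (simp add: proper_state_def)
  ultimately show ?thesis
    unfolding searches_def
    by (fastforce intro!: mult_le_mono1 elim!: calls_mono simp: node_time_def)
qed

lemma solves_Suc:
  assumes "solves h"
  shows "solves (Suc h)"
  unfolding solves_def
proof (intro allI impI)
  fix a b X
  assume X: "b - a < 2 ^ Suc h \<and> b \<le> length us \<and> proper_rows X \<and> length X + Suc h * n \<le> M"
  let ?r = "solve_time node_time n K h"
  have time: "80 * n + 500 \<le> node_time" by (simp add: node_time_def)
  show "calls (prog A) fSolve [problem, VNat a, VNat b, enc_rows X]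
    (enc_result (solve_interval us T K (Suc h) a b X)) (solve_time node_time n K (Suc h))"
  proof (cases "a < b")
    case False
    have "100 \<le> solve_time node_time n K (Suc h)"
      by (rule le_trans[OF _ solve_time_ge]) (use time in simp)
    then show ?thesis using False by (intro callsI) (auto simp: solve_body_def)
  next
    case True
    define m where "m = (a + b) div 2"
    note m = halves_of_interval[OF True conjunct1[OF X], folded m_def]
    define TM where "TM = middle_tasks T a m b"
    have search: "calls (prog A) fSearch
        [VPair problem (VPair (VNat a) (VPair (VNat m) (VPair (VNat b)
          (VPair (enc_rows X) (enc_rows TM))))), VNat K, enc_rows TM, VNat 0, VNat 0]
        (enc_result (search (combine (solve_interval us T K h) us a m b X) TM K (TM, [], [])))
        ((2 * ?r + node_time) * (20 * (n + 1)) ^ K)"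
      using X m unfolding TM_def by (intro calls_search_combine[OF assms]) auto
    have "calls (prog A) fSolve [problem, VNat a, VNat b, enc_rows X]
        (enc_result (solve_interval us T K (Suc h) a b X))
        (80 * n + 500 + (2 * ?r + node_time) * (20 * (n + 1)) ^ K)"
      using True length_T
      by (intro callsI) (auto simp: solve_body_def problem_def Let_def simp flip: m_def TM_def
        intro!: call_wpI[OF calls_middle[OF proper_T]] call_wpI[OF search[unfolded problem_def]])
    then show ?thesis by (rule calls_mono[OF _ solve_time_Suc_ge[OF time]])
  qed
qed

lemma calls_solve: "solves h"
proof (induction h)
  case 0
  have "calls (prog A) fSolve [problem, VNat a, VNat b, enc_rows X] (VPair (VNat 0) (VNat 0))
      node_time"
    if "b \<le> a" for a b X
    using that by (intro callsI) (auto simp: solve_body_def node_time_def)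
  then show ?case by (auto simp: solves_def solve_time_def)
qed (rule solves_Suc)

end

section \<open>From instances to rows\<close>

definition rat_num :: "rat \<Rightarrow> nat" where
  "rat_num q = nat (fst (quotient_of q))"

definition rat_den :: "rat \<Rightarrow> nat" where
  "rat_den q = nat (snd (quotient_of q))"

definition rat_ceil :: "rat \<Rightarrow> nat" where
  "rat_ceil q = (rat_num q + rat_den q - 1) div rat_den q"

lemma rat_den_pos: "0 < rat_den q"
  using quotient_of_denom_pos'[of q] by (simp add: rat_den_def)

lemma rat_eq_num_den:
  assumes "0 \<le> q"
  shows "q = of_nat (rat_num q) / of_nat (rat_den q)"
proof -
  obtain n d where nd: "quotient_of q = (n, d)" by fastforce
  have d: "0 < d" using quotient_of_denom_pos[OF nd] .
  have q: "q = of_int n / of_int d" using quotient_of_div[OF nd] .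
  then have "0 \<le> n" using assms d by (simp add: zero_le_divide_iff)
  then show ?thesis using q d nd by (simp add: rat_num_def rat_den_def)
qed

lemma rat_eq_num: "q \<in> \<int> \<Longrightarrow> 0 \<le> q \<Longrightarrow> q = of_nat (rat_num q)"
  by (auto simp: Ints_def rat_num_def)

lemma rat_ceil_le_iff:
  assumes "0 \<le> q"
  shows "rat_ceil q \<le> x \<longleftrightarrow> q \<le> of_nat x"
proof -
  let ?n = "rat_num q" and ?d = "rat_den q"
  have d: "0 < ?d" by (rule rat_den_pos)
  have "rat_ceil q \<le> x \<longleftrightarrow> (?n + ?d - 1) div ?d < Suc x" by (auto simp: rat_ceil_def)
  also have "\<dots> \<longleftrightarrow> ?n + ?d - 1 < Suc x * ?d" by (rule div_less_iff_less_mult[OF d])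
  also have "\<dots> \<longleftrightarrow> ?n \<le> x * ?d" using d by auto
  also have "\<dots> \<longleftrightarrow> (of_nat ?n :: rat) \<le> of_nat (x * ?d)" by (simp only: of_nat_le_iff)
  also have "\<dots> \<longleftrightarrow> of_nat ?n / of_nat ?d \<le> (of_nat x :: rat)" using d by (simp add: divide_le_eq)
  also have "\<dots> \<longleftrightarrow> q \<le> of_nat x" using rat_eq_num_den[OF assms] by simp
  finally show ?thesis .
qed

definition cost_den :: "task list \<Rightarrow> nat" where
  "cost_den js = (\<Prod>j\<leftarrow>js. rat_den (task_cost j))"

lemma cost_den_pos: "0 < cost_den js"
  unfolding cost_den_def by (induction js) (auto simp: rat_den_pos)

definition row_of_task :: "nat \<Rightarrow> nat \<Rightarrow> task \<Rightarrow> row" where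
  "row_of_task d i j = [start_vertex j, end_vertex j, rat_num (task_size j),
     (d div rat_den (task_cost j)) * rat_num (task_cost j), i]"

definition rows_of_tasks :: "nat \<Rightarrow> nat \<Rightarrow> task list \<Rightarrow> row list" where
  "rows_of_tasks d i js = map (\<lambda>(k, j). row_of_task d k j) (enumerate i js)"

lemma rows_of_tasks_simps [simp]:
  "rows_of_tasks d i [] = []"
  "rows_of_tasks d i (j # js) = row_of_task d i j # rows_of_tasks d (Suc i) js"
  by (simp_all add: rows_of_tasks_def)

lemma length_rows_of_tasks [simp]: "length (rows_of_tasks d i js) = length js"
  by (simp add: rows_of_tasks_def)

lemma proper_rows_of_tasks: "proper_rows (rows_of_tasks d i js)"
  by (auto simp: proper_rows_def rows_of_tasks_def row_of_task_def)

lemma distinct_rows_of_tasks: "distinct (rows_of_tasks d i js)"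
  by (auto simp: rows_of_tasks_def distinct_map inj_on_def row_of_task_def in_set_enumerate_eq)

definition int_demands :: "ufp_instance \<Rightarrow> nat list" where
  "int_demands I = map rat_ceil (demands I)"

definition int_tasks :: "ufp_instance \<Rightarrow> row list" where
  "int_tasks I = rows_of_tasks (cost_den (tasks I)) 0 (tasks I)"

definition total_size :: "ufp_instance \<Rightarrow> nat" where
  "total_size I = (\<Sum>j\<leftarrow>tasks I. rat_num (task_size j))"

definition size_bits :: "ufp_instance \<Rightarrow> nat" where
  "size_bits I = floorlog 2 (Suc (total_size I))"

lemma sum_row_size_int_tasks: "(\<Sum>t\<leftarrow>int_tasks I. row_size t) = total_size I"
proof -
  have "(\<Sum>t\<leftarrow>rows_of_tasks d i js. row_size t) = (\<Sum>j\<leftarrow>js. rat_num (task_size j))" for d i js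
    by (induction js arbitrary: i) (auto simp: row_of_task_def)
  then show ?thesis by (simp add: int_tasks_def total_size_def)
qed

text \<open>The number \<open>A\<close> of instructions per squared bit depends only on the approximation ratio.\<close>

definition solve :: "nat \<Rightarrow> ufp_instance \<Rightarrow> result" where
  "solve A I = solve_interval (int_demands I) (int_tasks I) (size_bits I * size_bits I * A)
     (floorlog 2 (length (demands I))) 0 (length (demands I)) []"

lemma solve_Some:
  assumes "solve A I = Some (c, l)"
  shows "distinct l" "set l \<subseteq> set (int_tasks I)" "c = cost l"
    "\<forall>e < length (demands I). int_demands I ! e \<le> cover l e" "length l \<le> length (tasks I)"
proof -
  have dist: "distinct (int_tasks I)" by (simp add: int_tasks_def distinct_rows_of_tasks)
  have h: "length (demands I) - 0 < 2 ^ floorlog 2 (length (demands I))" using less_power_floorlog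
    by simp
  show "distinct l" "set l \<subseteq> set (int_tasks I)" "c = cost l"
    "\<forall>e < length (demands I). int_demands I ! e \<le> cover l e"
    using solve_interval_sound[OF dist assms[unfolded solve_def] h]
    by (auto simp: tasks_within_def covers_def)
  show "length l \<le> length (tasks I)"
    using length_solve_interval_le[OF dist assms[unfolded solve_def] h] by (simp add: int_tasks_def)
qed

definition prog_output :: "nat \<Rightarrow> ufp_instance \<Rightarrow> val" where
  "prog_output A I = (case solve A I of None \<Rightarrow> VNat 0
     | Some (c, l) \<Rightarrow> enc_nats (map (\<lambda>t. row_index t) l))"

lemma enc_rat_eq: "enc_rat q = VPair (VNat (rat_num q)) (VNat (rat_den q))"
  by (simp add: enc_rat_def rat_num_def rat_den_def)

lemma enc_task_eq: "enc_task j = VPair (VNat (start_vertex j)) (VPair (VNat (end_vertex j))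
    (VPair (VPair (VNat (rat_num (task_size j))) (VNat (rat_den (task_size j))))
    (VPair (VPair (VNat (rat_num (task_cost j))) (VNat (rat_den (task_cost j)))) (VNat 0))))"
  by (simp add: enc_task_def enc_rat_eq)

lemma calls_cost_den:
  "\<forall>j\<in>set js. floorlog 2 (rat_den (task_cost j)) \<le> N \<Longrightarrow>
    calls (prog A) fCostDen [enc_list (map enc_task js)] (VNat (cost_den js))
      (length js * (50 * N + 100) + 10)"
proof (induction js)
  case Nil
  show ?case by (rule callsI) (simp_all add: cost_den_body_def cost_den_def)
next
  case (Cons j js)
  then have "calls (prog A) fCostDen [enc_list (map enc_task js)] (VNat (cost_den js))
      (length js * (50 * N + 100) + 10)" by simp
  note rules = call_wpI[OF this] call_wpI[OF calls_mul]
  show ?case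
    using Cons.prems by (intro callsI) (auto simp: cost_den_body_def cost_den_def enc_task_eq[of j]
      intro!: rules[unfolded cost_den_def])
qed

lemma calls_rows:
  "\<forall>j\<in>set js. floorlog 2 (rat_num (task_cost j)) \<le> N \<Longrightarrow>
    calls (prog A) fRows [enc_list (map enc_task js), VNat i, VNat d]
      (enc_rows (rows_of_tasks d i js)) (length js * (50 * N + 200) + 10)"
proof (induction js arbitrary: i)
  case Nil
  show ?case by (rule callsI) (simp_all add: rows_body_def)
next
  case (Cons j js)
  then have "calls (prog A) fRows [enc_list (map enc_task js), VNat (Suc i), VNat d]
      (enc_rows (rows_of_tasks d (Suc i) js)) (length js * (50 * N + 200) + 10)" by simp
  note rules = call_wpI[OF this] call_wpI[OF calls_mul]
  show ?case
    using Cons.prems by (intro callsI)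
      (auto simp: rows_body_def row_of_task_def enc_task_eq[of j] intro!: rules)
qed

lemma calls_ceilings:
  "calls (prog A) fCeilings [enc_list (map enc_rat us)] (enc_nats (map rat_ceil us))
    (100 * length us + 10)"
proof (induction us)
  case Nil
  show ?case by (rule callsI) (simp_all add: ceilings_body_def)
next
  case (Cons u us)
  show ?case
    by (rule callsI) (auto simp: ceilings_body_def enc_rat_eq[of u] rat_ceil_def[of u]
      intro!: call_wpI[OF Cons.IH])
qed

lemma val_size_less_enc_list: "v \<in> set vs \<Longrightarrow> val_size v < val_size (enc_list vs)"
  by (induction vs) (auto simp: floorlog_def)

lemma length_less_val_size_enc_list: "length vs < val_size (enc_list vs)"
  by (induction vs) (auto simp: floorlog_def)

lemma max_bits_less_val_size: "max_bits v < val_size v"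
  by (induction v) auto

lemma less_input_size:
  "length (demands I) < input_size I" "length (tasks I) < input_size I"
  "j \<in> set (tasks I) \<Longrightarrow> floorlog 2 (rat_num (task_cost j)) < input_size I"
  "j \<in> set (tasks I) \<Longrightarrow> floorlog 2 (rat_den (task_cost j)) < input_size I"
proof -
  have I: "input_size I =
      1 + val_size (enc_list (map enc_rat (demands I))) +
      val_size (enc_list (map enc_task (tasks I)))"
    by (simp add: input_size_def enc_instance_def)
  show "length (demands I) < input_size I" "length (tasks I) < input_size I"
    using length_less_val_size_enc_list[of "map enc_rat (demands I)"]
      length_less_val_size_enc_list[of "map enc_task (tasks I)"] I by simp_all
  assume "j \<in> set (tasks I)"
  then have "val_size (enc_task j) < input_size I"
    using val_size_less_enc_list[of "enc_task j" "map enc_task (tasks I)"] I by simp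
  then show "floorlog 2 (rat_num (task_cost j)) < input_size I"
    "floorlog 2 (rat_den (task_cost j)) < input_size I"
    by (simp_all add: enc_task_eq)
qed

definition main_time :: "nat \<Rightarrow> nat \<Rightarrow> nat \<Rightarrow> nat" where
  "main_time A N L = 100 * N * N + 1000 * (N + L + A + 1) +
     solve_time (1000 * (N + N * N + N + 10)) N (L * L * A) (floorlog 2 N)"

lemma main_time_mono: "L \<le> L' \<Longrightarrow> main_time A N L \<le> main_time A N L'"
  unfolding main_time_def solve_time_def
  by (intro add_mono mult_le_mono power_mono power_increasing) auto

lemma calls_solve_instance:
  fixes I A
  defines "N \<equiv> input_size I" and "K \<equiv> size_bits I * size_bits I * A"
  shows "calls (prog A) fSolve
    [VPair (enc_nats (int_demands I)) (VPair (enc_rows (int_tasks I)) (VNat K)), VNat 0,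
      VNat (length (demands I)), VNat 0]
    (enc_result (solve A I)) (solve_time (1000 * (N + N * N + N + 10)) N K (floorlog 2 N))"
proof -
  define h where "h = floorlog 2 (length (demands I))"
  interpret solve_context A K N "h * N" "int_demands I" "int_tasks I"
    using less_input_size(2)[of I]
    by unfold_locales
      (simp_all add: int_tasks_def proper_rows_of_tasks distinct_rows_of_tasks N_def)
  have N: "length (demands I) \<le> N" using less_input_size(1)[of I] by (simp add: N_def)
  then have h: "h \<le> floorlog 2 N" unfolding h_def by (rule floorlog_mono)
  have "length (demands I) < 2 ^ length (demands I)" by simp
  then have "h \<le> length (demands I)" unfolding h_def by (simp add: floorlog_le_iff)
  then have "h * N \<le> N * N" using N by (intro mult_le_mono1) simp
  moreover have "length (int_demands I) \<le> N" using N by (simp add: int_demands_def)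
  ultimately have "node_time \<le> 1000 * (N + N * N + N + 10)"
    unfolding node_time_def by (intro mult_le_mono2 add_mono order_refl)
  then have time: "solve_time node_time N K h
      \<le> solve_time (1000 * (N + N * N + N + 10)) N K (floorlog 2 N)"
    unfolding solve_time_def using h by (intro mult_le_mono power_increasing) auto
  have "calls (prog A) fSolve [problem, VNat 0, VNat (length (demands I)), enc_rows []]
      (enc_result (solve_interval (int_demands I) (int_tasks I) K h 0 (length (demands I)) []))
      (solve_time node_time N K h)"
    using calls_solve[of h, unfolded solves_def] less_power_floorlog
    by (simp add: h_def int_demands_def)
  from calls_mono[OF this[unfolded problem_def] time] show ?thesis
    by (simp only: solve_def K_def h_def enc_rows_simps)
qed

lemma calls_preprocessing:
  fixes I
  defines "N \<equiv> input_size I" and "L \<equiv> size_bits I" and "js \<equiv> enc_list (map enc_task (tasks I))"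
  shows "calls (prog A) fCostDen [js] (VNat (cost_den (tasks I))) (50 * N * N + 100 * N + 10)"
      (is ?cost_den)
    and "calls (prog A) fRows [js, VNat 0, VNat (cost_den (tasks I))] (enc_rows (int_tasks I))
      (50 * N * N + 200 * N + 10)" (is ?rows)
    and "calls (prog A) fCeilings [enc_list (map enc_rat (demands I))] (enc_nats (int_demands I))
      (100 * N + 10)" (is ?ceilings)
    and "calls (prog A) fSum [enc_rows (int_tasks I), VNat 2] (VNat (total_size I)) (100 * N + 10)"
      (is ?sum)
    and "calls (prog A) fBits [VNat (Suc (total_size I))] (VNat L) (20 * L + 10)" (is ?bits)
    and "calls (prog A) fLength [enc_nats (int_demands I)] (VNat (length (demands I)))
      (10 * N + 10)" (is ?length)
proof -
  have N: "length (tasks I) \<le> N" "length (demands I) \<le> N"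
    "\<forall>j\<in>set (tasks I). floorlog 2 (rat_den (task_cost j)) \<le> N"
    "\<forall>j\<in>set (tasks I). floorlog 2 (rat_num (task_cost j)) \<le> N"
    using less_input_size[where I = I] by (auto simp: N_def intro: less_imp_le)
  show ?cost_den
    using mult_le_mono1[OF N(1), of "50 * N + 100"] unfolding js_def
    by (intro calls_mono[OF calls_cost_den[OF N(3)]]) (simp add: algebra_simps)
  show ?rows
    using mult_le_mono1[OF N(1), of "50 * N + 200"] unfolding js_def int_tasks_def
    by (intro calls_mono[OF calls_rows[OF N(4)]]) (simp add: algebra_simps)
  show ?ceilings
    unfolding int_demands_def using N(2) by (intro calls_mono[OF calls_ceilings]) simp
  show ?sum
    using N(1) calls_mono[OF calls_sum[of 2 "int_tasks I" A], of "100 * N + 10"]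
    by (simp add: sum_row_size_int_tasks) (simp add: int_tasks_def proper_rows_of_tasks)
  show ?bits
    unfolding L_def size_bits_def by (rule calls_bits)
  show ?length
    using N(2) calls_mono[OF calls_length[of A "map VNat (int_demands I)"], of "10 * N + 10"]
    by (simp add: enc_nats_def int_demands_def)
qed

lemma calls_main:
  "calls (prog A) 0 [enc_instance I] (prog_output A I) (main_time A (input_size I) (size_bits I))"
proof -
  define N L where "N = input_size I" and "L = size_bits I"
  have bits: "floorlog 2 L \<le> L" "floorlog 2 A \<le> A" by (simp_all add: floorlog_le_iff)
  then have "calls (prog A) fMul [VNat L, VNat L] (VNat (L * L)) (50 * L + 10)"
    "calls (prog A) fMul [VNat (L * L), VNat A] (VNat (L * L * A)) (50 * A + 10)"
    by (auto intro: calls_mono[OF calls_mul])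
  note rules = this calls_preprocessing[where I = I and A = A, folded N_def L_def]
    calls_solve_instance[where I = I and A = A, folded N_def L_def]
  note rules = rules[THEN call_wpI]
  show ?thesis
  proof (cases "solve A I")
    case None
    then show ?thesis
      by (intro callsI) (auto simp: main_body_def enc_instance_def prog_output_def main_time_def
        simp flip: N_def L_def intro!: rules)
  next
    case (Some p)
    obtain c l where p: "p = (c, l)" by fastforce
    note l = solve_Some[OF Some[unfolded p]]
    have "proper_rows l"
      using proper_rows_of_tasks l(2) unfolding int_tasks_def by (rule proper_rows_subset)
    moreover have "length l \<le> N" using l(5) less_input_size(2)[of I] by (simp add: N_def)
    ultimately have "calls (prog A) fIndices [enc_rows l] (enc_nats (map (\<lambda>t. row_index t) l))
      (120 * N + 10)"
      by (intro calls_mono[OF calls_indices]) auto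
    note rules = rules this[THEN call_wpI]
    show ?thesis
      using Some p
      by (intro callsI) (auto simp: main_body_def enc_instance_def prog_output_def main_time_def
        simp flip: N_def L_def intro!: rules)
  qed
qed

locale integral_instance =
  fixes I :: ufp_instance
  assumes valid: "valid_instance I"
    and integral: "\<And>j. j \<in> set (tasks I) \<Longrightarrow> task_size j \<in> \<int>"
begin

definition int_task :: "nat \<Rightarrow> row" where
  "int_task i = row_of_task (cost_den (tasks I)) i (tasks I ! i)"

lemma set_int_tasks: "set (int_tasks I) = int_task ` task_indices I"
  by (force simp: int_tasks_def rows_of_tasks_def int_task_def task_indices_def
    in_set_enumerate_eq image_iff)

lemma int_task_nth:
  "row_start (int_task i) = start_vertex (tasks I ! i)"
  "row_end (int_task i) = end_vertex (tasks I ! i)"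
  "row_size (int_task i) = rat_num (task_size (tasks I ! i))" "row_index (int_task i) = i"
  by (simp_all add: int_task_def row_of_task_def)

lemma inj_int_task: "inj_on int_task S"
  by (rule inj_onI) (metis int_task_nth(4))

lemma task_bounds:
  assumes "i \<in> task_indices I"
  shows "end_vertex (tasks I ! i) \<le> length (demands I)" "0 \<le> task_cost (tasks I ! i)"
    "task_size (tasks I ! i) = of_nat (row_size (int_task i))" "0 < row_size (int_task i)"
proof -
  have j: "tasks I ! i \<in> set (tasks I)" using assms by (simp add: task_indices_def)
  show "end_vertex (tasks I ! i) \<le> length (demands I)" "0 \<le> task_cost (tasks I ! i)"
    using valid j by (auto simp: valid_instance_def)
  have pos: "0 < task_size (tasks I ! i)" using valid j by (auto simp: valid_instance_def)
  then show size: "task_size (tasks I ! i) = of_nat (row_size (int_task i))"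
    unfolding int_task_nth using integral[OF j] by (intro rat_eq_num) auto
  show "0 < row_size (int_task i)" using pos unfolding size by (rule of_nat_0_less_iff[THEN iffD1])
qed

lemma row_cost_int_task:
  assumes "i \<in> task_indices I"
  shows "of_nat (row_cost (int_task i)) = of_nat (cost_den (tasks I)) * task_cost (tasks I ! i)"
proof -
  let ?c = "task_cost (tasks I ! i)" and ?D = "cost_den (tasks I)"
  have "tasks I ! i \<in> set (tasks I)" using assms by (simp add: task_indices_def)
  then have "rat_den ?c dvd ?D" unfolding cost_den_def by (intro prod_list_dvd) auto
  then obtain k where k: "?D = rat_den ?c * k" by blast
  have d: "0 < rat_den ?c" by (rule rat_den_pos)
  have "row_cost (int_task i) = k * rat_num ?c"
    using d by (simp add: int_task_def row_of_task_def k)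
  moreover have "of_nat ?D * ?c = of_nat k * of_nat (rat_num ?c)"
    using d by (subst rat_eq_num_den[OF task_bounds(2)[OF assms]]) (simp add: k)
  ultimately show ?thesis by simp
qed

lemma set_cost_int_task:
  assumes "S \<subseteq> task_indices I"
  shows "of_nat (set_cost (int_task ` S)) = of_nat (cost_den (tasks I)) * total_cost I S"
proof -
  have "set_cost (int_task ` S) = (\<Sum>i\<in>S. row_cost (int_task i))"
    unfolding set_cost_def using inj_int_task by (simp add: sum.reindex)
  then have "of_nat (set_cost (int_task ` S)) = (\<Sum>i\<in>S. of_nat (row_cost (int_task i)) :: rat)"
    by simp
  also have "\<dots> = (\<Sum>i\<in>S. of_nat (cost_den (tasks I)) * task_cost (tasks I ! i))"
    using assms by (intro sum.cong refl row_cost_int_task) auto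
  finally show ?thesis by (simp add: total_cost_def sum_distrib_left)
qed

lemma set_cover_int_task:
  assumes "S \<subseteq> task_indices I"
  shows "of_nat (set_cover (int_task ` S) e) = (\<Sum>i \<in> S \<inter> tasks_using I e. task_size (tasks I ! i))"
proof -
  have finS: "finite S" using assms finite_subset by (auto simp: task_indices_def)
  have "set_cover (int_task ` S) e =
      (\<Sum>i\<in>S. if uses (int_task i) e then row_size (int_task i) else 0)"
    unfolding set_cover_def using inj_int_task by (simp add: sum.reindex)
  then have "of_nat (set_cover (int_task ` S) e)
      = (\<Sum>i\<in>S. if uses (int_task i) e then of_nat (row_size (int_task i)) else 0 :: rat)"
    by (simp add: of_nat_sum if_distrib cong: if_cong)
  also have "\<dots> = (\<Sum>i\<in>S. if i \<in> tasks_using I e then task_size (tasks I ! i) else 0)"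
  proof (intro sum.cong refl)
    fix i assume "i \<in> S"
    then have i: "i \<in> task_indices I" using assms by blast
    then have "uses (int_task i) e \<longleftrightarrow> i \<in> tasks_using I e"
      unfolding uses_def int_task_nth tasks_using_def by simp
    then show "(if uses (int_task i) e then of_nat (row_size (int_task i)) else 0)
        = (if i \<in> tasks_using I e then task_size (tasks I ! i) else 0)"
      using task_bounds(3)[OF i] by simp
  qed
  also have "\<dots> = (\<Sum>i \<in> S \<inter> tasks_using I e. task_size (tasks I ! i))"
    using finS by (simp add: sum.inter_restrict)
  finally show ?thesis .
qed

lemma feasible_iff:
  "feasible I S \<longleftrightarrow> S \<subseteq> task_indices I \<and>
     (\<forall>e < length (demands I). int_demands I ! e \<le> set_cover (int_task ` S) e)"
proof -
  have "int_demands I ! e \<le> set_cover (int_task ` S) e \<longleftrightarrow>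
      demands I ! e \<le> (\<Sum>i \<in> S \<inter> tasks_using I e. task_size (tasks I ! i))"
    if "S \<subseteq> task_indices I" "e < length (demands I)" for e
  proof -
    have "0 \<le> demands I ! e" using valid that(2) by (auto simp: valid_instance_def)
    then show ?thesis
      using that(2) set_cover_int_task[OF that(1), of e]
      by (simp add: int_demands_def rat_ceil_le_iff)
  qed
  then show ?thesis by (auto simp: feasible_def)
qed

lemma size_bits_bounds:
  "t \<in> set (int_tasks I) \<Longrightarrow> 0 < row_size t \<and> row_size t \<le> 2 ^ size_bits I"
  "length (int_tasks I) \<le> 2 ^ size_bits I" "0 < size_bits I"
proof -
  have total: "total_size I < 2 ^ size_bits I"
    using less_power_floorlog[of "Suc (total_size I)"] by (simp add: size_bits_def)
  have pos: "0 < row_size t" if "t \<in> set (int_tasks I)" for t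
    using that task_bounds(4) by (auto simp: set_int_tasks)
  have "row_size t \<le> total_size I" if "t \<in> set (int_tasks I)" for t
    unfolding sum_row_size_int_tasks[symmetric] using that by (intro member_le_sum_list) auto
  then show "t \<in> set (int_tasks I) \<Longrightarrow> 0 < row_size t \<and> row_size t \<le> 2 ^ size_bits I"
    using pos total by (meson le_trans less_imp_le)
  have "length ts \<le> (\<Sum>t\<leftarrow>ts. row_size t)" if "\<forall>t\<in>set ts. 0 < row_size t" for ts
    using that by (induction ts) (auto simp: Suc_le_eq)
  then show "length (int_tasks I) \<le> 2 ^ size_bits I"
    using pos total sum_row_size_int_tasks[of I] by (metis le_trans less_imp_le)
  show "0 < size_bits I" unfolding size_bits_def by (rule gr0I) (simp add: floorlog_eq_zero_iff)
qed

lemma solve_sound: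
  assumes "solve A I = Some (c, l)"
  shows "\<exists>S. encodes_set (prog_output A I) S \<and> feasible I S \<and>
    of_nat c = of_nat (cost_den (tasks I)) * total_cost I S"
proof -
  note l = solve_Some[OF assms]
  define S where "S = {i \<in> task_indices I. int_task i \<in> set l}"
  have S: "S \<subseteq> task_indices I" "int_task ` S = set l" using l(2) by (auto simp: S_def set_int_tasks)
  have "(\<lambda>t. row_index t) ` set l = S"
    unfolding S(2)[symmetric] by (simp add: image_image int_task_nth)
  moreover have "inj_on (\<lambda>t. row_index t) (set l)"
    unfolding S(2)[symmetric] by (auto simp: inj_on_def int_task_nth)
  ultimately have "encodes_set (prog_output A I) S"
    unfolding encodes_set_def using assms l(1)
    by (intro exI[of _ "map (\<lambda>t. row_index t) l"])
      (auto simp: prog_output_def enc_nats_def distinct_map)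
  moreover have "feasible I S"
    unfolding feasible_iff S(2) using S(1) l(1,4) by (simp add: cover_eq_set_cover)
  moreover have "of_nat c = of_nat (cost_den (tasks I)) * total_cost I S"
    using set_cost_int_task[OF S(1)] l(1,3) S(2) by (simp add: cost_eq_set_cost)
  ultimately show ?thesis by blast
qed

lemma selection_length_le:
  assumes "0 < L"
  shows "selection_length D L \<le> L * L * selection_length D 1"
proof -
  have "D * L + 1 \<le> L * (D + 1)" using assms by (simp add: algebra_simps)
  moreover have "1 * (D * D + 1) \<le> L * (D * D + 1)" using assms by (intro mult_le_mono1) simp
  then have "D * (D + L) + 1 \<le> L * (D * (D + 1) + 1)" by (simp add: algebra_simps)
  ultimately have "(D * L + 1) * (D * (D + L) + 1) * group_length D
      \<le> (L * (D + 1)) * (L * (D * (D + 1) + 1)) * group_length D"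
    by (intro mult_le_mono1 mult_le_mono)
  also have "\<dots> = L * L * ((D + 1) * (D * (D + 1) + 1) * group_length D)" by (simp only: mult_ac)
  finally have "(D * L + 1) * (D * (D + L) + 1) * group_length D
      \<le> L * L * ((D + 1) * (D * (D + 1) + 1) * group_length D)" .
  moreover have "2 \<le> L * L * 2" using assms by simp
  ultimately show ?thesis
    unfolding selection_length_def distrib_left[of "L * L"] mult_1_right by (intro add_mono)
qed

lemma solve_complete:
  assumes D: "0 < D" and feas: "feasible I S"
  shows "\<exists>c l. solve (selection_length D 1) I = Some (c, l) \<and>
    of_nat (D * c) \<le> of_nat (D + 26) * (of_nat (cost_den (tasks I)) * total_cost I S)"
proof -
  let ?Q = "int_task ` S"
  have S: "S \<subseteq> task_indices I" "\<And>e. e < length (demands I) \<Longrightarrow> int_demands I ! e \<le> set_cover ?Q e"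
    using feas by (auto simp: feasible_iff)
  have "?Q \<subseteq> tasks_within (int_tasks I) 0 (length (demands I))"
    using S(1) task_bounds(1)
    by (auto simp: tasks_within_def set_int_tasks int_task_nth simp del: One_nat_def)
  then have "\<exists>c l. solve (selection_length D 1) I = Some (c, l) \<and> D * c \<le> (D + 26) * set_cost ?Q"
    unfolding solve_def using size_bits_bounds S(2) less_power_floorlog
    by (intro solve_interval_complete[OF _ D, where L = "size_bits I"] selection_length_le)
      (auto simp: int_tasks_def distinct_rows_of_tasks covers_def)
  then obtain c l where cl: "solve (selection_length D 1) I = Some (c, l)"
    "D * c \<le> (D + 26) * set_cost ?Q"
    by blast
  have "(of_nat (D * c) :: rat) \<le> of_nat ((D + 26) * set_cost ?Q)"
    using cl(2) by (simp only: of_nat_le_iff)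
  also have "\<dots> = of_nat (D + 26) * (of_nat (cost_den (tasks I)) * total_cost I S)"
    by (simp only: of_nat_mult set_cost_int_task[OF S(1)])
  finally show ?thesis using cl(1) by blast
qed

lemma ex_optimal:
  assumes "feasible I S"
  obtains S' where "feasible I S'" "total_cost I S' = opt_cost I"
proof -
  have "finite {S. feasible I S}"
    by (rule finite_subset[of _ "Pow (task_indices I)"]) (auto simp: feasible_def task_indices_def)
  then have "opt_cost I \<in> total_cost I ` {S. feasible I S}"
    unfolding opt_cost_def using assms by (intro Min_in) auto
  then show ?thesis using that by auto
qed

lemma prog_output_approx:
  assumes D: "0 < D" "26 / \<epsilon> \<le> real D" and \<epsilon>: "0 < \<epsilon>" and feas: "feasible I S0"
  shows "\<exists>S. encodes_set (prog_output (selection_length D 1) I) S \<and> approx_solution \<epsilon> I S"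
proof -
  let ?d = "of_nat (cost_den (tasks I)) :: rat"
  obtain S1 where S1: "feasible I S1" "total_cost I S1 = opt_cost I" using feas by (rule ex_optimal)
  obtain c l where cl: "solve (selection_length D 1) I = Some (c, l)"
    "of_nat (D * c) \<le> of_nat (D + 26) * (?d * opt_cost I)"
    using solve_complete[OF D(1) S1(1)] S1(2) by auto
  obtain S where S: "encodes_set (prog_output (selection_length D 1) I) S" "feasible I S"
    "of_nat c = ?d * total_cost I S" using solve_sound[OF cl(1)] by blast
  have opt: "0 \<le> opt_cost I"
    unfolding S1(2)[symmetric] total_cost_def using S1(1) task_bounds(2)
    by (intro sum_nonneg) (auto simp: feasible_def)
  have "?d * (of_nat D * total_cost I S) \<le> ?d * (of_nat (D + 26) * opt_cost I)"
    using cl(2) S(3) by (simp add: mult_ac)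
  then have "of_nat D * total_cost I S \<le> of_nat (D + 26) * opt_cost I" using cost_den_pos by simp
  then have "real_of_rat (of_nat D * total_cost I S) \<le> real_of_rat (of_nat (D + 26) * opt_cost I)"
    by (simp only: of_rat_less_eq)
  then have "real D * real_of_rat (total_cost I S) \<le> (real D + 26) * real_of_rat (opt_cost I)"
    by (simp add: of_rat_mult of_rat_add)
  also have "\<dots> \<le> (real D * (1 + \<epsilon>)) * real_of_rat (opt_cost I)"
    using D(2) \<epsilon> opt by (intro mult_right_mono) (auto simp: field_simps)
  finally have "real_of_rat (total_cost I S) \<le> (1 + \<epsilon>) * real_of_rat (opt_cost I)"
    using D(1) by (simp add: mult.assoc)
  then show ?thesis using S by (auto simp: approx_solution_def)
qed

end

section \<open>Running time\<close>

definition total_time :: "nat \<Rightarrow> nat \<Rightarrow> nat \<Rightarrow> nat" where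
  "total_time A N L = bit_cost N (main_time A N L)"

lemma computes_prog:
  assumes "size_bits I \<le> L"
  shows "\<exists>k. computes (prog A) (enc_instance I) (prog_output A I) k \<and>
    k \<le> total_time A (input_size I) L"
proof -
  have "\<forall>x\<in>set [enc_instance I]. max_bits x \<le> input_size I"
    using max_bits_less_val_size[of "enc_instance I"] by (simp add: input_size_def)
  moreover have "runs (prog A) [enc_instance I] (main_body A) (prog_output A I)
    (main_time A (input_size I) (size_bits I))"
    using calls_main unfolding calls_def by simp
  ultimately obtain k where "eval (prog A) [enc_instance I] (main_body A) (prog_output A I) k"
    "k \<le> bit_cost (input_size I) (main_time A (input_size I) (size_bits I))" by (metis runsE)
  then show ?thesis
    using le_trans[OF _ bit_cost_mono[OF main_time_mono[OF assms]]]
    unfolding computes_def total_time_def by auto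
qed

lemma size_bits_le:
  assumes valid: "valid_instance I" and sizes: "integral_sizes_upto I b"
  shows "size_bits I \<le> floorlog 2 (input_size I * nat \<lfloor>b\<rfloor> + 1)"
proof -
  have "rat_num (task_size j) \<le> nat \<lfloor>b\<rfloor>" if j: "j \<in> set (tasks I)" for j
  proof -
    have "task_size j = of_nat (rat_num (task_size j))"
      using valid sizes j
      by (intro rat_eq_num) (auto simp: valid_instance_def integral_sizes_upto_def less_imp_le)
    then have "real (rat_num (task_size j)) = real_of_rat (task_size j)" by (metis of_rat_of_nat_eq)
    also have "\<dots> \<le> b" using sizes j by (simp add: integral_sizes_upto_def)
    finally show ?thesis by (simp add: le_nat_floor)
  qed
  then have "total_size I \<le> (\<Sum>j\<leftarrow>tasks I. nat \<lfloor>b\<rfloor>)"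
    unfolding total_size_def by (rule sum_list_mono)
  also have "\<dots> = length (tasks I) * nat \<lfloor>b\<rfloor>" by (simp add: sum_list_triv)
  also have "\<dots> \<le> input_size I * nat \<lfloor>b\<rfloor>"
    using less_input_size(2)[of I] by (intro mult_le_mono1) simp
  finally show ?thesis unfolding size_bits_def by (intro floorlog_mono) simp
qed

lemma quasi_poly_total_time:
  assumes "quasi_poly b"
  shows "quasi_poly (\<lambda>N. real (total_time A N (floorlog 2 (N * nat \<lfloor>b N\<rfloor> + 1))))"
proof -
  define L where "L N = floorlog 2 (N * nat \<lfloor>b N\<rfloor> + 1)" for N
  note closure = quasi_poly_add quasi_poly_mult quasi_poly_power quasi_poly_const quasi_poly_of_nat
    polylog_mult polylog_const
  note hom = of_nat_add of_nat_mult of_nat_power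
  have "quasi_poly (\<lambda>N. real (N * nat \<lfloor>b N\<rfloor> + 1))"
    unfolding hom by (intro closure quasi_poly_nat_floor assms) auto
  then have L: "polylog (\<lambda>N. real (L N))" unfolding L_def by (rule polylog_floorlog)
  then have "polylog (\<lambda>N. real (L N * L N * A))" unfolding hom by (intro closure) auto
  then have "quasi_poly (\<lambda>N. real (main_time A N (L N)))"
    unfolding main_time_def solve_time_def hom
    by (intro closure quasi_poly_of_polylog[OF L] polylog_floorlog[OF quasi_poly_of_nat]) auto
  then show ?thesis
    unfolding total_time_def bit_cost_def hom L_def[symmetric]
    by (intro closure) auto
qed

theorem theorem1:
  fixes \<epsilon> :: real
  assumes "\<epsilon> > 0"
  shows "\<exists>P :: program. \<forall>b. quasi_poly b \<longrightarrow>
    (\<exists>t. quasi_poly t \<and>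
      (\<forall>I. valid_instance I \<and> integral_sizes_upto I (b (input_size I)) \<longrightarrow>
        (\<exists>v k. computes P (enc_instance I) v k \<and> real k \<le> t (input_size I) \<and>
          ((\<exists>S. feasible I S) \<longrightarrow>
            (\<exists>S. encodes_set v S \<and> approx_solution \<epsilon> I S)))))"
proof -
  define D where "D = nat \<lceil>26 / \<epsilon>\<rceil>"
  have D: "0 < D" "26 / \<epsilon> \<le> real D" using assms by (auto simp: D_def real_nat_ceiling_ge)
  define A where "A = selection_length D 1"
  define t where "t b N = real (total_time A N (floorlog 2 (N * nat \<lfloor>b N\<rfloor> + 1)))"
    for b :: "nat \<Rightarrow> real" and N
  have "\<exists>v k. computes (prog A) (enc_instance I) v k \<and> real k \<le> t b (input_size I) \<and>
      ((\<exists>S. feasible I S) \<longrightarrow> (\<exists>S. encodes_set v S \<and> approx_solution \<epsilon> I S))"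
    if I: "valid_instance I" "integral_sizes_upto I (b (input_size I))" for b I
  proof -
    interpret integral_instance I
      by unfold_locales (use I in \<open>auto simp: integral_sizes_upto_def\<close>)
    show ?thesis
      using computes_prog[OF size_bits_le[OF I], of A] prog_output_approx[OF D assms]
      unfolding t_def A_def by (metis of_nat_le_iff)
  qed
  then show ?thesis using quasi_poly_total_time[of _ A, folded t_def] by blast
qed

end
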